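(* Let $\mathbf P_\Sigma$ be a complete simplicial toric variety with a semiample anticanonical degree, such that the minimal lattice generators $e_1,\dots,e_n$ of the 1-dimensional cones of $\Sigma$ lie on the boundary of the reflexive polytope $\Delta^\circ$ and include all lattice points $e_{i_0},\dots,e_{i_{k+1}}$ (in consecutive order) of one of the edges $\Gamma^*\subset\Delta^\circ$. Let $X\subset\mathbf P_\Sigma$ be a semiample anticanonical nondegenerate hypersurface defined by a homogeneous polynomial $$f(x)=\sum_{m\in\Delta\cap M}a_m\prod_{i=1}^nx_i^{1+\langle m,e_i\rangle}.$$ Then the complete intersection in $\mathbf P_{\Sigma(\Gamma^* )}$ given by $$s_{j+1}t_j=s_jt_{j-1},\quad j=1,\dots,k,\qquad\text{and}\qquad\sum_{m\in\Delta\cap M}a_mX_m\prod_{e_i\notin\Gamma^*}y_i^{1+\langle m,e_i\rangle}=0$$ (which is isomorphic to $X$ via $\phi_{\Gamma^*}$) is quasismooth in the toric variety $\mathbf P_{\Sigma(\Gamma^* )}$.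
   Context: **Toric varieties.** $N$ is a lattice of rank $d$, $M=\mathrm{Hom}(N,\mathbb{Z})$, $N_{\mathbb R}=N\otimes\mathbb R$, $M_{\mathbb R}=M\otimes\mathbb R$, and $\langle\,,\,\rangle$ is the pairing. Let $\Sigma$ be a fan in $N_{\mathbb R}$ whose 1-dimensional cones span $N_{\mathbb R}$ and have minimal integral generators $e_1,\dots,e_n$. Let $x_1,\dots,x_n$ be the corresponding coordinates on $\mathbb C^n$, $B(\Sigma)=\langle\prod_{e_i\notin\sigma}x_i:\sigma\in\Sigma\rangle\subset\mathbb C[x_1,\dots,x_n]$, and $G(\Sigma)=\{(x_i)\in(\mathbb C^* )^n:\prod_{i}x_i^{\langle m,e_i\rangle}=1\ \forall m\in M\}$. The toric variety is the categorical quotient $\mathbf P_\Sigma=(\mathbb C^n\setminus\mathbf V(B(\Sigma)))/G(\Sigma)$ over $\mathbb C$ (a geometric quotient if $\Sigma$ is simplicial), and $S=S(\Sigma)=\mathbb C[x_1,\dots,x_n]$ is its homogeneous coordinate ring, graded by the Chow group $A_{d-1}(\mathbf P_\Sigma)$ with $\deg x_i=[D_i]$, $D_i=\{x_i=0\}$. The anticanonical degree is $\beta=[\sum_iD_i]$. It is semiample if $\mathcal O(\sum_i D_i)$ is a line bundle generated by global sections. An anticanonical hypersurface $X=\{f=0\}$, $f\in S_\beta$, is nondegenerate if the polynomials $x_i\,\partial f/\partial x_i$, $i=1,\dots,n$, do not vanish simultaneously on $\mathbf P_\Sigma$. **Polytopes.** $\Delta=\{m\in M_{\mathbb R}:\langle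 m,e_i\rangle\ge-1\ \forall i\}$ and $\Delta^\circ=\{n\in N_{\mathbb R}:\langle m,n\rangle\ge-1\ \forall m\in\Delta\}$. When $\beta$ is semiample and $\Sigma$ is complete, $\Delta$ is reflexive (its vertices are lattice points, its only interior lattice point is $0$, and the same holds for $\Delta^\circ$), all $e_i$ lie on the boundary of $\Delta^\circ$, and $\Sigma$ is a subdivision of the fan whose cones are the cones over the faces of $\Delta^\circ$. **The fan $\Sigma(\Gamma^* )$.** Let $\Gamma^*$ be an edge of $\Delta^\circ$ all of whose lattice points are among $e_1,\dots,e_n$, ordered consecutively along $\Gamma^*$ as $e_{i_0},e_{i_1},\dots,e_{i_{k+1}}$ (so $e_{i_1},\dots,e_{i_k}$ are the interior lattice points). Let $v_1,\dots,v_k$ be the standard basis of $\mathbb Z^k$. In $N\oplus\mathbb Z^k$ put $\tilde e_{s_j}=v_j$ for $j=1,\dots,k$; $\tilde e_{s_{k+1}}=e_{i_0}-v_1-\cdots-v_k$; $\tilde e_{t_{j-1}}=v_j+\frac1{k+1}(e_{i_{k+1}}-e_{i_0})$ for $j=1,\dots,k$; $\tilde e_{t_k}=e_{i_0}-v_1-\cdots-v_k+\frac1{k+1}(e_{i_{k+1}}-e_{i_0})$; and $\tilde e_i=e_i$ for $e_i\notin\Gamma^*$. $\Sigma(\Gamma^* )$ is the simplicial fan in $N_{\mathbb R}\oplus\mathbb R^k$ consisting of the following cones, for $\sigma\in\Sigma$, together with all their faces (where $\sigma\cap\Gamma^*$ is recorded by the generators $e_i$ of $\sigma$ lying in $\Gamma^*$):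 (i) $\sigma$ (viewed as $\sigma\oplus\mathbf 0$), if $\sigma\cap\Gamma^*=\emptyset$; (ii) the cone generated by the $e_i\in\sigma\setminus\{e_{i_j}\}$ and $\tilde e_{t_0},\dots,\tilde e_{t_{j-1}},\tilde e_{s_{j+1}},\dots,\tilde e_{s_{k+1}}$, if $e_{i_j}$ is the only generator of $\sigma$ in $\Gamma^*$; (iii) the cone generated by the $e_i\in\sigma$ with $e_i\notin\Gamma^*$ and $\tilde e_{t_0},\dots,\tilde e_{t_j},\tilde e_{s_{j+1}},\dots,\tilde e_{s_{k+1}}$, if the generators of $\sigma$ in $\Gamma^*$ are exactly $e_{i_j},e_{i_{j+1}}$. The homogeneous coordinates of $\mathbf P_{\Sigma(\Gamma^* )}=(\mathbb C^{n+k}\setminus\mathbf V(B(\Sigma(\Gamma^* ))))/G(\Sigma(\Gamma^* ))$ corresponding to $\tilde e_{s_j},\tilde e_{t_j},\tilde e_i$ are denoted $s_j$ ($1\le j\le k+1$), $t_j$ ($0\le j\le k$), $y_i$ ($e_i\notin\Gamma^*$). **The embedding and the monomials $X_m$.** $\phi_{\Gamma^*}:\mathbf P_\Sigma\to\mathbf P_{\Sigma(\Gamma^* )}$ is the embedding $s_j=x_{i_0}\cdots x_{i_{j-1}}$, $t_j=x_{i_{j+1}}\cdots x_{i_{k+1}}$, $y_i=x_i$ ($e_i\notin\Gamma^*$). For $m\in\Delta\cap M$, $$X_m=\begin{cases}(s_1t_0)^{1+\langle m,e_{i_0}\rangle}(t_0\cdots t_k)^{\langle m,e_{i_1}-e_{i_0}\rangle}&\text{if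 }\langle m,e_{i_1}-e_{i_0}\rangle\ge0,\\(s_1t_0)^{1+\langle m,e_{i_{k+1}}\rangle}(s_1\cdots s_{k+1})^{\langle m,e_{i_0}-e_{i_1}\rangle}&\text{if }\langle m,e_{i_1}-e_{i_0}\rangle<0.\end{cases}$$ **Quasismooth.** A complete intersection in a simplicial toric variety defined by homogeneous polynomials $f_1,\dots,f_s$ in the homogeneous coordinates is quasismooth if the Jacobian matrix of $f_1,\dots,f_s$ with respect to all homogeneous coordinates has maximal rank $s$ at every common zero of $f_1,\dots,f_s$ in the complement of the zero set of the irrelevant ideal $B$. *)

theory Defs
  imports
    "HOL-Analysis.Analysis"
    "HOL-Analysis.Finite_Function_Topology"
    "Jordan_Normal_Form.DL_Rank"
begin

section \<open>Cones and fans\<close>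

definition polyhedral_cone :: "'v::real_vector set \<Rightarrow> 'v set \<Rightarrow> bool" where
  "polyhedral_cone N \<sigma> \<longleftrightarrow>
     (\<exists>S. finite S \<and> S \<subseteq> N \<and> \<sigma> = convex_cone hull S) \<and> \<sigma> \<inter> uminus ` \<sigma> = {0}"

text \<open>The library's \<^const>\<open>face_of\<close> also admits the empty set, which is not a face in the
  sense of toric geometry.\<close>

definition fan :: "'v::real_vector set \<Rightarrow> 'v set set \<Rightarrow> bool" where
  "fan N \<Sigma> \<longleftrightarrow> finite \<Sigma> \<and> \<Sigma> \<noteq> {} \<and> (\<forall>\<sigma>\<in>\<Sigma>. polyhedral_cone N \<sigma>) \<and>
     (\<forall>\<sigma>\<in>\<Sigma>. \<forall>\<tau>. \<tau> face_of \<sigma> \<and> \<tau> \<noteq> {} \<longrightarrow> \<tau> \<in> \<Sigma>) \<and>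
     (\<forall>\<sigma>\<in>\<Sigma>. \<forall>\<tau>\<in>\<Sigma>. (\<sigma> \<inter> \<tau>) face_of \<sigma> \<and> (\<sigma> \<inter> \<tau>) face_of \<tau>)"

definition complete_fan :: "'v::real_vector set set \<Rightarrow> bool" where
  "complete_fan \<Sigma> \<longleftrightarrow> \<Union>\<Sigma> = UNIV"

definition simplicial_fan :: "'v::real_vector set set \<Rightarrow> bool" where
  "simplicial_fan \<Sigma> \<longleftrightarrow> (\<forall>\<sigma>\<in>\<Sigma>. \<exists>S. independent S \<and> \<sigma> = convex_cone hull S)"

definition minimal_generators :: "'v::real_vector set \<Rightarrow> 'v set set \<Rightarrow> 'v set" where
  "minimal_generators N \<Sigma> =
     {u. u \<noteq> 0 \<and> (\<exists>\<rho>\<in>\<Sigma>. dim \<rho> = 1 \<and> \<rho> \<inter> N = {of_nat a *\<^sub>R u | a. True})}"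


section \<open>Toric varieties in homogeneous coordinates\<close>

text \<open>The fan is \<open>cones\<close>, in a vector space spanned by the lattice \<open>lat\<close>; the homogeneous
  coordinates are indexed by the members of the list \<open>vars\<close> (its order serves to number the
  columns of Jacobian matrices), and \<open>gens\<close> sends each index to the corresponding ray generator.\<close>

record ('v, 'i) toric =
  lat :: "'v set"
  cones :: "'v set set"
  vars :: "'i list"
  gens :: "'i \<Rightarrow> 'v"

abbreviation idx :: "('v, 'i) toric \<Rightarrow> 'i set" where
  "idx T \<equiv> set (vars T)"

text \<open>Points of \<open>\<complex>\<^sup>n\<close> are functions on the index set, extended by \<^const>\<open>undefined\<close>.\<close>

definition affine_space :: "('v, 'i) toric \<Rightarrow> ('i \<Rightarrow> complex) set" where
  "affine_space T = idx T \<rightarrow>\<^sub>E UNIV"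

definition irrelevant_locus :: "('v, 'i) toric \<Rightarrow> ('i \<Rightarrow> complex) set" where
  "irrelevant_locus T =
     {x \<in> affine_space T. \<forall>\<sigma>\<in>cones T. (\<Prod>i\<in>{i\<in>idx T. gens T i \<notin> \<sigma>}. x i) = 0}"

definition semistable :: "('v, 'i) toric \<Rightarrow> ('i \<Rightarrow> complex) set" where
  "semistable T = affine_space T - irrelevant_locus T"

text \<open>The divisors \<open>\<Sum>\<^sub>i \<langle>m, e\<^sub>i\<rangle> D\<^sub>i\<close> of the characters \<open>m \<in> M = Hom(N, \<int>)\<close>; an element of \<open>M\<close> is
  given by its linear extension to \<open>N\<^sub>\<real>\<close>. The Chow group \<open>A\<^sub>d\<^sub>-\<^sub>1\<close> is the group of all
  \<open>b :: 'i \<Rightarrow> int\<close>, read as \<open>\<Sum>\<^sub>i b\<^sub>i D\<^sub>i\<close>, modulo these.\<close>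

definition principal_divisors :: "('v::real_vector, 'i) toric \<Rightarrow> ('i \<Rightarrow> int) set" where
  "principal_divisors T =
     {b. \<exists>m. linear m \<and> (\<forall>v\<in>lat T. m v \<in> \<int>) \<and> (\<forall>i\<in>idx T. real_of_int (b i) = m (gens T i))}"

definition torus_group :: "('v::real_vector, 'i) toric \<Rightarrow> ('i \<Rightarrow> complex) set" where
  "torus_group T = {g \<in> affine_space T. (\<forall>i\<in>idx T. g i \<noteq> 0) \<and>
     (\<forall>b\<in>principal_divisors T. (\<Prod>i\<in>idx T. g i powi b i) = 1)}"

definition orbit :: "('v::real_vector, 'i) toric \<Rightarrow> ('i \<Rightarrow> complex) \<Rightarrow> ('i \<Rightarrow> complex) set" where
  "orbit T x = (\<lambda>g. \<lambda>i\<in>idx T. g i * x i) ` torus_group T"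

text \<open>The points of the geometric quotient, for a simplicial fan.\<close>

definition toric_points :: "('v::real_vector, 'i) toric \<Rightarrow> ('i \<Rightarrow> complex) set set" where
  "toric_points T = orbit T ` semistable T"

text \<open>\<open>homogeneous T b F\<close>: \<open>F\<close> is a polynomial in the homogeneous coordinates all of whose
  monomials have degree \<open>[\<Sum>\<^sub>i b\<^sub>i D\<^sub>i]\<close>.\<close>

definition homogeneous ::
    "('v::real_vector, 'i) toric \<Rightarrow> ('i \<Rightarrow> int) \<Rightarrow> (('i \<Rightarrow> complex) \<Rightarrow> complex) \<Rightarrow> bool" where
  "homogeneous T b F \<longleftrightarrow> (\<exists>A c. finite A \<and>
     (\<forall>\<alpha>\<in>A. (\<lambda>i. int (\<alpha> i) - b i) \<in> principal_divisors T) \<and>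
     (\<forall>x\<in>affine_space T. F x = (\<Sum>\<alpha>\<in>A. c \<alpha> * (\<Prod>i\<in>idx T. x i ^ \<alpha> i))))"

definition partial :: "(('i \<Rightarrow> complex) \<Rightarrow> complex) \<Rightarrow> 'i \<Rightarrow> ('i \<Rightarrow> complex) \<Rightarrow> complex" where
  "partial F i x = deriv (\<lambda>w. F (x(i := w))) (x i)"

definition jacobian ::
    "('v, 'i) toric \<Rightarrow> (('i \<Rightarrow> complex) \<Rightarrow> complex) list \<Rightarrow> ('i \<Rightarrow> complex) \<Rightarrow> complex mat" where
  "jacobian T Fs x =
     Matrix.mat (length Fs) (length (vars T)) (\<lambda>(r, c). partial (Fs ! r) (vars T ! c) x)"

definition quasismooth ::
    "('v::real_vector, 'i) toric \<Rightarrow> (('i \<Rightarrow> complex) \<Rightarrow> complex) list \<Rightarrow> bool" where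
  "quasismooth T Fs \<longleftrightarrow> (\<forall>F\<in>set Fs. \<exists>b. homogeneous T b F) \<and>
     (\<forall>x\<in>semistable T. (\<forall>F\<in>set Fs. F x = 0) \<longrightarrow>
        vec_space.rank (length Fs) (jacobian T Fs x) = length Fs)"

definition nondegenerate ::
    "('v, 'i) toric \<Rightarrow> (('i \<Rightarrow> complex) \<Rightarrow> complex) \<Rightarrow> bool" where
  "nondegenerate T F \<longleftrightarrow> \<not> (\<exists>x\<in>semistable T. \<forall>i\<in>idx T. x i * partial F i x = 0)"


section \<open>Line bundles\<close>

text \<open>For \<open>D = \<Sum>\<^sub>i b\<^sub>i D\<^sub>i\<close> on a simplicial toric variety, the stalk of \<open>\<O>(D)\<close> at the point with
  homogeneous coordinates \<open>p\<close> consists of the fractions \<open>g/h\<close> of homogeneous polynomials with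
  \<open>deg g - deg h = [D]\<close> and \<open>h(p) \<noteq> 0\<close>, i.e. it is the stalk of the sheaf associated with the
  shifted ring \<open>S([D])\<close>. A fraction is given as a pair of numerator and denominator. For \<open>b = 0\<close>
  this is the local ring at \<open>p\<close>.\<close>

definition stalk ::
    "('v::real_vector, 'i) toric \<Rightarrow> ('i \<Rightarrow> int) \<Rightarrow> ('i \<Rightarrow> complex) \<Rightarrow>
      ((('i \<Rightarrow> complex) \<Rightarrow> complex) \<times> (('i \<Rightarrow> complex) \<Rightarrow> complex)) set" where
  "stalk T b p = {(g, h). \<exists>c. homogeneous T (\<lambda>i. c i + b i) g \<and> homogeneous T c h \<and> h p \<noteq> 0}"

definition frac_eq ::
    "('v, 'i) toric \<Rightarrow> (('i \<Rightarrow> complex) \<Rightarrow> complex) \<times> (('i \<Rightarrow> complex) \<Rightarrow> complex) \<Rightarrow>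
      (('i \<Rightarrow> complex) \<Rightarrow> complex) \<times> (('i \<Rightarrow> complex) \<Rightarrow> complex) \<Rightarrow> bool" where
  "frac_eq T s t \<longleftrightarrow> (\<forall>x\<in>affine_space T. fst s x * snd t x = fst t x * snd s x)"

definition frac_mult ::
    "(('i \<Rightarrow> complex) \<Rightarrow> complex) \<times> (('i \<Rightarrow> complex) \<Rightarrow> complex) \<Rightarrow>
      (('i \<Rightarrow> complex) \<Rightarrow> complex) \<times> (('i \<Rightarrow> complex) \<Rightarrow> complex) \<Rightarrow>
      (('i \<Rightarrow> complex) \<Rightarrow> complex) \<times> (('i \<Rightarrow> complex) \<Rightarrow> complex)" where
  "frac_mult s t = (\<lambda>x. fst s x * fst t x, \<lambda>x. snd s x * snd t x)"

text \<open>The coherent sheaf \<open>\<O>(D)\<close> is a line bundle iff all its stalks are free of rank one, that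
  is, have a one-element basis \<open>u\<close> over the local ring.\<close>

definition line_bundle :: "('v::real_vector, 'i) toric \<Rightarrow> ('i \<Rightarrow> int) \<Rightarrow> bool" where
  "line_bundle T b \<longleftrightarrow> (\<forall>p\<in>semistable T. \<exists>u\<in>stalk T b p.
     (\<forall>s\<in>stalk T b p. \<exists>r\<in>stalk T (\<lambda>_. 0) p. frac_eq T s (frac_mult r u)) \<and>
     (\<forall>r\<in>stalk T (\<lambda>_. 0) p. frac_eq T (frac_mult r u) (\<lambda>_. 0, \<lambda>_. 1) \<longrightarrow>
        frac_eq T r (\<lambda>_. 0, \<lambda>_. 1)))"

text \<open>Every element of a stalk is a combination of global sections (these are the homogeneous
  polynomials of degree \<open>[D]\<close>) with coefficients in the local ring, which may be brought to a
  common denominator \<open>h\<close>.\<close>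

definition globally_generated :: "('v::real_vector, 'i) toric \<Rightarrow> ('i \<Rightarrow> int) \<Rightarrow> bool" where
  "globally_generated T b \<longleftrightarrow> (\<forall>p\<in>semistable T. \<forall>s\<in>stalk T b p.
     \<exists>(r::nat) g h q. (\<forall>l<r. (g l, h) \<in> stalk T (\<lambda>_. 0) p \<and> homogeneous T b (q l)) \<and> h p \<noteq> 0 \<and>
       frac_eq T s (\<lambda>x. \<Sum>l<r. g l x * q l x, h))"

text \<open>The anticanonical divisor is \<open>\<Sum>\<^sub>i D\<^sub>i\<close>.\<close>

definition semiample_anticanonical :: "('v::real_vector, 'i) toric \<Rightarrow> bool" where
  "semiample_anticanonical T \<longleftrightarrow> line_bundle T (\<lambda>_. 1) \<and> globally_generated T (\<lambda>_. 1)"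


section \<open>Closed subvarieties and isomorphisms\<close>

definition subvariety ::
    "('v::real_vector, 'i) toric \<Rightarrow> (('i \<Rightarrow> complex) \<Rightarrow> complex) list \<Rightarrow> ('i \<Rightarrow> complex) set set" where
  "subvariety T Fs = {p \<in> toric_points T. \<forall>x\<in>p. \<forall>F\<in>set Fs. F x = 0}"

definition zariski ::
    "('v::real_vector, 'i) toric \<Rightarrow> ('i \<Rightarrow> complex) set set \<Rightarrow> ('i \<Rightarrow> complex) set topology" where
  "zariski T P = topology_generated_by {{p \<in> P. \<forall>x\<in>p. h x \<noteq> 0} | h. \<exists>b. homogeneous T b h}"

definition regular_on ::
    "('v::real_vector, 'i) toric \<Rightarrow> ('i \<Rightarrow> complex) set set \<Rightarrow>
      (('i \<Rightarrow> complex) set \<Rightarrow> complex) \<Rightarrow> bool" where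
  "regular_on T W f \<longleftrightarrow> (\<forall>p\<in>W. \<exists>g h. (\<forall>x\<in>p. (g, h) \<in> stalk T (\<lambda>_. 0) x) \<and>
     (\<forall>q\<in>W. \<forall>x\<in>q. h x \<noteq> 0 \<longrightarrow> f q = g x / h x))"

definition variety_isomorphism ::
    "('v::real_vector, 'i) toric \<Rightarrow> ('i \<Rightarrow> complex) set set \<Rightarrow>
      ('w::real_vector, 'j) toric \<Rightarrow> ('j \<Rightarrow> complex) set set \<Rightarrow>
      (('i \<Rightarrow> complex) set \<Rightarrow> ('j \<Rightarrow> complex) set) \<Rightarrow> bool" where
  "variety_isomorphism T P T' Q \<Phi> \<longleftrightarrow>
     homeomorphic_map (zariski T P) (zariski T' Q) \<Phi> \<and>
     (\<forall>W f. openin (zariski T' Q) W \<longrightarrow>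
        (regular_on T' W f \<longleftrightarrow> regular_on T {p \<in> P. \<Phi> p \<in> W} (f \<circ> \<Phi>)))"

text \<open>\<open>\<phi>\<close>, written in homogeneous coordinates, induces a map from the toric variety of \<open>T\<close> to
  that of \<open>T'\<close> which restricts to an isomorphism of \<open>P\<close> onto \<open>Q\<close>.\<close>

definition isomorphic_via ::
    "('v::real_vector, 'i) toric \<Rightarrow> ('i \<Rightarrow> complex) set set \<Rightarrow>
      ('w::real_vector, 'j) toric \<Rightarrow> ('j \<Rightarrow> complex) set set \<Rightarrow>
      (('i \<Rightarrow> complex) \<Rightarrow> ('j \<Rightarrow> complex)) \<Rightarrow> bool" where
  "isomorphic_via T P T' Q \<phi> \<longleftrightarrow> (\<exists>\<Phi>.
     (\<forall>x\<in>semistable T. \<phi> x \<in> semistable T' \<and> \<Phi> (orbit T x) = orbit T' (\<phi> x)) \<and>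
     variety_isomorphism T P T' Q \<Phi>)"


section \<open>The anticanonical polytope\<close>

text \<open>\<open>N = \<int>\<^sup>d\<close>; its dual \<open>M\<close> is identified with \<open>\<int>\<^sup>d\<close> through the standard inner product.\<close>

definition std_lattice :: "(real ^ 'd) set" where
  "std_lattice = {v. \<forall>j. vec_nth v j \<in> \<int>}"

definition Delta :: "nat \<Rightarrow> (nat \<Rightarrow> real ^ 'd) \<Rightarrow> (real ^ 'd) set" where
  "Delta n e = {m. \<forall>i\<in>{1..n}. inner m (e i) \<ge> - 1}"

definition polar :: "(real ^ 'd) set \<Rightarrow> (real ^ 'd) set" where
  "polar P = {v. \<forall>m\<in>P. inner m v \<ge> - 1}"

definition lattice_polytope_at_0 :: "(real ^ 'd) set \<Rightarrow> bool" where
  "lattice_polytope_at_0 P \<longleftrightarrow> polytope P \<and> (\<forall>v. v extreme_point_of P \<longrightarrow> v \<in> std_lattice) \<and>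
     interior P \<inter> std_lattice = {0}"

definition reflexive :: "(real ^ 'd) set \<Rightarrow> bool" where
  "reflexive P \<longleftrightarrow> lattice_polytope_at_0 P \<and> lattice_polytope_at_0 (polar P)"

text \<open>Exponents such as \<open>1 + \<langle>m, e\<^sub>i\<rangle>\<close> below are nonnegative integers whenever
  \<open>m \<in> \<Delta> \<inter> M\<close>.\<close>

abbreviation expo :: "real \<Rightarrow> nat" where
  "expo r \<equiv> nat \<lfloor>r\<rfloor>"

definition anticanonical_poly ::
    "nat \<Rightarrow> (nat \<Rightarrow> real ^ 'd) \<Rightarrow> (real ^ 'd \<Rightarrow> complex) \<Rightarrow> (nat \<Rightarrow> complex) \<Rightarrow> complex" where
  "anticanonical_poly n e a x =
     (\<Sum>m\<in>Delta n e \<inter> std_lattice. a m * (\<Prod>i\<in>{1..n}. x i ^ expo (1 + inner m (e i))))"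

definition base_toric ::
    "nat \<Rightarrow> (nat \<Rightarrow> real ^ 'd) \<Rightarrow> (real ^ 'd) set set \<Rightarrow> (real ^ 'd, nat) toric" where
  "base_toric n e \<Sigma> = \<lparr>lat = std_lattice, cones = \<Sigma>, vars = [1..<Suc n], gens = e\<rparr>"


section \<open>The fan of an edge\<close>

text \<open>Throughout, \<open>i 0, \<dots>, i (k + 1)\<close> are the indices of the lattice points
  on the edge, and \<open>\<int>\<^sup>k\<close> is realised by the finitely supported functions on \<open>{1..k}\<close>.\<close>

datatype coord = Sc nat | Tc nat | Yc nat

definition edge_vars :: "nat \<Rightarrow> (nat \<Rightarrow> nat) \<Rightarrow> nat \<Rightarrow> coord list" where
  "edge_vars n i k = map Sc [1..<k + 2] @ map Tc [0..<k + 1] @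
     map Yc (filter (\<lambda>l. l \<notin> i ` {0..k + 1}) [1..<Suc n])"

definition edge_lattice :: "nat \<Rightarrow> ((real ^ 'd) \<times> (nat \<Rightarrow>\<^sub>0 real)) set" where
  "edge_lattice k = {(v, c). v \<in> std_lattice \<and> Poly_Mapping.keys c \<subseteq> {1..k} \<and>
     (\<forall>j. Poly_Mapping.lookup c j \<in> \<int>)}"

abbreviation bvec :: "nat \<Rightarrow> nat \<Rightarrow>\<^sub>0 real" where
  "bvec j \<equiv> Poly_Mapping.single j 1"

fun edge_gens ::
    "(nat \<Rightarrow> real ^ 'd) \<Rightarrow> (nat \<Rightarrow> nat) \<Rightarrow> nat \<Rightarrow> coord \<Rightarrow> (real ^ 'd) \<times> (nat \<Rightarrow>\<^sub>0 real)" where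
  "edge_gens e i k (Sc j) =
     (if j \<le> k then (0, bvec j) else (e (i 0), - (\<Sum>l\<in>{1..k}. bvec l)))"
| "edge_gens e i k (Tc j) =
     (if j < k then ((1 / real (k + 1)) *\<^sub>R (e (i (k + 1)) - e (i 0)), bvec (j + 1))
      else (e (i 0) + (1 / real (k + 1)) *\<^sub>R (e (i (k + 1)) - e (i 0)),
            - (\<Sum>l\<in>{1..k}. bvec l)))"
| "edge_gens e i k (Yc l) = (e l, 0)"

definition gens_on_edge ::
    "(nat \<Rightarrow> real ^ 'd) \<Rightarrow> (nat \<Rightarrow> nat) \<Rightarrow> nat \<Rightarrow> (real ^ 'd) set \<Rightarrow> nat set" where
  "gens_on_edge e i k \<sigma> = {j \<in> {0..k + 1}. e (i j) \<in> \<sigma>}"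

definition gens_off_edge ::
    "nat \<Rightarrow> (nat \<Rightarrow> real ^ 'd) \<Rightarrow> (nat \<Rightarrow> nat) \<Rightarrow> nat \<Rightarrow> (real ^ 'd) set \<Rightarrow> nat set" where
  "gens_off_edge n e i k \<sigma> = {l \<in> {1..n} - i ` {0..k + 1}. e l \<in> \<sigma>}"

definition edge_cones ::
    "nat \<Rightarrow> (nat \<Rightarrow> real ^ 'd) \<Rightarrow> (real ^ 'd) set set \<Rightarrow> (nat \<Rightarrow> nat) \<Rightarrow> nat \<Rightarrow>
      ((real ^ 'd) \<times> (nat \<Rightarrow>\<^sub>0 real)) set set" where
  "edge_cones n e \<Sigma> i k =
     {\<sigma> \<times> {0} | \<sigma>. \<sigma> \<in> \<Sigma> \<and> gens_on_edge e i k \<sigma> = {}} \<union>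
     {convex_cone hull (edge_gens e i k `
        (Yc ` gens_off_edge n e i k \<sigma> \<union> Tc ` {0..<j} \<union> Sc ` {j + 1..k + 1})) | \<sigma> j.
        \<sigma> \<in> \<Sigma> \<and> gens_on_edge e i k \<sigma> = {j}} \<union>
     {convex_cone hull (edge_gens e i k `
        (Yc ` gens_off_edge n e i k \<sigma> \<union> Tc ` {0..j} \<union> Sc ` {j + 1..k + 1})) | \<sigma> j.
        \<sigma> \<in> \<Sigma> \<and> gens_on_edge e i k \<sigma> = {j, j + 1}}"

definition edge_fan ::
    "nat \<Rightarrow> (nat \<Rightarrow> real ^ 'd) \<Rightarrow> (real ^ 'd) set set \<Rightarrow> (nat \<Rightarrow> nat) \<Rightarrow> nat \<Rightarrow>
      ((real ^ 'd) \<times> (nat \<Rightarrow>\<^sub>0 real)) set set" where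
  "edge_fan n e \<Sigma> i k = {\<tau>. \<tau> \<noteq> {} \<and> (\<exists>\<kappa>\<in>edge_cones n e \<Sigma> i k. \<tau> face_of \<kappa>)}"

definition edge_toric ::
    "nat \<Rightarrow> (nat \<Rightarrow> real ^ 'd) \<Rightarrow> (real ^ 'd) set set \<Rightarrow> (nat \<Rightarrow> nat) \<Rightarrow> nat \<Rightarrow>
      ((real ^ 'd) \<times> (nat \<Rightarrow>\<^sub>0 real), coord) toric" where
  "edge_toric n e \<Sigma> i k = \<lparr>lat = edge_lattice k, cones = edge_fan n e \<Sigma> i k,
     vars = edge_vars n i k, gens = edge_gens e i k\<rparr>"

definition edge_embedding ::
    "nat \<Rightarrow> (nat \<Rightarrow> nat) \<Rightarrow> nat \<Rightarrow> (nat \<Rightarrow> complex) \<Rightarrow> coord \<Rightarrow> complex" where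
  "edge_embedding n i k x = (\<lambda>c\<in>set (edge_vars n i k). case c of
       Sc j \<Rightarrow> \<Prod>l\<in>{0..<j}. x (i l)
     | Tc j \<Rightarrow> \<Prod>l\<in>{j + 1..k + 1}. x (i l)
     | Yc l \<Rightarrow> x l)"

definition X_monomial ::
    "(nat \<Rightarrow> real ^ 'd) \<Rightarrow> (nat \<Rightarrow> nat) \<Rightarrow> nat \<Rightarrow> real ^ 'd \<Rightarrow> (coord \<Rightarrow> complex) \<Rightarrow> complex" where
  "X_monomial e i k m z =
     (if inner m (e (i 1) - e (i 0)) \<ge> 0
      then (z (Sc 1) * z (Tc 0)) ^ expo (1 + inner m (e (i 0))) *
           (\<Prod>j\<in>{0..k}. z (Tc j)) ^ expo (inner m (e (i 1) - e (i 0)))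
      else (z (Sc 1) * z (Tc 0)) ^ expo (1 + inner m (e (i (k + 1)))) *
           (\<Prod>j\<in>{1..k + 1}. z (Sc j)) ^ expo (inner m (e (i 0) - e (i 1))))"

definition lifted_poly ::
    "nat \<Rightarrow> (nat \<Rightarrow> real ^ 'd) \<Rightarrow> (nat \<Rightarrow> nat) \<Rightarrow> nat \<Rightarrow> (real ^ 'd \<Rightarrow> complex) \<Rightarrow>
      (coord \<Rightarrow> complex) \<Rightarrow> complex" where
  "lifted_poly n e i k a z = (\<Sum>m\<in>Delta n e \<inter> std_lattice. a m * X_monomial e i k m z *
     (\<Prod>l\<in>{1..n} - i ` {0..k + 1}. z (Yc l) ^ expo (1 + inner m (e l))))"

definition edge_equations ::
    "nat \<Rightarrow> (nat \<Rightarrow> real ^ 'd) \<Rightarrow> (nat \<Rightarrow> nat) \<Rightarrow> nat \<Rightarrow> (real ^ 'd \<Rightarrow> complex) \<Rightarrow>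
      ((coord \<Rightarrow> complex) \<Rightarrow> complex) list" where
  "edge_equations n e i k a =
     map (\<lambda>j z. z (Sc (j + 1)) * z (Tc j) - z (Sc j) * z (Tc (j - 1))) [1..<k + 1] @
     [lifted_poly n e i k a]"

end

theory Submission
  imports Defs
begin

text \<open>Everything follows from the monomial form of the embedding \<open>\<phi>\<close>. Pulling exponent vectors
  back along \<open>\<phi>\<close> identifies the characters of the two toric varieties, so \<open>\<phi>\<close> induces an
  isomorphism of the groups by which one divides. For every \<open>j\<close> the
  generators of \<open>t\<^bsub>j-1\<^esub>\<close> and \<open>s\<^sub>j\<close> differ by the same primitive edge vector, and this decides
  which generators lie in a given cone of \<open>\<Sigma>(\<Gamma>\<^sup>*)\<close>; hence \<open>\<phi>\<close> maps the semistable points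
  bijectively onto the semistable zeros of the binomials \<open>s\<^bsub>j+1\<^esub> t\<^sub>j - s\<^sub>j t\<^bsub>j-1\<^esub>\<close>. Near any semistable point all but
  two consecutive edge coordinates are units, and after multiplication by a monomial in these
  units every polynomial is a pullback, which gives the isomorphism. In a linear relation among
  the rows of the Jacobian matrix, the vector fields \<open>x\<^sub>r \<partial>/\<partial>x\<^sub>r\<close>, transported by \<open>\<phi>\<close>, kill the
  binomials and turn the last polynomial into \<open>x\<^sub>r \<partial>f/\<partial>x\<^sub>r\<close>; nondegeneracy of \<open>f\<close> thus removes the
  last row, and the binomials alone are independent because at most one of the pairs
  \<open>(s\<^sub>j, t\<^bsub>j-1\<^esub>)\<close> can vanish.\<close>

section \<open>Rank of complex matrices\<close>

text \<open>The factor 1/(k+1) in the generators of the t_j comes from the lattice: the points of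
  the edge are equally spaced, so (e_{i_{k+1}} - e_{i_0})/(k+1) is the step between neighbours.
  Hence a sum of k+1 generators, one from each pair (s_j, t_{j-1}), is the lattice point e_{i_l},
  where l counts the chosen t's.

  The obstacle is that a monomial in the x_r need not be a pullback, since pullbacks have restricted
  exponents along the edge. A convex correction of the exponents, supported on coordinates that do
  not vanish, removes the restriction near one point at a time; this is why fractions and basic open
  sets are compared locally.

  The monomials X_m have the same origin: <m, e_{i_l}> is affine in l, while s_1 t_0, the product of
  all t_j and the product of all s_j pull back to the exponents 1, l and k+1-l at position
  l.\<close>

lemma complex_rank_eq_dim:
  fixes A :: "complex mat"
  assumes A: "A \<in> carrier_mat nr nc"
    and left: "\<And>v. (\<And>c. c < nc \<Longrightarrow> (\<Sum>r<nr. v r * A $$ (r, c)) = 0) \<Longrightarrow> \<forall>r<nr. v r = 0"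
  shows "vec_space.rank nr A = nr"
proof -
  interpret vec_space "TYPE(complex)" nr .
  \<comment> \<open>\<open>B\<close> is the conjugate transpose of \<open>A\<close>. If
    \<open>A * B\<close> kills \<open>v\<close>, then \<open>B\<close> applied to \<open>v\<close>
    has norm zero, so the conjugate of \<open>v\<close> is a relation among the rows of
    \<open>A\<close>. Hence \<open>A * B\<close> is invertible and \<open>A\<close> is onto.\<close>
  define B where "B = Matrix.mat nc nr (\<lambda>(c, r). cnj (A $$ (r, c)))"
  have B: "B \<in> carrier_mat nc nr" by (simp add: B_def)
  have AB: "A * B \<in> carrier_mat nr nr" using A B by simp
  have "det (A * B) \<noteq> 0"
  proof
    assume "det (A * B) = 0"
    then obtain v where v: "v \<in> carrier_vec nr" "v \<noteq> 0\<^sub>v nr" "(A * B) *\<^sub>v v = 0\<^sub>v nr"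
      using det_0_iff_vec_prod_zero_field[OF AB] by blast
    define u where "u = B *\<^sub>v v"
    have u: "u \<in> carrier_vec nc" using B v by (simp add: u_def)
    have Au: "A *\<^sub>v u = 0\<^sub>v nr"
      using v A B by (simp add: u_def assoc_mult_mat_vec)
    have uc: "vec_index u c = (\<Sum>r<nr. cnj (A $$ (r, c)) * vec_index v r)" if "c < nc" for c
      using that v B by (simp add: u_def B_def scalar_prod_def atLeast0LessThan)
    have Ar: "(\<Sum>c<nc. A $$ (r, c) * vec_index u c) = 0" if "r < nr" for r
    proof -
      have "vec_index (A *\<^sub>v u) r = (\<Sum>c<nc. A $$ (r, c) * vec_index u c)"
        using that A u by (simp add: scalar_prod_def atLeast0LessThan)
      then show ?thesis using Au that by simp
    qed
    have "(\<Sum>c<nc. vec_index u c * cnj (vec_index u c)) = (\<Sum>c<nc. \<Sum>r<nr. A $$ (r, c) * vec_index u c * cnj (vec_index v r))"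
      by (intro sum.cong refl) (simp add: uc sum_distrib_left mult_ac)
    also have "\<dots> = (\<Sum>r<nr. cnj (vec_index v r) * (\<Sum>c<nc. A $$ (r, c) * vec_index u c))"
      by (subst sum.swap) (simp add: sum_distrib_left mult_ac)
    also have "\<dots> = 0" using Ar by simp
    finally have "(\<Sum>c<nc. complex_of_real ((cmod (vec_index u c))\<^sup>2)) = 0"
      by (simp only: complex_norm_square)
    then have "(\<Sum>c<nc. (cmod (vec_index u c))\<^sup>2) = 0"
      by (metis of_real_eq_0_iff of_real_sum)
    then have u0: "vec_index u c = 0" if "c < nc" for c
      using that by (subst (asm) sum_nonneg_eq_0_iff) auto
    have "\<forall>r<nr. cnj (vec_index v r) = 0"
    proof (rule left)
      fix c assume c: "c < nc"
      have "(\<Sum>r<nr. cnj (vec_index v r) * A $$ (r, c)) = cnj (vec_index u c)"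
        by (simp add: uc[OF c] mult_ac)
      then show "(\<Sum>r<nr. cnj (vec_index v r) * A $$ (r, c)) = 0" using u0[OF c] by simp
    qed
    then have "v = 0\<^sub>v nr" using v(1) by (intro eq_vecI) auto
    then show False using v(2) by simp
  qed
  then obtain C where C: "C \<in> carrier_mat nr nr" "A * B * C = 1\<^sub>m nr"
    using det_non_zero_imp_unit[OF AB] unfolding Units_def ring_mat_def by auto
  have "col_space A = carrier_vec nr"
  proof -
    have "y \<in> col_space A" if y: "y \<in> carrier_vec nr" for y
    proof -
      have "A *\<^sub>v (B *\<^sub>v (C *\<^sub>v y)) = (A * B * C) *\<^sub>v y"
        using A B C(1) y by (simp add: assoc_mult_mat_vec[where ?n\<^sub>1.0=nr and ?n\<^sub>3.0=nr])
      also have "\<dots> = y" using C y by simp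
      finally show ?thesis using A B C y
        by (subst col_space_eq[OF A]) (auto intro!: bexI[of _ "B *\<^sub>v (C *\<^sub>v y)"])
    qed
    moreover have "col_space A \<subseteq> carrier_vec nr" by (subst col_space_eq[OF A]) (use A in auto)
    ultimately show ?thesis by auto
  qed
  then have "span_vs (set (cols A)) = V" by (simp add: col_space_def)
  then show ?thesis by (simp add: rank_def dim_is_n)
qed

section \<open>Homogeneous polynomials and torus orbits\<close>

lemma semistable_iff:
  "x \<in> semistable T \<longleftrightarrow>
     x \<in> affine_space T \<and> (\<exists>\<sigma>\<in>cones T. \<forall>c\<in>idx T. x c = 0 \<longrightarrow> gens T c \<in> \<sigma>)"
  unfolding semistable_def irrelevant_locus_def by (auto simp: prod_zero_iff)

lemma principal_divisors_cong:
  assumes "\<And>c. c \<in> idx T \<Longrightarrow> b c = b' c"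
  shows "b \<in> principal_divisors T \<longleftrightarrow> b' \<in> principal_divisors T"
  using assms unfolding principal_divisors_def by simp

lemma principal_divisors_diff:
  assumes "b \<in> principal_divisors T" "b' \<in> principal_divisors T"
  shows "(\<lambda>c. b c - b' c) \<in> principal_divisors T"
proof -
  obtain m m' where "linear m" "\<forall>v\<in>lat T. m v \<in> \<int>" "\<forall>c\<in>idx T. real_of_int (b c) = m (gens T c)"
    "linear m'" "\<forall>v\<in>lat T. m' v \<in> \<int>" "\<forall>c\<in>idx T. real_of_int (b' c) = m' (gens T c)"
    using assms unfolding principal_divisors_def by auto
  then have "linear (\<lambda>v. m v - m' v) \<and> (\<forall>v\<in>lat T. m v - m' v \<in> \<int>) \<and>
      (\<forall>c\<in>idx T. real_of_int (b c - b' c) = m (gens T c) - m' (gens T c))"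
    by (simp add: linear_compose_sub)
  then show ?thesis unfolding principal_divisors_def by blast
qed

lemma zero_principal_divisor: "(\<lambda>_. 0) \<in> principal_divisors T"
  unfolding principal_divisors_def by (auto intro!: exI[of _ "\<lambda>_. 0"] linear_zero)

text \<open>The definition indexes monomials by distinct exponent vectors, whereas families obtained
  by pulling exponents back or lifting them need not be injective; the coefficients of equal
  exponents are collected.\<close>

lemma homogeneousI:
  assumes R: "finite R"
    and deg: "\<And>r. r \<in> R \<Longrightarrow> (\<lambda>c. int (\<alpha> r c) - b c) \<in> principal_divisors T"
    and F: "\<And>x. x \<in> affine_space T \<Longrightarrow> F x = (\<Sum>r\<in>R. a r * (\<Prod>c\<in>idx T. x c ^ \<alpha> r c))"
  shows "homogeneous T b F"
  unfolding homogeneous_def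
proof (intro exI[of _ "\<alpha> ` R"] exI[of _ "\<lambda>\<beta>. \<Sum>r | r \<in> R \<and> \<alpha> r = \<beta>. a r"] conjI ballI)
  fix x assume x: "x \<in> affine_space T"
  let ?P = "\<lambda>\<beta>. \<Prod>c\<in>idx T. x c ^ \<beta> c"
  have "F x = (\<Sum>r\<in>R. a r * ?P (\<alpha> r))" using F[OF x] .
  also have "\<dots> = (\<Sum>\<beta>\<in>\<alpha> ` R. \<Sum>r | r \<in> R \<and> \<alpha> r = \<beta>. a r * ?P (\<alpha> r))"
    by (rule sum.image_gen[OF R])
  also have "\<dots> = (\<Sum>\<beta>\<in>\<alpha> ` R. (\<Sum>r | r \<in> R \<and> \<alpha> r = \<beta>. a r) * ?P \<beta>)"
    by (intro sum.cong refl) (simp add: sum_distrib_right)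
  finally show "F x = (\<Sum>\<beta>\<in>\<alpha> ` R. (\<Sum>r | r \<in> R \<and> \<alpha> r = \<beta>. a r) * ?P \<beta>)" .
qed (use R deg in auto)

text \<open>Each exponent vector differs from \<open>b\<close> by a principal divisor, whose
  character is trivial on the torus group; so all monomials of \<open>F\<close> scale by the same
  factor.\<close>

lemma homogeneous_torus:
  assumes F: "homogeneous T b F" and g: "g \<in> torus_group T" and x: "x \<in> affine_space T"
  shows "F (\<lambda>c\<in>idx T. g c * x c) = (\<Prod>c\<in>idx T. g c powi b c) * F x"
proof -
  obtain A a where A: "\<And>\<alpha>. \<alpha> \<in> A \<Longrightarrow> (\<lambda>c. int (\<alpha> c) - b c) \<in> principal_divisors T"
    and eq: "\<And>x. x \<in> affine_space T \<Longrightarrow> F x = (\<Sum>\<alpha>\<in>A. a \<alpha> * (\<Prod>c\<in>idx T. x c ^ \<alpha> c))"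
    using F unfolding homogeneous_def by auto
  have g0: "\<And>c. c \<in> idx T \<Longrightarrow> g c \<noteq> 0" using g by (simp add: torus_group_def)
  have "(\<Prod>c\<in>idx T. g c ^ \<alpha> c) = (\<Prod>c\<in>idx T. g c powi b c)" if "\<alpha> \<in> A" for \<alpha>
  proof -
    have "(\<Prod>c\<in>idx T. g c ^ \<alpha> c) = (\<Prod>c\<in>idx T. g c powi (int (\<alpha> c) - b c) * g c powi b c)"
    proof (intro prod.cong refl)
      fix c assume "c \<in> idx T"
      then have "g c powi (int (\<alpha> c) - b c) * g c powi b c = g c powi (int (\<alpha> c) - b c + b c)"
        by (intro power_int_add[symmetric]) (use g0 in auto)
      then show "g c ^ \<alpha> c = g c powi (int (\<alpha> c) - b c) * g c powi b c" by simp
    qed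
    also have "\<dots> = (\<Prod>c\<in>idx T. g c powi b c)"
      using g A[OF that] by (simp add: prod.distrib torus_group_def)
    finally show ?thesis .
  qed
  then show ?thesis
    by (subst (1 2) eq) (auto simp: affine_space_def x[unfolded affine_space_def]
        power_mult_distrib prod.distrib sum_distrib_left mult_ac intro!: sum.cong)
qed

lemma torus_orbit_self:
  assumes "x \<in> affine_space T"
  shows "x \<in> orbit T x"
proof -
  have "(\<lambda>c\<in>idx T. 1) \<in> torus_group T"
    by (simp add: torus_group_def affine_space_def)
  moreover have "x = (\<lambda>c\<in>idx T. (\<lambda>c\<in>idx T. 1) c * x c)"
    using assms by (auto simp: affine_space_def PiE_def extensional_def restrict_def)
  ultimately show ?thesis unfolding orbit_def by blast
qed

lemma torus_orbit_semistable:
  assumes "x \<in> semistable T" "y \<in> orbit T x"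
  shows "y \<in> semistable T"
proof -
  obtain g where "g \<in> torus_group T" "y = (\<lambda>c\<in>idx T. g c * x c)"
    using assms(2) unfolding orbit_def by auto
  then have "y \<in> affine_space T" "\<And>c. c \<in> idx T \<Longrightarrow> y c = 0 \<Longrightarrow> x c = 0"
    by (auto simp: affine_space_def torus_group_def)
  then show ?thesis using assms(1) unfolding semistable_iff by blast
qed

lemma toric_point_cases:
  assumes "p \<in> toric_points T"
  obtains x where "x \<in> semistable T" "p = orbit T x" "x \<in> p" "p \<subseteq> semistable T"
proof -
  obtain x where x: "x \<in> semistable T" "p = orbit T x"
    using assms unfolding toric_points_def by auto
  moreover have "x \<in> p" using x torus_orbit_self[of x T] by (simp add: semistable_iff)
  ultimately show thesis using that torus_orbit_semistable[OF x(1)] by blast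
qed

lemma homogeneous_nonzero_on_orbit:
  assumes "homogeneous T b F" "x \<in> affine_space T" "F x \<noteq> 0" "y \<in> orbit T x"
  shows "F y \<noteq> 0"
  using assms homogeneous_torus[OF assms(1) _ assms(2)]
  by (auto simp: orbit_def torus_group_def)

section \<open>Exponent vectors under square-free monomial substitutions\<close>

definition pull :: "'j set \<Rightarrow> ('j \<Rightarrow> 'i set) \<Rightarrow> ('j \<Rightarrow> 'a::comm_monoid_add) \<Rightarrow> 'i \<Rightarrow> 'a" where
  "pull V S b r = (\<Sum>c | c \<in> V \<and> r \<in> S c. b c)"

lemma pull_of_nat: "pull V S (\<lambda>c. int (\<alpha> c)) r = int (pull V S \<alpha> r)"
  by (simp add: pull_def)

lemma pull_diff:
  fixes b :: "_ \<Rightarrow> 'a::ab_group_add"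
  shows "pull V S (\<lambda>c. b c - b' c) r = pull V S b r - pull V S b' r"
  by (simp add: pull_def sum_subtractf)

lemma prod_swap_incidence:
  fixes h :: "'i \<Rightarrow> 'j \<Rightarrow> 'a::comm_monoid_mult"
  assumes "finite V" "finite I" "\<And>c. c \<in> V \<Longrightarrow> S c \<subseteq> I"
  shows "(\<Prod>c\<in>V. \<Prod>r\<in>S c. h r c) = (\<Prod>r\<in>I. \<Prod>c | c \<in> V \<and> r \<in> S c. h r c)"
proof -
  have "(\<Prod>c\<in>V. \<Prod>r\<in>S c. h r c) = (\<Prod>c\<in>V. \<Prod>r | r \<in> I \<and> r \<in> S c. h r c)"
    using assms(3) by (intro prod.cong refl) (auto intro: arg_cong[where f="prod _"])
  also have "\<dots> = (\<Prod>r\<in>I. \<Prod>c | c \<in> V \<and> r \<in> S c. h r c)"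
    by (rule prod.swap_restrict[OF assms(1,2)])
  finally show ?thesis .
qed

lemma prod_powi_sum:
  fixes x :: "'a::field"
  assumes "x \<noteq> 0"
  shows "(\<Prod>c\<in>C. x powi b c) = x powi (\<Sum>c\<in>C. b c)"
  using assms by (induction C rule: infinite_finite_induct) (auto simp: power_int_add)

text \<open>This is what \<open>pull\<close> computes: the exponent of \<open>x r\<close> after each
  coordinate \<open>c\<close> has been replaced by the product of the variables in
  \<open>S c\<close>.\<close>

lemma monomial_push:
  fixes x :: "'i \<Rightarrow> 'a::comm_semiring_1"
  assumes "finite V" "finite I" "\<And>c. c \<in> V \<Longrightarrow> S c \<subseteq> I"
  shows "(\<Prod>c\<in>V. (\<Prod>r\<in>S c. x r) ^ \<alpha> c) = (\<Prod>r\<in>I. x r ^ pull V S \<alpha> r)"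
proof -
  have "(\<Prod>c\<in>V. \<Prod>r\<in>S c. x r ^ \<alpha> c) = (\<Prod>r\<in>I. \<Prod>c | c \<in> V \<and> r \<in> S c. x r ^ \<alpha> c)"
    by (rule prod_swap_incidence) (use assms in auto)
  then show ?thesis by (simp add: prod_power_distrib power_sum pull_def)
qed

lemma laurent_monomial_push:
  fixes x :: "'i \<Rightarrow> 'a::field"
  assumes "finite V" "finite I" "\<And>c. c \<in> V \<Longrightarrow> S c \<subseteq> I" "\<And>r. r \<in> I \<Longrightarrow> x r \<noteq> 0"
  shows "(\<Prod>c\<in>V. (\<Prod>r\<in>S c. x r) powi b c) = (\<Prod>r\<in>I. x r powi pull V S b r)"
proof -
  have "(\<Prod>r\<in>R. x r) powi m = (\<Prod>r\<in>R. x r powi m)" for R m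
    by (induction R rule: infinite_finite_induct) (auto simp: power_int_mult_distrib)
  then have "(\<Prod>c\<in>V. (\<Prod>r\<in>S c. x r) powi b c) = (\<Prod>c\<in>V. \<Prod>r\<in>S c. x r powi b c)"
    by simp
  also have "\<dots> = (\<Prod>r\<in>I. \<Prod>c | c \<in> V \<and> r \<in> S c. x r powi b c)"
    by (rule prod_swap_incidence) (use assms in auto)
  also have "\<dots> = (\<Prod>r\<in>I. x r powi pull V S b r)"
    using assms(4) by (intro prod.cong refl) (simp add: prod_powi_sum pull_def)
  finally show ?thesis .
qed

section \<open>Euler operators on polynomials\<close>

lemma mult_partial_polynomial:
  assumes V: "finite V" and c: "c \<in> V"
    and F: "\<And>z. F z = (\<Sum>m\<in>R. a m * (\<Prod>d\<in>V. z d ^ \<alpha> m d))"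
  shows "z c * partial F c z = (\<Sum>m\<in>R. a m * of_nat (\<alpha> m c) * (\<Prod>d\<in>V. z d ^ \<alpha> m d))"
proof -
  let ?P = "\<lambda>m. \<Prod>d\<in>V - {c}. z d ^ \<alpha> m d"
  have split: "(\<Prod>d\<in>V. (z(c := w)) d ^ \<alpha> m d) = w ^ \<alpha> m c * ?P m" for w m
    using V c by (subst prod.remove[of _ c]) (auto intro!: prod.cong)
  have "((\<lambda>w. \<Sum>m\<in>R. a m * (w ^ \<alpha> m c * ?P m)) has_field_derivative
      (\<Sum>m\<in>R. a m * (of_nat (\<alpha> m c) * z c ^ (\<alpha> m c - 1) * ?P m))) (at (z c))"
    by (auto intro!: derivative_eq_intros sum.cong simp: mult_ac)
  then have "partial F c z = (\<Sum>m\<in>R. a m * (of_nat (\<alpha> m c) * z c ^ (\<alpha> m c - 1) * ?P m))"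
    unfolding partial_def F split by (rule DERIV_imp_deriv)
  then have "z c * partial F c z =
      (\<Sum>m\<in>R. a m * of_nat (\<alpha> m c) * ((z c * z c ^ (\<alpha> m c - 1)) * ?P m))"
    by (simp add: sum_distrib_left mult_ac)
  also have "\<dots> = (\<Sum>m\<in>R. a m * of_nat (\<alpha> m c) * (z c ^ \<alpha> m c * ?P m))"
  proof (intro sum.cong refl)
    fix m
    \<comment> \<open>For exponent 0 the truncated \<open>\<alpha> m c - 1\<close> gives the wrong
      power, but the factor \<open>of_nat 0\<close> removes the term.\<close>
    show "a m * of_nat (\<alpha> m c) * ((z c * z c ^ (\<alpha> m c - 1)) * ?P m) =
        a m * of_nat (\<alpha> m c) * (z c ^ \<alpha> m c * ?P m)"
      by (cases "\<alpha> m c") simp_all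
  qed
  also have "\<dots> = (\<Sum>m\<in>R. a m * of_nat (\<alpha> m c) * (\<Prod>d\<in>V. z d ^ \<alpha> m d))"
    using split[of "z c"] by simp
  finally show ?thesis .
qed

text \<open>The weights of the single coordinates add up to \<open>pull\<close>, the exponent of x_r
  after substitution. So the operator on the left acts on a monomial with the weight that x_r d/dx_r
  has on its pullback.\<close>

lemma euler_polynomial:
  assumes V: "finite V"
    and F: "\<And>z. F z = (\<Sum>m\<in>R. a m * (\<Prod>d\<in>V. z d ^ \<alpha> m d))"
  shows "(\<Sum>c | c \<in> V \<and> r \<in> S c. z c * partial F c z) =
      (\<Sum>m\<in>R. a m * of_nat (pull V S (\<alpha> m) r) * (\<Prod>d\<in>V. z d ^ \<alpha> m d))"
proof -
  have "(\<Sum>c | c \<in> V \<and> r \<in> S c. z c * partial F c z) =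
      (\<Sum>c | c \<in> V \<and> r \<in> S c. \<Sum>m\<in>R. a m * of_nat (\<alpha> m c) * (\<Prod>d\<in>V. z d ^ \<alpha> m d))"
    by (intro sum.cong refl) (use mult_partial_polynomial[OF V _ F] in simp)
  also have "\<dots> = (\<Sum>m\<in>R. a m * of_nat (pull V S (\<alpha> m) r) * (\<Prod>d\<in>V. z d ^ \<alpha> m d))"
    by (subst sum.swap) (simp add: pull_def sum_distrib_left sum_distrib_right)
  finally show ?thesis .
qed

section \<open>Embeddings of toric varieties given by monomials\<close>

text \<open>In \<open>principal_pull_iff\<close>, the direction from \<open>T'\<close> to
  \<open>T\<close> makes \<open>push\<close> respect torus groups and degrees; the direction from
  \<open>T\<close> to \<open>T'\<close> recovers degrees and torus elements of \<open>T'\<close>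
  from their images in \<open>T\<close>.\<close>

locale monomial_map =
  fixes T :: "('v::real_vector, 'i) toric" and T' :: "('w::real_vector, 'j) toric"
    and S :: "'j \<Rightarrow> 'i set"
  assumes incidence_subset: "c \<in> idx T' \<Longrightarrow> S c \<subseteq> idx T"
    and principal_pull_iff:
      "pull (idx T') S b \<in> principal_divisors T \<longleftrightarrow> b \<in> principal_divisors T'"
begin

definition push :: "('i \<Rightarrow> complex) \<Rightarrow> 'j \<Rightarrow> complex" where
  "push x = (\<lambda>c\<in>idx T'. \<Prod>r\<in>S c. x r)"

lemma push_affine: "push x \<in> affine_space T'"
  by (simp add: push_def affine_space_def)

lemma push_monomial: "(\<Prod>c\<in>idx T'. push x c ^ \<alpha> c) = (\<Prod>r\<in>idx T. x r ^ pull (idx T') S \<alpha> r)"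
proof -
  have "(\<Prod>c\<in>idx T'. push x c ^ \<alpha> c) = (\<Prod>c\<in>idx T'. (\<Prod>r\<in>S c. x r) ^ \<alpha> c)"
    by (simp add: push_def)
  also have "\<dots> = (\<Prod>r\<in>idx T. x r ^ pull (idx T') S \<alpha> r)"
    by (rule monomial_push) (use incidence_subset in auto)
  finally show ?thesis .
qed

lemma push_laurent_monomial:
  assumes "\<And>r. r \<in> idx T \<Longrightarrow> x r \<noteq> 0"
  shows "(\<Prod>c\<in>idx T'. push x c powi b c) = (\<Prod>r\<in>idx T. x r powi pull (idx T') S b r)"
proof -
  have "(\<Prod>c\<in>idx T'. push x c powi b c) = (\<Prod>c\<in>idx T'. (\<Prod>r\<in>S c. x r) powi b c)"
    by (simp add: push_def)
  also have "\<dots> = (\<Prod>r\<in>idx T. x r powi pull (idx T') S b r)"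
    by (rule laurent_monomial_push) (use incidence_subset assms in auto)
  finally show ?thesis .
qed

lemma homogeneous_pull:
  assumes "homogeneous T' b F"
  shows "homogeneous T (pull (idx T') S b) (\<lambda>x. F (push x))"
proof -
  obtain A a where A: "finite A" "\<And>\<alpha>. \<alpha> \<in> A \<Longrightarrow> (\<lambda>c. int (\<alpha> c) - b c) \<in> principal_divisors T'"
    and F: "\<And>x. x \<in> affine_space T' \<Longrightarrow> F x = (\<Sum>\<alpha>\<in>A. a \<alpha> * (\<Prod>c\<in>idx T'. x c ^ \<alpha> c))"
    using assms unfolding homogeneous_def by auto
  show ?thesis
  proof (rule homogeneousI[OF A(1), where \<alpha> = "\<lambda>\<alpha>. pull (idx T') S \<alpha>"])
    fix \<alpha> assume "\<alpha> \<in> A"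
    from A(2)[OF this] have "pull (idx T') S (\<lambda>c. int (\<alpha> c) - b c) \<in> principal_divisors T"
      by (simp add: principal_pull_iff)
    then show "(\<lambda>r. int (pull (idx T') S \<alpha> r) - pull (idx T') S b r) \<in> principal_divisors T"
      by (simp add: pull_diff pull_of_nat fun_eq_iff cong: principal_divisors_cong)
  qed (simp add: F push_affine push_monomial)
qed

lemma push_torus:
  assumes "g \<in> torus_group T"
  shows "push g \<in> torus_group T'"
proof -
  have g: "\<And>r. r \<in> idx T \<Longrightarrow> g r \<noteq> 0" using assms by (simp add: torus_group_def)
  have "(\<Prod>c\<in>idx T'. push g c powi b c) = 1" if "b \<in> principal_divisors T'" for b
    using that assms g by (subst push_laurent_monomial) (auto simp: torus_group_def principal_pull_iff)
  moreover have "push g c \<noteq> 0" if "c \<in> idx T'" for c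
    using that g incidence_subset[OF that] finite_subset[OF incidence_subset[OF that]]
    by (auto simp: push_def)
  ultimately show ?thesis by (simp add: torus_group_def push_affine)
qed

lemma push_scale: "push (\<lambda>r\<in>idx T. g r * x r) = (\<lambda>c\<in>idx T'. push g c * push x c)"
proof
  fix c
  show "push (\<lambda>r\<in>idx T. g r * x r) c = (\<lambda>c\<in>idx T'. push g c * push x c) c"
  proof (cases "c \<in> idx T'")
    case True
    have "(\<Prod>r\<in>S c. (\<lambda>r\<in>idx T. g r * x r) r) = (\<Prod>r\<in>S c. g r * x r)"
      by (intro prod.cong) (use incidence_subset[OF True] in auto)
    with True show ?thesis by (simp add: push_def prod.distrib)
  qed (simp add: push_def)
qed

end

text \<open>\<open>exponent_lift\<close> is local surjectivity on monomials: a factor that does not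
  vanish at \<open>x\<close> turns every exponent in \<open>A\<close> into a pulled-back one. One
  \<open>\<eta>\<close> serves all of \<open>A\<close>, so that numerator and denominator of a
  fraction receive the same factor.\<close>

locale toric_embedding = monomial_map T T' S
  for T :: "('v::real_vector, 'i) toric" and T' :: "('w::real_vector, 'j) toric" and S +
  assumes push_semistable: "x \<in> semistable T \<Longrightarrow> push x \<in> semistable T'"
    and inj_push: "inj_on push (semistable T)"
    and torus_lift: "g' \<in> torus_group T' \<Longrightarrow> \<exists>g\<in>torus_group T. push g = g'"
    and exponent_lift: "x \<in> semistable T \<Longrightarrow> finite A \<Longrightarrow>
      \<exists>\<eta> L. (\<Prod>r\<in>idx T. x r ^ \<eta> r) \<noteq> 0 \<and>
        (\<forall>\<alpha>\<in>A. \<forall>r\<in>idx T. pull (idx T') S (L \<alpha>) r = \<alpha> r + (\<eta> r :: nat))"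
begin

lemma push_orbit: "push ` orbit T x = orbit T' (push x)"
proof -
  have "torus_group T' = push ` torus_group T"
    using push_torus torus_lift by blast
  then have "orbit T' (push x) = (\<lambda>g. \<lambda>c\<in>idx T'. push g c * push x c) ` torus_group T"
    by (simp add: orbit_def image_image)
  also have "\<dots> = push ` orbit T x"
    by (simp add: orbit_def image_image push_scale)
  finally show ?thesis by simp
qed

lemma homogeneous_lift:
  assumes x: "x \<in> semistable T" and g: "homogeneous T b g" and h: "homogeneous T b h"
  obtains u b' g' h' where "u x \<noteq> 0" "homogeneous T' b' g'" "homogeneous T' b' h'"
    "\<And>y. y \<in> affine_space T \<Longrightarrow> g' (push y) = u y * g y"
    "\<And>y. y \<in> affine_space T \<Longrightarrow> h' (push y) = u y * h y"
proof -
  let ?V = "idx T'"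
  obtain A a where A: "finite A" "\<And>\<alpha>. \<alpha> \<in> A \<Longrightarrow> (\<lambda>c. int (\<alpha> c) - b c) \<in> principal_divisors T"
    and geq: "\<And>x. x \<in> affine_space T \<Longrightarrow> g x = (\<Sum>\<alpha>\<in>A. a \<alpha> * (\<Prod>c\<in>idx T. x c ^ \<alpha> c))"
    using g unfolding homogeneous_def by auto
  obtain C d where C: "finite C" "\<And>\<alpha>. \<alpha> \<in> C \<Longrightarrow> (\<lambda>c. int (\<alpha> c) - b c) \<in> principal_divisors T"
    and heq: "\<And>x. x \<in> affine_space T \<Longrightarrow> h x = (\<Sum>\<alpha>\<in>C. d \<alpha> * (\<Prod>c\<in>idx T. x c ^ \<alpha> c))"
    using h unfolding homogeneous_def by auto
  have fin: "finite (A \<union> C)" using A(1) C(1) by simp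
  obtain \<eta> L where \<eta>: "(\<Prod>r\<in>idx T. x r ^ \<eta> r) \<noteq> 0"
    and L: "\<And>\<alpha> r. \<alpha> \<in> A \<union> C \<Longrightarrow> r \<in> idx T \<Longrightarrow> pull ?V S (L \<alpha>) r = \<alpha> r + \<eta> r"
    using exponent_lift[OF x fin] by blast
  define u where "u y = (\<Prod>r\<in>idx T. y r ^ \<eta> r)" for y :: "'i \<Rightarrow> complex"
  \<comment> \<open>Any lifted exponent may serve as the reference degree, since by
    \<open>principal_pull_iff\<close> all of them differ by principal divisors. If
    \<open>A \<union> C\<close> is empty, both sums are empty and the choice is immaterial.\<close>
  define b' where "b' = (\<lambda>c. int (L (SOME \<alpha>. \<alpha> \<in> A \<union> C) c))"
  have deg: "(\<lambda>c. int (L \<alpha> c) - b' c) \<in> principal_divisors T'" if "\<alpha> \<in> A \<union> C" for \<alpha>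
  proof -
    define \<beta> where "\<beta> = (SOME \<alpha>. \<alpha> \<in> A \<union> C)"
    have \<beta>: "\<beta> \<in> A \<union> C" unfolding \<beta>_def using that by (rule someI[of "\<lambda>\<alpha>. \<alpha> \<in> A \<union> C"])
    have "(\<lambda>r. (int (\<alpha> r) - b r) - (int (\<beta> r) - b r)) \<in> principal_divisors T"
      by (rule principal_divisors_diff) (use that \<beta> A C in auto)
    moreover have "pull ?V S (\<lambda>c. int (L \<alpha> c) - b' c) r = (int (\<alpha> r) - b r) - (int (\<beta> r) - b r)"
      if "r \<in> idx T" for r
      using L[OF \<open>\<alpha> \<in> A \<union> C\<close> that] L[OF \<beta> that]
      unfolding b'_def \<beta>_def[symmetric] by (simp add: pull_diff pull_of_nat)
    ultimately have "pull ?V S (\<lambda>c. int (L \<alpha> c) - b' c) \<in> principal_divisors T"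
      by (subst principal_divisors_cong[of T _ "\<lambda>r. (int (\<alpha> r) - b r) - (int (\<beta> r) - b r)"]) auto
    then show ?thesis by (simp add: principal_pull_iff)
  qed
  have push_L: "(\<Prod>c\<in>?V. push y c ^ L \<alpha> c) = u y * (\<Prod>r\<in>idx T. y r ^ \<alpha> r)"
    if "\<alpha> \<in> A \<union> C" for \<alpha> y
    unfolding push_monomial u_def prod.distrib[symmetric]
    by (intro prod.cong refl) (simp add: L[OF that] power_add)
  show thesis
  proof (rule that[of u b' "\<lambda>z. \<Sum>\<alpha>\<in>A. a \<alpha> * (\<Prod>c\<in>?V. z c ^ L \<alpha> c)"
        "\<lambda>z. \<Sum>\<alpha>\<in>C. d \<alpha> * (\<Prod>c\<in>?V. z c ^ L \<alpha> c)"])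
    show "u x \<noteq> 0" using \<eta> by (simp add: u_def)
    show "homogeneous T' b' (\<lambda>z. \<Sum>\<alpha>\<in>A. a \<alpha> * (\<Prod>c\<in>?V. z c ^ L \<alpha> c))"
      by (rule homogeneousI[OF A(1)]) (use deg in auto)
    show "homogeneous T' b' (\<lambda>z. \<Sum>\<alpha>\<in>C. d \<alpha> * (\<Prod>c\<in>?V. z c ^ L \<alpha> c))"
      by (rule homogeneousI[OF C(1)]) (use deg in auto)
    fix y assume "y \<in> affine_space T"
    then show "(\<Sum>\<alpha>\<in>A. a \<alpha> * (\<Prod>c\<in>?V. push y c ^ L \<alpha> c)) = u y * g y"
      "(\<Sum>\<alpha>\<in>C. d \<alpha> * (\<Prod>c\<in>?V. push y c ^ L \<alpha> c)) = u y * h y"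
      by (auto simp: geq heq push_L sum_distrib_left mult_ac intro!: sum.cong)
  qed
qed

section \<open>Subvarieties, Zariski topology and regular functions under the embedding\<close>

context
  fixes Fs :: "(('i \<Rightarrow> complex) \<Rightarrow> complex) list" and Fs' :: "(('j \<Rightarrow> complex) \<Rightarrow> complex) list"
  assumes zeros: "{z \<in> semistable T'. \<forall>F\<in>set Fs'. F z = 0} =
    push ` {x \<in> semistable T. \<forall>F\<in>set Fs. F x = 0}"
begin

lemma subvariety_cases:
  assumes "p \<in> subvariety T Fs"
  obtains x where "x \<in> semistable T" "p = orbit T x" "x \<in> p" "p \<subseteq> semistable T"
    "\<And>y F. y \<in> p \<Longrightarrow> F \<in> set Fs \<Longrightarrow> F y = 0"
  using assms unfolding subvariety_def by (auto elim!: toric_point_cases)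

lemma push_subvariety: "(`) push ` subvariety T Fs = subvariety T' Fs'"
proof (intro equalityI subsetI)
  fix q assume "q \<in> (`) push ` subvariety T Fs"
  then obtain p where p: "p \<in> subvariety T Fs" and q: "q = push ` p" by auto
  from p show "q \<in> subvariety T' Fs'"
  proof (rule subvariety_cases)
    fix x assume x: "x \<in> semistable T" "p = orbit T x" "p \<subseteq> semistable T"
      and F: "\<And>y F. y \<in> p \<Longrightarrow> F \<in> set Fs \<Longrightarrow> F y = 0"
    have "q \<in> toric_points T'"
      using x push_semistable by (auto simp: q push_orbit toric_points_def)
    moreover have "F (push y) = 0" if "y \<in> p" "F \<in> set Fs'" for y F
    proof -
      have "push y \<in> push ` {x \<in> semistable T. \<forall>F\<in>set Fs. F x = 0}"
        using that x(3) F by blast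
      then show ?thesis using that(2) unfolding zeros[symmetric] by simp
    qed
    ultimately show ?thesis by (auto simp: subvariety_def q)
  qed
next
  fix q assume q: "q \<in> subvariety T' Fs'"
  then obtain z where z: "z \<in> semistable T'" "q = orbit T' z" "z \<in> q" "q \<subseteq> semistable T'"
    by (auto simp: subvariety_def elim!: toric_point_cases)
  have zero: "q \<subseteq> push ` {x \<in> semistable T. \<forall>F\<in>set Fs. F x = 0}"
    using q z(4) unfolding zeros[symmetric] by (auto simp: subvariety_def)
  then obtain x where x: "x \<in> semistable T" "z = push x" using z(3) by auto
  then have eq: "q = push ` orbit T x" by (simp add: z(2) push_orbit)
  \<comment> \<open>Each point of the orbit of \<open>push x\<close> is the image of some zero of
    \<open>Fs\<close>; injectivity of \<open>push\<close> identifies that zero with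
    \<open>y\<close>.\<close>
  have "F y = 0" if "y \<in> orbit T x" "F \<in> set Fs" for y F
  proof -
    have "push y \<in> push ` {x \<in> semistable T. \<forall>F\<in>set Fs. F x = 0}"
      using zero that(1) unfolding eq by blast
    then obtain y' where y': "push y = push y'" "y' \<in> semistable T" "\<forall>F\<in>set Fs. F y' = 0"
      by auto
    have "y \<in> semistable T" using x(1) that(1) by (rule torus_orbit_semistable)
    with y' have "y = y'" using inj_onD[OF inj_push] by blast
    then show ?thesis using y'(3) that(2) by simp
  qed
  then have "orbit T x \<in> subvariety T Fs"
    using x(1) by (auto simp: subvariety_def toric_points_def)
  then show "q \<in> (`) push ` subvariety T Fs" using eq by blast
qed

lemma inj_push_subvariety: "inj_on ((`) push) (subvariety T Fs)"
proof (rule inj_onI)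
  fix p q assume "p \<in> subvariety T Fs" "q \<in> subvariety T Fs" "push ` p = push ` q"
  then show "p = q"
    using inj_push by (metis inj_on_image_eq_iff subvariety_cases)
qed

lemma topspace_zariski: "topspace (zariski T'' P) = P"
proof -
  have "homogeneous T'' (\<lambda>_. 0) (\<lambda>_. 1)"
    by (rule homogeneousI[of "{()}" "\<lambda>_ _. 0" _ _ _ "\<lambda>_. 1"]) (auto simp: zero_principal_divisor)
  then have "P \<in> {{p \<in> P. \<forall>x\<in>p. h x \<noteq> 0} |h. \<exists>b. homogeneous T'' b h}"
    by (intro CollectI exI[of _ "\<lambda>_. 1"]) auto
  then show ?thesis unfolding zariski_def topology_generated_by_topspace by blast
qed

lemma openin_zariski_basic:
  assumes "homogeneous T'' b h"
  shows "openin (zariski T'' P) {p \<in> P. \<forall>x\<in>p. h x \<noteq> 0}"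
  unfolding zariski_def by (rule topology_generated_by_Basis) (use assms in blast)

text \<open>A lift of \<open>h\<close> restricts to \<open>u y * h y\<close>, so its nonvanishing
  locus lies in the image and contains the point where it was lifted. The factor \<open>u\<close>
  depends on the point; the image is therefore shown to be open by neighbourhoods.\<close>

lemma open_push_basic:
  assumes h: "homogeneous T b h"
  shows "openin (zariski T' (subvariety T' Fs'))
    ((`) push ` {p \<in> subvariety T Fs. \<forall>x\<in>p. h x \<noteq> 0})" (is "openin ?Z ?W")
proof (subst openin_subopen, intro ballI)
  fix q assume "q \<in> ?W"
  then obtain p where p: "p \<in> subvariety T Fs" "\<And>x. x \<in> p \<Longrightarrow> h x \<noteq> 0" "q = push ` p" by auto
  from p(1) obtain x where x: "x \<in> semistable T" "p = orbit T x" "x \<in> p" by (rule subvariety_cases)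
  obtain u b' g' h' where u: "u x \<noteq> 0" and h': "homogeneous T' b' h'"
    and eq: "\<And>y. y \<in> affine_space T \<Longrightarrow> h' (push y) = u y * h y"
    by (rule homogeneous_lift[OF x(1) h h]) blast
  have aff: "y \<in> affine_space T" if "y \<in> semistable T" for y using that by (simp add: semistable_iff)
  let ?U = "{q \<in> subvariety T' Fs'. \<forall>z\<in>q. h' z \<noteq> 0}"
  have "h' (push x) \<noteq> 0" using u p(2)[OF x(3)] eq[OF aff[OF x(1)]] by simp
  then have "h' z \<noteq> 0" if "z \<in> q" for z
    using homogeneous_nonzero_on_orbit[OF h' push_affine] that
    by (simp add: p(3) x(2) push_orbit)
  then have "q \<in> ?U" using p(1,3) push_subvariety by auto
  moreover have "?U \<subseteq> ?W"
  proof
    fix r assume r: "r \<in> ?U"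
    then have "r \<in> (`) push ` subvariety T Fs" using push_subvariety by simp
    then obtain s where s: "s \<in> subvariety T Fs" "r = push ` s" by (rule imageE)
    then have "s \<subseteq> semistable T" by (auto elim: subvariety_cases)
    then have "h y \<noteq> 0" if "y \<in> s" for y
      using eq[of y] aff[of y] r s(2) that by auto
    then show "r \<in> ?W" using s by auto
  qed
  ultimately show "\<exists>U. openin ?Z U \<and> q \<in> U \<and> U \<subseteq> ?W"
    using openin_zariski_basic[OF h'] by blast
qed

lemma homeomorphic_push:
  "homeomorphic_map (zariski T (subvariety T Fs)) (zariski T' (subvariety T' Fs')) ((`) push)"
proof (rule bijective_open_imp_homeomorphic_map)
  show "continuous_map (zariski T (subvariety T Fs)) (zariski T' (subvariety T' Fs')) ((`) push)"
    unfolding zariski_def[of T']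
  proof (rule continuous_on_generated_topo)
    fix U assume "U \<in> {{p \<in> subvariety T' Fs'. \<forall>x\<in>p. h x \<noteq> 0} |h. \<exists>b. homogeneous T' b h}"
    then obtain h b where U: "U = {p \<in> subvariety T' Fs'. \<forall>x\<in>p. h x \<noteq> 0}" and h: "homogeneous T' b h"
      by auto
    have "(`) push -` U \<inter> topspace (zariski T (subvariety T Fs)) =
        {p \<in> subvariety T Fs. \<forall>x\<in>p. h (push x) \<noteq> 0}"
      using push_subvariety by (auto simp: U topspace_zariski)
    then show "openin (zariski T (subvariety T Fs))
        ((`) push -` U \<inter> topspace (zariski T (subvariety T Fs)))"
      using openin_zariski_basic[OF homogeneous_pull[OF h]] by simp
  next
    have "(`) push ` topspace (zariski T (subvariety T Fs)) = topspace (zariski T' (subvariety T' Fs'))"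
      by (simp add: topspace_zariski push_subvariety)
    then show "(`) push ` topspace (zariski T (subvariety T Fs)) \<subseteq>
        \<Union> {{p \<in> subvariety T' Fs'. \<forall>x\<in>p. h x \<noteq> 0} |h. \<exists>b. homogeneous T' b h}"
      unfolding zariski_def[of T'] topology_generated_by_topspace by (rule equalityD1)
  qed
  \<comment> \<open>Openness passes from the generating sets to all open sets; images commute with
    intersections because the map on orbits is injective.\<close>
  have "U \<subseteq> subvariety T Fs \<and> openin (zariski T' (subvariety T' Fs')) ((`) push ` U)"
    if "generate_topology_on {{p \<in> subvariety T Fs. \<forall>x\<in>p. h x \<noteq> 0} |h. \<exists>b. homogeneous T b h} U" for U
    using that
  proof induction
    case (Int U V)
    then show ?case
      by (auto simp: inj_on_image_Int[OF inj_push_subvariety])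
  next
    case (UN K)
    then show ?case by (auto simp: image_Union intro!: openin_Union)
  next
    case (Basis U)
    then show ?case by (auto intro: open_push_basic)
  qed auto
  then show "open_map (zariski T (subvariety T Fs)) (zariski T' (subvariety T' Fs')) ((`) push)"
    by (simp add: open_map_def zariski_def[of T] openin_topology_generated_by_iff)
qed (simp_all add: topspace_zariski push_subvariety inj_push_subvariety)

lemma regular_push:
  assumes W: "W \<subseteq> subvariety T' Fs'"
  shows "regular_on T' W f \<longleftrightarrow> regular_on T {p \<in> subvariety T Fs. push ` p \<in> W} (f \<circ> (`) push)"
    (is "_ \<longleftrightarrow> regular_on T ?W _")
proof
  assume reg: "regular_on T' W f"
  show "regular_on T ?W (f \<circ> (`) push)"
    unfolding regular_on_def
  proof
    fix p assume "p \<in> ?W"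
    then have "push ` p \<in> W" by simp
    from bspec[OF reg[unfolded regular_on_def] this]
    obtain g h where gh: "\<forall>z\<in>push ` p. (g, h) \<in> stalk T' (\<lambda>_. 0) z"
      and f: "\<forall>q\<in>W. \<forall>z\<in>q. h z \<noteq> 0 \<longrightarrow> f q = g z / h z"
      by (elim exE conjE)
    have "((\<lambda>x. g (push x)), (\<lambda>x. h (push x))) \<in> stalk T (\<lambda>_. 0) x" if x: "x \<in> p" for x
    proof -
      obtain c where "homogeneous T' c g" "homogeneous T' c h" "h (push x) \<noteq> 0"
        using bspec[OF gh imageI[OF x]] by (auto simp: stalk_def)
      then show ?thesis
        using homogeneous_pull[of c g] homogeneous_pull[of c h] by (auto simp: stalk_def)
    qed
    moreover have "(f \<circ> (`) push) q = g (push x) / h (push x)"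
      if "q \<in> ?W" "x \<in> q" "h (push x) \<noteq> 0" for q x
      using f[rule_format, of "push ` q" "push x"] that by simp
    ultimately show "\<exists>g h. (\<forall>x\<in>p. (g, h) \<in> stalk T (\<lambda>_. 0) x) \<and>
        (\<forall>q\<in>?W. \<forall>x\<in>q. h x \<noteq> 0 \<longrightarrow> (f \<circ> (`) push) q = g x / h x)" by blast
  qed
next
  assume reg: "regular_on T ?W (f \<circ> (`) push)"
  show "regular_on T' W f"
    unfolding regular_on_def
  proof
    fix w assume w: "w \<in> W"
    then have "w \<in> (`) push ` subvariety T Fs" using W push_subvariety by blast
    then obtain p where p: "p \<in> subvariety T Fs" "w = push ` p" by blast
    from p(1) obtain x where x: "x \<in> semistable T" "p = orbit T x" "x \<in> p" by (rule subvariety_cases)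
    obtain g h where gh: "(g, h) \<in> stalk T (\<lambda>_. 0) x"
      and f: "\<And>q y. q \<in> ?W \<Longrightarrow> y \<in> q \<Longrightarrow> h y \<noteq> 0 \<Longrightarrow> f (push ` q) = g y / h y"
    proof -
      have "p \<in> ?W" using p w by simp
      from bspec[OF reg[unfolded regular_on_def] this]
      obtain g h where "\<forall>x\<in>p. (g, h) \<in> stalk T (\<lambda>_. 0) x"
        "\<forall>q\<in>?W. \<forall>y\<in>q. h y \<noteq> 0 \<longrightarrow> (f \<circ> (`) push) q = g y / h y"
        by (elim exE conjE)
      then show thesis using that[of g h] x(3) by simp
    qed
    from gh obtain c where g: "homogeneous T c g" and h: "homogeneous T c h" and hx: "h x \<noteq> 0"
      unfolding stalk_def by auto
    \<comment> \<open>The common factor \<open>u\<close> cancels: where \<open>h'\<close> is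
      nonzero, so are \<open>u\<close> and \<open>h\<close>, and \<open>g' / h'\<close> equals
      \<open>g / h\<close>.\<close>
    obtain u b' g' h' where u: "u x \<noteq> 0" and g': "homogeneous T' b' g'" and h': "homogeneous T' b' h'"
      and geq: "\<And>y. y \<in> affine_space T \<Longrightarrow> g' (push y) = u y * g y"
      and heq: "\<And>y. y \<in> affine_space T \<Longrightarrow> h' (push y) = u y * h y"
      by (rule homogeneous_lift[OF x(1) g h]) blast
    have aff: "y \<in> affine_space T" if "y \<in> semistable T" for y using that by (simp add: semistable_iff)
    have "h' (push x) \<noteq> 0" using u hx heq[OF aff[OF x(1)]] by simp
    then have "h' z \<noteq> 0" if "z \<in> w" for z
      using homogeneous_nonzero_on_orbit[OF h' push_affine] that
      by (simp add: p(2) x(2) push_orbit)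
    then have "(g', h') \<in> stalk T' (\<lambda>_. 0) z" if "z \<in> w" for z
      using g' h' that by (auto simp: stalk_def)
    moreover have "f q = g' z / h' z" if "q \<in> W" "z \<in> q" "h' z \<noteq> 0" for q z
    proof -
      have "q \<in> (`) push ` subvariety T Fs" using W \<open>q \<in> W\<close> push_subvariety by blast
      then obtain s where s: "s \<in> subvariety T Fs" "q = push ` s" by blast
      then obtain y where y: "y \<in> s" "z = push y" using \<open>z \<in> q\<close> by auto
      have "s \<subseteq> semistable T" using s(1) by (auto elim: subvariety_cases)
      then have "y \<in> affine_space T" using y(1) aff by blast
      then show ?thesis
        using f[of s y] geq[of y] heq[of y] \<open>q \<in> W\<close> \<open>h' z \<noteq> 0\<close> y s by simp
    qed
    ultimately show "\<exists>g h. (\<forall>x\<in>w. (g, h) \<in> stalk T' (\<lambda>_. 0) x) \<and>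
        (\<forall>q\<in>W. \<forall>x\<in>q. h x \<noteq> 0 \<longrightarrow> f q = g x / h x)" by blast
  qed
qed

lemma isomorphic_via_push:
  "isomorphic_via T (subvariety T Fs) T' (subvariety T' Fs') push"
  unfolding isomorphic_via_def variety_isomorphism_def
proof (intro exI[of _ "(`) push"] conjI ballI allI impI)
  fix W f assume "openin (zariski T' (subvariety T' Fs')) W"
  then have "W \<subseteq> subvariety T' Fs'"
    using openin_subset topspace_zariski by metis
  then show "regular_on T' W f \<longleftrightarrow>
      regular_on T {p \<in> subvariety T Fs. push ` p \<in> W} (f \<circ> (`) push)"
    by (rule regular_push)
qed (use push_semistable push_orbit homeomorphic_push in auto)

end

end

section \<open>Characters of the toric variety of an edge\<close>

lemma lookup_scaleR:
  "Poly_Mapping.lookup (r *\<^sub>R c) j = r *\<^sub>R Poly_Mapping.lookup c j"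
proof -
  have "finite {j. r *\<^sub>R Poly_Mapping.lookup c j \<noteq> 0}"
    by (rule finite_subset[OF _ finite_lookup[of c]]) auto
  then show ?thesis by (simp add: scaleR_poly_mapping_def Abs_poly_mapping_inverse)
qed

text \<open>The reflection of \<open>u l\<close> in the midpoint of its two neighbours is again a lattice
  point strictly between them, so it is \<open>u l\<close> itself.\<close>

lemma lattice_points_equidistant:
  fixes u :: "nat \<Rightarrow> real ^ 'd"
  assumes cvx: "convex \<Gamma>" and bij: "bij_betw u {0..k + 1} (\<Gamma> \<inter> std_lattice)"
    and ord: "\<And>p q r. p < q \<Longrightarrow> q < r \<Longrightarrow> r \<le> k + 1 \<Longrightarrow> u q \<in> open_segment (u p) (u r)"
    and l: "l \<le> k + 1"
  shows "u l = u 0 + real l *\<^sub>R ((1 / real (k + 1)) *\<^sub>R (u (k + 1) - u 0))"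
proof -
  have mem: "u l \<in> \<Gamma>" "u l \<in> std_lattice" if "l \<le> k + 1" for l
    using bij_betwE[OF bij] that by auto
  have step: "u (l + 1) - u l = u l - u (l - 1)" if l: "0 < l" "l \<le> k" for l
  proof -
    define q where "q = u (l - 1) + u (l + 1) - u l"
    have seg: "u l \<in> open_segment (u (l - 1)) (u (l + 1))" using ord[of "l - 1" l "l + 1"] l by simp
    then obtain t where t: "0 < t" "t < 1" "u (l - 1) \<noteq> u (l + 1)"
      "u l = (1 - t) *\<^sub>R u (l - 1) + t *\<^sub>R u (l + 1)"
      by (auto simp: in_segment)
    have "q = (1 - (1 - t)) *\<^sub>R u (l - 1) + (1 - t) *\<^sub>R u (l + 1)"
      unfolding q_def t(4) by (simp add: algebra_simps)
    then have q: "q \<in> open_segment (u (l - 1)) (u (l + 1))"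
      using t(1-3) unfolding in_segment by (intro conjI exI[of _ "1 - t"]) auto
    have "u (l - 1) \<in> \<Gamma>" "u (l + 1) \<in> \<Gamma>" using mem(1)[of "l - 1"] mem(1)[of "l + 1"] l by auto
    then have "q \<in> \<Gamma>" using q cvx closed_segment_subset segment_open_subset_closed by blast
    moreover have "q \<in> std_lattice"
      using mem(2)[of "l - 1"] mem(2)[of l] mem(2)[of "l + 1"] l
      by (simp add: q_def std_lattice_def)
    ultimately have "q \<in> u ` {0..k + 1}" using bij_betw_imp_surj_on[OF bij] by simp
    then obtain m where m: "m \<le> k + 1" "q = u m" by auto
    \<comment> \<open>Both exclusions compare distances: \<open>q\<close> and the neighbour that it
      would have to pass would each be strictly nearer to the opposite neighbour than the
      other.\<close>
    have "\<not> m < l - 1"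
    proof
      assume "m < l - 1"
      then have "u (l - 1) \<in> open_segment q (u (l + 1))" using ord[of m "l - 1" "l + 1"] l m by simp
      from dist_in_open_segment[OF this] dist_in_open_segment[OF q] show False by simp
    qed
    moreover have "\<not> l + 1 < m"
    proof
      assume "l + 1 < m"
      then have "u (l + 1) \<in> open_segment (u (l - 1)) q" using ord[of "l - 1" "l + 1" m] l m by simp
      from dist_in_open_segment[OF this] dist_in_open_segment[OF q] show False
        by (simp add: dist_commute)
    qed
    moreover have "m \<noteq> l - 1" "m \<noteq> l + 1" using q m by (auto simp: open_segment_def)
    ultimately have "m = l" by linarith
    then show ?thesis using m(2) q_def by (simp add: algebra_simps)
  qed
  have diff: "u (l + 1) - u l = u 1 - u 0" if "l \<le> k" for l
    using that
  proof (induction l)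
    case (Suc l)
    then show ?case using step[of "Suc l"] by simp
  qed simp
  have lin: "u l = u 0 + real l *\<^sub>R (u 1 - u 0)" if "l \<le> k + 1" for l
    using that
  proof (induction l)
    case (Suc l)
    have "u (Suc l) = u l + (u 1 - u 0)" using diff[of l] Suc.prems by (simp add: algebra_simps)
    also have "u l = u 0 + real l *\<^sub>R (u 1 - u 0)" using Suc by simp
    finally show ?case by (simp only: of_nat_Suc scaleR_add_left scaleR_one add_ac)
  qed simp
  have "u (k + 1) - u 0 = real (k + 1) *\<^sub>R (u 1 - u 0)" using lin[of "k + 1"] by simp
  then have "(1 / real (k + 1)) *\<^sub>R (u (k + 1) - u 0) = u 1 - u 0" by simp
  then show ?thesis using lin[OF l] by simp
qed

lemma convex_cone_sum:
  assumes "convex_cone K" "\<And>j. j \<in> J \<Longrightarrow> f j \<in> K"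
  shows "sum f J \<in> K"
  using assms(2)
proof (induction J rule: infinite_finite_induct)
  case (insert j J)
  then show ?case using convex_cone_add[OF assms(1), of "f j" "sum f J"] by simp
qed (simp_all add: convex_cone_contains_0[OF assms(1)])

text \<open>Equal spacing is recorded separately because it ties the points of the edge to the
  vector in the generators of the t_j. It comes from the convexity of the edge and the ordered
  enumeration of its lattice points.\<close>

locale edge_configuration =
  fixes n k :: nat and e :: "nat \<Rightarrow> real ^ 'd" and \<Sigma> :: "(real ^ 'd) set set" and i :: "nat \<Rightarrow> nat"
  assumes fan: "fan std_lattice \<Sigma>"
    and minimal_generator: "\<And>l. l \<in> {1..n} \<Longrightarrow> e l \<in> minimal_generators std_lattice \<Sigma>"
    and edge_range: "\<And>l. l \<le> k + 1 \<Longrightarrow> i l \<in> {1..n}"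
    and edge_inj: "inj_on i {0..k + 1}"
    and edge_order: "\<And>p q r. p < q \<Longrightarrow> q < r \<Longrightarrow> r \<le> k + 1 \<Longrightarrow>
      e (i q) \<in> open_segment (e (i p)) (e (i r))"
    and equidistant: "\<And>l. l \<le> k + 1 \<Longrightarrow>
      e (i l) = e (i 0) + real l *\<^sub>R ((1 / real (k + 1)) *\<^sub>R (e (i (k + 1)) - e (i 0)))"
begin

definition w :: "real ^ 'd" where
  "w = (1 / real (k + 1)) *\<^sub>R (e (i (k + 1)) - e (i 0))"

abbreviation T :: "(real ^ 'd, nat) toric" where
  "T \<equiv> base_toric n e \<Sigma>"

abbreviation T' :: "((real ^ 'd) \<times> (nat \<Rightarrow>\<^sub>0 real), coord) toric" where
  "T' \<equiv> edge_toric n e \<Sigma> i k"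

abbreviation off_edge :: "nat set" where
  "off_edge \<equiv> {1..n} - i ` {0..k + 1}"

abbreviation V :: "coord set" where
  "V \<equiv> idx T'"

fun incidence :: "coord \<Rightarrow> nat set" where
  "incidence (Sc j) = i ` {0..<j}"
| "incidence (Tc j) = i ` {j + 1..k + 1}"
| "incidence (Yc l) = {l}"

lemma edge_point: "l \<le> k + 1 \<Longrightarrow> e (i l) = e (i 0) + real l *\<^sub>R w"
  unfolding w_def by (rule equidistant)

lemma idx_T: "idx T = {1..n}"
  by (auto simp: base_toric_def)

lemma base_toric_simps: "lat T = std_lattice" "cones T = \<Sigma>" "gens T = e"
  by (simp_all add: base_toric_def)

lemma idx_T': "V = Sc ` {1..k + 1} \<union> Tc ` {0..k} \<union> Yc ` off_edge"
  unfolding edge_toric_def edge_vars_def by (auto simp: image_iff)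

lemma set_edge_vars: "set (edge_vars n i k) = V"
  by (simp add: edge_toric_def)

lemma edge_toric_simps: "lat T' = edge_lattice k" "cones T' = edge_fan n e \<Sigma> i k"
  "gens T' = edge_gens e i k"
  by (simp_all add: edge_toric_def)

lemma edge_mem_image_iff:
  "l \<le> k + 1 \<Longrightarrow> A \<subseteq> {0..k + 1} \<Longrightarrow> i l \<in> i ` A \<longleftrightarrow> l \<in> A"
  by (rule inj_on_image_mem_iff[OF edge_inj]) auto

lemma idx_T_cases:
  assumes "r \<in> {1..n}"
  obtains l where "l \<le> k + 1" "r = i l" | "r \<in> off_edge"
  using assms by (cases "r \<in> i ` {0..k + 1}") auto

section \<open>Generators of the edge coordinates and their incidence with the edge\<close>

lemma Tc_gen:
  assumes "l \<in> {1..k + 1}"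
  shows "edge_gens e i k (Tc (l - 1)) = edge_gens e i k (Sc l) + (w, 0)"
  using assms by (auto simp: w_def)

lemma sum_Sc_gens: "(\<Sum>l=1..k + 1. edge_gens e i k (Sc l)) = (e (i 0), 0)"
proof -
  have "(\<Sum>l=1..k + 1. edge_gens e i k (Sc l)) =
      (\<Sum>l=1..k. (0, bvec l)) + (e (i 0), - (\<Sum>l\<in>{1..k}. bvec l))"
    by simp
  also have "(\<Sum>l=1..k. (0 :: real ^ 'd, bvec l)) = (0, \<Sum>l\<in>{1..k}. bvec l)"
    by (induction k) (simp_all add: zero_prod_def)
  finally show ?thesis by simp
qed

text \<open>In the sum of all s-generators the basis vectors cancel and \<open>e (i 0)\<close>
  remains. Each exchange of an s-generator for its partner t adds \<open>w\<close>, so only the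
  number of exchanges counts.\<close>

lemma sum_mixed_gens:
  assumes "A \<subseteq> {1..k + 1}"
  shows "(\<Sum>l=1..k + 1. edge_gens e i k (if l \<in> A then Tc (l - 1) else Sc l)) = (e (i (card A)), 0)"
proof -
  have "(\<Sum>l=1..k + 1. edge_gens e i k (if l \<in> A then Tc (l - 1) else Sc l)) =
      (\<Sum>l=1..k + 1. edge_gens e i k (Sc l) + (if l \<in> A then (w, 0) else 0))"
    by (intro sum.cong refl) (use Tc_gen in auto)
  also have "\<dots> = (e (i 0), 0) + (\<Sum>l\<in>A. (w, 0))"
  proof -
    have "(\<Sum>l=1..k + 1. if l \<in> A then (w, 0 :: nat \<Rightarrow>\<^sub>0 real) else 0) = (\<Sum>l\<in>{1..k + 1} \<inter> A. (w, 0))"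
      by (rule sum.inter_restrict[symmetric]) simp
    also have "{1..k + 1} \<inter> A = A" using assms by auto
    finally show ?thesis by (simp only: sum.distrib sum_Sc_gens)
  qed
  also have "(\<Sum>l\<in>A. (w, 0 :: nat \<Rightarrow>\<^sub>0 real)) = (real (card A) *\<^sub>R w, 0)"
    by (simp add: sum_constant_scaleR)
  also have "(e (i 0), 0 :: nat \<Rightarrow>\<^sub>0 real) + (real (card A) *\<^sub>R w, 0) = (e (i (card A)), 0)"
    using card_mono[OF _ assms] edge_point[of "card A"] by simp
  finally show ?thesis .
qed

text \<open>The variable at position \<open>l\<close> divides s_j exactly when \<open>l < j\<close>,
  and t_{j-1} exactly when \<open>j \<le> l\<close>; so exactly one member of each pair contains
  it.\<close>

lemma pull_edge:
  assumes l: "l \<le> k + 1"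
  shows "pull V incidence b (i l) = (\<Sum>j=1..k + 1. b (if j \<le> l then Tc (j - 1) else Sc j))"
proof -
  have "{c \<in> V. i l \<in> incidence c} = (\<lambda>j. if j \<le> l then Tc (j - 1) else Sc j) ` {1..k + 1}"
    (is "?A = ?f ` _")
  proof (intro equalityI subsetI)
    fix c assume c: "c \<in> ?A"
    show "c \<in> ?f ` {1..k + 1}"
    proof (cases c)
      case (Sc j)
      then have "j \<in> {1..k + 1}" using c by (auto simp: idx_T')
      moreover have "i l \<in> i ` {0..<j}" using c Sc by simp
      ultimately have "j \<in> {1..k + 1}" "l \<in> {0..<j}"
        using edge_mem_image_iff[OF l, of "{0..<j}"] by (simp_all add: subset_eq)
      then show ?thesis using Sc by (intro image_eqI[of _ _ j]) auto
    next
      case (Tc j)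
      then have "j \<le> k" using c by (auto simp: idx_T')
      moreover have "i l \<in> i ` {j + 1..k + 1}" using c Tc by simp
      ultimately have "j \<le> k" "l \<in> {j + 1..k + 1}"
        using edge_mem_image_iff[OF l, of "{j + 1..k + 1}"] by (simp_all add: subset_eq)
      then show ?thesis using Tc by (intro image_eqI[of _ _ "j + 1"]) auto
    next
      case (Yc m)
      then show ?thesis using c l by (auto simp: idx_T')
    qed
  next
    fix c assume "c \<in> ?f ` {1..k + 1}"
    then show "c \<in> ?A" using l by (auto simp: idx_T')
  qed
  moreover have "inj_on ?f {1..k + 1}" by (auto simp: inj_on_def split: if_splits)
  ultimately show ?thesis unfolding pull_def by (simp only: sum.reindex o_def)
qed

lemma pull_off_edge:
  assumes "r \<in> off_edge"
  shows "pull V incidence b r = b (Yc r)"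
proof -
  have "{c \<in> V. r \<in> incidence c} = {Yc r}" using assms by (auto simp: idx_T')
  then show ?thesis by (simp add: pull_def)
qed

lemma pull_edge_0: "pull V incidence b (i 0) = (\<Sum>j=1..k + 1. b (Sc j))"
  unfolding pull_edge[OF le0] by (intro sum.cong) auto

text \<open>Passing from position \<open>l - 1\<close> to \<open>l\<close> exchanges s_l for t_{l-1}
  and leaves all other pairs alone.\<close>

lemma pull_edge_step:
  fixes b :: "coord \<Rightarrow> 'a::ab_group_add"
  assumes "l \<in> {1..k + 1}"
  shows "pull V incidence b (i l) = pull V incidence b (i (l - 1)) + b (Tc (l - 1)) - b (Sc l)"
proof -
  let ?g = "\<lambda>l j. b (if j \<le> l then Tc (j - 1) else Sc j)"
  have "(\<Sum>j\<in>{1..k + 1} - {l}. ?g l j) = (\<Sum>j\<in>{1..k + 1} - {l}. ?g (l - 1) j)"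
    using assms by (intro sum.cong refl) (auto intro!: arg_cong[of _ _ b])
  moreover have "(\<Sum>j=1..k + 1. ?g m j) = ?g m l + (\<Sum>j\<in>{1..k + 1} - {l}. ?g m j)" for m
    by (rule sum.remove) (use assms in auto)
  ultimately have "(\<Sum>j=1..k + 1. ?g l j) - ?g l l = (\<Sum>j=1..k + 1. ?g (l - 1) j) - ?g (l - 1) l"
    by (simp only: add_diff_cancel_left')
  moreover have "?g l l = b (Tc (l - 1))" "?g (l - 1) l = b (Sc l)" using assms by auto
  moreover have "l \<le> k + 1" "l - 1 \<le> k + 1" using assms by auto
  ultimately show ?thesis by (simp only: pull_edge) (simp only: diff_eq_eq add_diff_eq diff_add_eq add_diff_cancel)
qed

text \<open>A character of the large lattice is restricted to \<open>N \<times> 0\<close>, where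
  mixed sums of generators represent the points of the edge. Conversely, a character of N is
  extended by prescribing its values on s_1, ..., s_k; the pullback forces the remaining values of
  \<open>b\<close>.\<close>

lemma principal_pull_iff:
  "pull V incidence b \<in> principal_divisors T \<longleftrightarrow> b \<in> principal_divisors T'"
proof
  assume "b \<in> principal_divisors T'"
  then obtain m where m: "linear m" and int: "\<And>v. v \<in> edge_lattice k \<Longrightarrow> m v \<in> \<int>"
    and b: "\<And>c. c \<in> V \<Longrightarrow> real_of_int (b c) = m (edge_gens e i k c)"
    by (auto simp: principal_divisors_def edge_toric_simps)
  show "pull V incidence b \<in> principal_divisors T"
    unfolding principal_divisors_def base_toric_simps
  proof (intro CollectI exI[of _ "\<lambda>v. m (v, 0)"] conjI ballI)
    show "linear (\<lambda>v. m (v, 0))"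
    proof (rule linearI)
      show "m (v + v', 0) = m (v, 0) + m (v', 0)" for v v'
        by (simp flip: linear_add[OF m])
      show "m (r *\<^sub>R v, 0) = r *\<^sub>R m (v, 0)" for r v
        using linear_scale[OF m, of r "(v, 0)"] by simp
    qed
    show "m (v, 0) \<in> \<int>" if "v \<in> std_lattice" for v
      using int that by (simp add: edge_lattice_def)
    fix r assume "r \<in> idx T"
    then have "r \<in> {1..n}" by (simp add: idx_T)
    then show "real_of_int (pull V incidence b r) = m (e r, 0)"
    proof (cases rule: idx_T_cases)
      case (1 l)
      have "real_of_int (pull V incidence b r) =
          (\<Sum>j=1..k + 1. real_of_int (b (if j \<le> l then Tc (j - 1) else Sc j)))"
        by (simp only: 1(2) pull_edge[OF 1(1)] of_int_sum)
      also have "\<dots> = (\<Sum>j=1..k + 1. m (edge_gens e i k (if j \<in> {1..l} then Tc (j - 1) else Sc j)))"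
        by (intro sum.cong refl, subst b) (auto simp: idx_T')
      also have "\<dots> = m (\<Sum>j=1..k + 1. edge_gens e i k (if j \<in> {1..l} then Tc (j - 1) else Sc j))"
        by (simp only: linear_sum[OF m])
      also have "\<dots> = m (e r, 0)"
        by (subst sum_mixed_gens) (use 1 in auto)
      finally show ?thesis .
    next
      case 2
      then have "Yc r \<in> V" by (simp add: idx_T')
      then show ?thesis using b[of "Yc r"] 2 by (simp add: pull_off_edge del: Diff_iff)
    qed
  qed
next
  assume "pull V incidence b \<in> principal_divisors T"
  then obtain m where m: "linear m" and int: "\<And>v. v \<in> std_lattice \<Longrightarrow> m v \<in> \<int>"
    and b: "\<And>r. r \<in> {1..n} \<Longrightarrow> real_of_int (pull V incidence b r) = m (e r)"
    unfolding principal_divisors_def base_toric_simps idx_T mem_Collect_eq by blast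
  \<comment> \<open>The generators of s_1, ..., s_k are the basis vectors of Z^k, so
    \<open>M\<close> has to take the values \<open>b (Sc j)\<close> there; on N it is
    \<open>m\<close>.\<close>
  define M where "M = (\<lambda>(v, c). m v + (\<Sum>j=1..k. real_of_int (b (Sc j)) * Poly_Mapping.lookup c j))"
  have lin: "linear M"
    unfolding M_def
    by (rule linearI)
      (auto simp: linear_add[OF m] linear_scale[OF m] lookup_add lookup_scaleR algebra_simps
        sum.distrib sum_distrib_left)
  have lookup_b: "Poly_Mapping.lookup (bvec j) l = (if l = j then 1 else 0)" for j l
    by (simp add: lookup_single when_def)
  have m_edge: "real_of_int (pull V incidence b (i l)) = m (e (i l))" if "l \<le> k + 1" for l
    using b edge_range[OF that] by simp
  have sum_Sc: "(\<Sum>j=1..k + 1. real_of_int (b (Sc j))) = m (e (i 0))"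
    using m_edge[of 0] by (simp add: pull_edge_0)
  have M_Sc: "M (edge_gens e i k (Sc j)) = real_of_int (b (Sc j))" if "j \<in> {1..k + 1}" for j
  proof (cases "j \<le> k")
    case True
    then show ?thesis
      using that by (simp add: M_def lookup_b linear_0[OF m] if_distrib cong: if_cong)
  next
    case False
    then have "j = k + 1" using that by simp
    have "Poly_Mapping.lookup (\<Sum>l\<in>{1..k}. bvec l) j = 1" if "j \<in> {1..k}" for j
      using that by (simp add: lookup_sum lookup_b)
    then have "M (edge_gens e i k (Sc j)) = m (e (i 0)) - (\<Sum>j=1..k. real_of_int (b (Sc j)))"
      using False by (simp add: M_def sum_negf)
    also have "\<dots> = real_of_int (b (Sc j))" using sum_Sc \<open>j = k + 1\<close> by simp
    finally show ?thesis .
  qed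
  \<comment> \<open>The jump of the pullback between neighbours on the edge is \<open>m w\<close> at
    every position; this ties \<open>b (Tc (l - 1))\<close> to \<open>b (Sc l)\<close>.\<close>
  have mw: "m w = real_of_int (b (Tc (l - 1))) - real_of_int (b (Sc l))" if "l \<in> {1..k + 1}" for l
  proof -
    have "e (i l) - e (i (l - 1)) = w"
      using that edge_point[of l] edge_point[of "l - 1"]
      by (cases l) (auto simp: algebra_simps)
    then have "m w = m (e (i l)) - m (e (i (l - 1)))"
      using linear_diff[OF m, of "e (i l)" "e (i (l - 1))"] by simp
    also have "\<dots> = real_of_int (pull V incidence b (i l)) - real_of_int (pull V incidence b (i (l - 1)))"
    proof -
      have "l \<le> k + 1" "l - 1 \<le> k + 1" using that by auto
      then show ?thesis by (simp only: m_edge)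
    qed
    also have "\<dots> = real_of_int (b (Tc (l - 1))) - real_of_int (b (Sc l))"
      using pull_edge_step[OF that, of b] by simp
    finally show ?thesis .
  qed
  have M_Tc: "M (edge_gens e i k (Tc j)) = real_of_int (b (Tc j))" if "j \<le> k" for j
  proof -
    have "M (edge_gens e i k (Tc j)) = M (edge_gens e i k (Sc (j + 1))) + M (w, 0)"
      unfolding linear_add[OF lin, symmetric] using Tc_gen[of "j + 1"] that
      by (simp del: edge_gens.simps)
    also have "M (edge_gens e i k (Sc (j + 1))) = real_of_int (b (Sc (j + 1)))"
      by (rule M_Sc) (use that in auto)
    also have "M (w, 0) = m w" by (simp add: M_def)
    also have "m w = real_of_int (b (Tc j)) - real_of_int (b (Sc (j + 1)))"
      using mw[of "j + 1"] that by simp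
    finally show ?thesis by simp
  qed
  show "b \<in> principal_divisors T'"
    unfolding principal_divisors_def edge_toric_simps
  proof (intro CollectI exI[of _ M] conjI ballI lin)
    fix v :: "(real ^ 'd) \<times> (nat \<Rightarrow>\<^sub>0 real)"
    assume "v \<in> edge_lattice k"
    then show "M v \<in> \<int>"
      by (auto simp: M_def edge_lattice_def int intro!: Ints_add Ints_sum Ints_mult)
  next
    fix c assume c: "c \<in> V"
    show "real_of_int (b c) = M (edge_gens e i k c)"
    proof (cases c)
      case (Sc j)
      then have "j \<in> {1..k + 1}" using c by (auto simp: idx_T')
      then show ?thesis unfolding Sc by (simp only: M_Sc)
    next
      case (Tc j)
      then have "j \<le> k" using c by (auto simp: idx_T')
      then show ?thesis unfolding Tc by (simp only: M_Tc)
    next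
      case (Yc l)
      then have "l \<in> off_edge" using c by (auto simp: idx_T')
      then show ?thesis using b[of l] by (simp add: Yc M_def pull_off_edge)
    qed
  qed
qed

sublocale monomial_map T T' incidence
proof
  fix c assume "c \<in> V"
  then show "incidence c \<subseteq> idx T"
    using edge_range by (auto simp: idx_T' idx_T)
qed (rule principal_pull_iff)

lemma push_edge_embedding: "push = edge_embedding n i k"
proof (intro ext)
  fix x :: "nat \<Rightarrow> complex" and c
  show "push x c = edge_embedding n i k x c"
  proof (cases "c \<in> V")
    case True
    have "inj_on i {0..<j}" if "j \<le> Suc k" for j
      by (rule inj_on_subset[OF edge_inj]) (use that in auto)
    moreover have "inj_on i {j..Suc k}" for j
      by (rule inj_on_subset[OF edge_inj]) auto
    ultimately show ?thesis using True
      by (cases c) (auto simp: push_def edge_embedding_def prod.reindex set_edge_vars idx_T')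
  qed (simp add: push_def edge_embedding_def set_edge_vars)
qed

end

section \<open>Inverting the embedding\<close>

context edge_configuration
begin

lemma push_simps:
  "j \<in> {1..k + 1} \<Longrightarrow> push x (Sc j) = (\<Prod>l\<in>{0..<j}. x (i l))"
  "j \<le> k \<Longrightarrow> push x (Tc j) = (\<Prod>l\<in>{j + 1..k + 1}. x (i l))"
  "l \<in> off_edge \<Longrightarrow> push x (Yc l) = x l"
  unfolding push_edge_embedding edge_embedding_def set_edge_vars by (auto simp: idx_T')

text \<open>The exponent vector \<open>E\<close> factors through \<open>push\<close>: the monomials
  \<open>s\<^sub>1, \<dots>, s\<^bsub>p+1\<^esub>\<close> absorb its decrease up to position \<open>p\<close>, and
  \<open>t\<^sub>p, \<dots>, t\<^sub>k\<close> its increase from position \<open>p + 1\<close> on.\<close>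

fun lift :: "nat \<Rightarrow> (nat \<Rightarrow> int) \<Rightarrow> coord \<Rightarrow> int" where
  "lift p E (Sc j) = (if j \<le> p then E (i (j - 1)) - E (i j) else if j = p + 1 then E (i p) else 0)"
| "lift p E (Tc j) = (if j < p then 0 else if j = p then E (i (p + 1)) else E (i (j + 1)) - E (i j))"
| "lift p E (Yc l) = E l"

text \<open>At position 0 the s-exponents telescope to \<open>E (i 0)\<close>. The step from
  \<open>l\<close> to \<open>l + 1\<close> is carried by s_{l+1} alone if \<open>l < p\<close>, by
  t_l alone if \<open>p < l\<close>, and by both at \<open>l = p\<close>, where
  \<open>E (i p)\<close> is exchanged for \<open>E (i (p + 1))\<close>.\<close>

lemma pull_lift:
  assumes p: "p \<le> k" and r: "r \<in> {1..n}"
  shows "pull V incidence (lift p E) r = E r"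
  using r
proof (cases rule: idx_T_cases)
  case (1 l)
  have telescope: "(\<Sum>j=1..q. E (i (j - 1)) - E (i j)) = E (i 0) - E (i q)" for q
    by (induction q) auto
  have "pull V incidence (lift p E) (i l) = E (i l)" if "l \<le> k + 1" for l
    using that
  proof (induction l)
    case 0
    have "(\<Sum>j=1..k + 1. lift p E (Sc j)) = (\<Sum>j=1..p + 1. lift p E (Sc j))"
      using p by (intro sum.mono_neutral_right) auto
    also have "\<dots> = (\<Sum>j=1..p. E (i (j - 1)) - E (i j)) + E (i p)"
      by simp
    also have "\<dots> = E (i 0)" using telescope[of p] by linarith
    finally show ?case by (simp only: pull_edge_0)
  next
    case (Suc l)
    have "pull V incidence (lift p E) (i (Suc l)) =
        pull V incidence (lift p E) (i l) + lift p E (Tc l) - lift p E (Sc (Suc l))"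
      using pull_edge_step[of "Suc l" "lift p E"] Suc.prems by simp
    also have "\<dots> = E (i (Suc l))" using Suc by auto
    finally show ?case .
  qed
  then show ?thesis using 1 by simp
next
  case 2
  then show ?thesis by (simp only: pull_off_edge lift.simps)
qed

lemma push_surj:
  assumes p: "p \<le> k" and z: "z \<in> affine_space T'"
    and eq: "\<And>j. j \<in> {1..k} \<Longrightarrow> z (Sc (j + 1)) * z (Tc j) = z (Sc j) * z (Tc (j - 1))"
    and s0: "\<And>j. j \<in> {1..p} \<Longrightarrow> z (Sc j) \<noteq> 0"
    and t0: "\<And>j. j \<in> {p + 1..k} \<Longrightarrow> z (Tc j) \<noteq> 0"
  obtains x where "x \<in> affine_space T" "push x = z"
proof -
  \<comment> \<open>The value 1 at index 0, and for \<open>t\<close> at index \<open>k + 1\<close>,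
    is the empty product that s_0 and t_{k+1} would be.\<close>
  define s where "s j = (if j = 0 then 1 else z (Sc j))" for j
  define t where "t j = (if k < j then 1 else z (Tc j))" for j
  \<comment> \<open>Quotients of consecutive s up to the cutoff and of consecutive t beyond it; each
    denominator is nonzero on its side. The binomial equations make the two kinds of quotients
    agree, so that the products return all s and all t.\<close>
  define \<xi> where "\<xi> l = (if l \<le> p then s (l + 1) / s l else t (l - 1) / t l)" for l
  define x where "x = (\<lambda>r\<in>{1..n}. if r \<in> i ` {0..k + 1}
    then \<xi> (the_inv_into {0..k + 1} i r) else z (Yc r))"
  have st: "s (j + 1) * t j = s j * t (j - 1)" if "j \<in> {1..k}" for j
    using eq[OF that] that by (auto simp: s_def t_def)
  have s: "s j \<noteq> 0" if "j \<le> p" for j using s0[of j] that by (auto simp: s_def)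
  have t: "t j \<noteq> 0" if "p < j" for j using t0[of j] that by (auto simp: t_def)
  have x_edge: "x (i l) = \<xi> l" if "l \<le> k + 1" for l
    using that edge_range[OF that] the_inv_into_f_f[OF edge_inj, of l] by (auto simp: x_def)
  have prod_s: "(\<Prod>l\<in>{0..<m}. \<xi> l) = s m" if "m \<le> k + 1" for m
    using that
  proof (induction m)
    case 0
    then show ?case by (simp add: s_def)
  next
    case (Suc m)
    have "s m * \<xi> m = s (Suc m)"
    proof (cases "m \<le> p")
      case True
      then show ?thesis using s[of m] by (simp add: \<xi>_def)
    next
      case False
      then show ?thesis using st[of m] t[of m] Suc.prems by (simp add: \<xi>_def field_simps)
    qed
    then show ?case using Suc by simp
  qed
  have prod_t: "(\<Prod>l\<in>{m + 1..k + 1}. \<xi> l) = t m" if "m \<le> k + 1" for m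
    using that
  proof (induction m rule: inc_induct)
    case base
    then show ?case by (simp add: t_def)
  next
    case (step m)
    have "\<xi> (m + 1) * t (m + 1) = t m"
    proof (cases "m + 1 \<le> p")
      case True
      then show ?thesis using st[of "m + 1"] s[of "m + 1"] p by (simp add: \<xi>_def field_simps)
    next
      case False
      then show ?thesis using t[of "m + 1"] by (simp add: \<xi>_def)
    qed
    moreover have "{m + 1..k + 1} = insert (m + 1) {Suc m + 1..k + 1}" using step by auto
    ultimately show ?case using step by simp
  qed
  show thesis
  proof
    show "x \<in> affine_space T" by (simp add: x_def affine_space_def idx_T)
    show "push x = z"
    proof
      fix c
      show "push x c = z c"
      proof (cases "c \<in> V")
        case True
        show ?thesis
        proof (cases c)
          case (Sc j)
          then have j: "j \<in> {1..k + 1}" using True by (auto simp: idx_T')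
          then have "push x c = (\<Prod>l\<in>{0..<j}. \<xi> l)"
            unfolding Sc push_simps(1)[OF j] by (intro prod.cong refl x_edge) auto
          then show ?thesis using prod_s[of j] j by (simp add: Sc s_def)
        next
          case (Tc j)
          then have j: "j \<le> k" using True by (auto simp: idx_T')
          then have "push x c = (\<Prod>l\<in>{j + 1..k + 1}. \<xi> l)"
            unfolding Tc push_simps(2)[OF j] by (intro prod.cong refl x_edge) auto
          then show ?thesis using prod_t[of j] j by (simp add: Tc t_def)
        next
          case (Yc l)
          then have l: "l \<in> off_edge" using True by (auto simp: idx_T')
          show ?thesis unfolding Yc push_simps(3)[OF l] using l by (simp add: x_def)
        qed
      next
        case False
        have "c \<notin> V \<Longrightarrow> y c = undefined" if "y \<in> affine_space T'" for y
          using that by (auto simp: affine_space_def)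
        then show ?thesis using False z push_affine by metis
      qed
    qed
  qed
qed

text \<open>Cancellation in s_{l+1} = s_l x_{i_l} recovers the coordinate for
  \<open>l \<le> p\<close>, cancellation in t_{l-1} = x_{i_l} t_l for \<open>l > p\<close>, with s_0
  and t_{k+1} read as 1.\<close>

lemma push_eqD:
  assumes p: "p \<le> k" and x: "x \<in> affine_space T" and y: "y \<in> affine_space T"
    and eq: "push x = push y"
    and s0: "\<And>j. j \<in> {1..p} \<Longrightarrow> push x (Sc j) \<noteq> 0"
    and t0: "\<And>j. j \<in> {p + 1..k} \<Longrightarrow> push x (Tc j) \<noteq> 0"
  shows "x = y"
proof -
  have s: "(\<Prod>l\<in>{0..<j}. x (i l)) = (\<Prod>l\<in>{0..<j}. y (i l))" if "j \<le> k + 1" for j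
    using that eq push_simps(1)[of j x] push_simps(1)[of j y] by (cases "j = 0") auto
  have t: "(\<Prod>l\<in>{j + 1..k + 1}. x (i l)) = (\<Prod>l\<in>{j + 1..k + 1}. y (i l))" if "j \<le> k + 1" for j
    using that eq push_simps(2)[of j x] push_simps(2)[of j y] by (cases "j = k + 1") auto
  have edge: "x (i l) = y (i l)" if l: "l \<le> k + 1" for l
  proof (cases "l \<le> p")
    case True
    have "(\<Prod>l\<in>{0..<l}. x (i l)) \<noteq> 0"
      using True p s0[of l] push_simps(1)[of l] by (cases "l = 0") auto
    moreover have "(\<Prod>l\<in>{0..<l}. x (i l)) * x (i l) = (\<Prod>l\<in>{0..<l}. x (i l)) * y (i l)"
      using s[of l] s[of "l + 1"] True p by simp
    ultimately show ?thesis by simp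
  next
    case False
    have "(\<Prod>l\<in>{l + 1..k + 1}. x (i l)) \<noteq> 0"
      using False l t0[of l] push_simps(2)[of l] by (cases "l = k + 1") auto
    moreover have "x (i l) * (\<Prod>l\<in>{l + 1..k + 1}. x (i l)) = y (i l) * (\<Prod>l\<in>{l + 1..k + 1}. x (i l))"
    proof -
      have "{l - 1 + 1..k + 1} = insert l {l + 1..k + 1}" using False l by auto
      then show ?thesis using t[of "l - 1"] t[of l] False l by simp
    qed
    ultimately show ?thesis by simp
  qed
  show ?thesis
  proof
    fix r
    show "x r = y r"
    proof (cases "r \<in> {1..n}")
      case True
      then show ?thesis
      proof (cases rule: idx_T_cases)
        case 2
        then show ?thesis using eq push_simps(3)[of r] by metis
      qed (simp add: edge)
    next
      case False
      then show ?thesis using x y PiE_arb unfolding affine_space_def idx_T by metis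
    qed
  qed
qed

text \<open>The exponent of s_{j+1} t_j; the case \<open>j = 0\<close> is the factor s_1 t_0 of X_m.
  All of these monomials pull back to the product of the edge variables and so share one
  degree.\<close>

definition binomial_exponent :: "nat \<Rightarrow> coord \<Rightarrow> nat" where
  "binomial_exponent j c = (if c = Sc (j + 1) \<or> c = Tc j then 1 else 0)"

lemma pull_binomial_exponent:
  assumes j: "j \<le> k" and r: "r \<in> {1..n}"
  shows "pull V incidence (binomial_exponent j) r = (if r \<in> i ` {0..k + 1} then 1 else 0)"
  using r
proof (cases rule: idx_T_cases)
  case (1 l)
  have "pull V incidence (binomial_exponent j) r = (\<Sum>m=1..k + 1. if m = j + 1 then 1 else 0)"
    unfolding 1(2) pull_edge[OF 1(1)]
    by (intro sum.cong refl) (auto simp: binomial_exponent_def)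
  also have "\<dots> = 1" using j by (simp del: sum.cl_ivl_Suc)
  finally show ?thesis using 1 by simp
next
  case 2
  have "pull V incidence (binomial_exponent j) r = 0"
    unfolding pull_off_edge[OF 2] by (simp add: binomial_exponent_def)
  then show ?thesis using 2 by auto
qed

lemma binomial_monomial:
  assumes "j \<le> k"
  shows "(\<Prod>c\<in>V. z c ^ binomial_exponent j c) = z (Sc (j + 1)) * z (Tc j)"
proof -
  have "(\<Prod>c\<in>V. z c ^ binomial_exponent j c) = (\<Prod>c\<in>{Sc (j + 1), Tc j}. z c ^ binomial_exponent j c)"
    by (rule prod.mono_neutral_right)
      (use assms in \<open>auto simp: idx_T' binomial_exponent_def\<close>)
  then show ?thesis by (simp add: binomial_exponent_def)
qed

lemma principal_if_pull_eq:
  assumes "\<And>r. r \<in> {1..n} \<Longrightarrow> pull V incidence \<alpha> r = pull V incidence \<beta> r"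
  shows "(\<lambda>c. int (\<alpha> c) - int (\<beta> c)) \<in> principal_divisors T'"
proof -
  have "pull V incidence (\<lambda>c. int (\<alpha> c) - int (\<beta> c)) \<in> principal_divisors T \<longleftrightarrow>
      (\<lambda>_. 0) \<in> principal_divisors T"
    by (rule principal_divisors_cong) (use assms in \<open>simp add: pull_diff pull_of_nat idx_T\<close>)
  then show ?thesis by (simp add: principal_pull_iff zero_principal_divisor)
qed

text \<open>The two monomials have the same degree, so their quotient is the character of a
  principal divisor and equals 1 on the torus group.\<close>

lemma torus_binomials:
  assumes g: "g \<in> torus_group T'" and j: "j \<in> {1..k}"
  shows "g (Sc (j + 1)) * g (Tc j) = g (Sc j) * g (Tc (j - 1))"
proof -
  have g0: "\<And>c. c \<in> V \<Longrightarrow> g c \<noteq> 0" using g by (simp add: torus_group_def)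
  have "(\<lambda>c. int (binomial_exponent j c) - int (binomial_exponent (j - 1) c)) \<in> principal_divisors T'"
  proof (rule principal_if_pull_eq)
    have "j \<le> k" "j - 1 \<le> k" using j by auto
    then show "pull V incidence (binomial_exponent j) r = pull V incidence (binomial_exponent (j - 1)) r"
      if "r \<in> {1..n}" for r
      using that by (simp only: pull_binomial_exponent)
  qed
  then have "(\<Prod>c\<in>V. g c powi (int (binomial_exponent j c) - int (binomial_exponent (j - 1) c))) = 1"
    using g by (simp add: torus_group_def)
  moreover have "(\<Prod>c\<in>V. g c powi (int (binomial_exponent j c) - int (binomial_exponent (j - 1) c))) =
      (\<Prod>c\<in>V. g c ^ binomial_exponent j c) / (\<Prod>c\<in>V. g c ^ binomial_exponent (j - 1) c)"
    unfolding prod_dividef[symmetric] by (intro prod.cong refl) (simp add: power_int_diff g0)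
  moreover have "(\<Prod>c\<in>V. g c ^ binomial_exponent (j - 1) c) \<noteq> 0" using g0 by simp
  ultimately have "(\<Prod>c\<in>V. g c ^ binomial_exponent j c) = (\<Prod>c\<in>V. g c ^ binomial_exponent (j - 1) c)"
    by (simp add: divide_eq_1_iff)
  moreover have "j \<le> k" "j - 1 \<le> k" "j - 1 + 1 = j" using j by auto
  ultimately show ?thesis by (simp only: binomial_monomial)
qed

lemma incidence_cover:
  assumes "r \<in> {1..n}"
  obtains c where "c \<in> V" "r \<in> incidence c"
  using assms
proof (cases rule: idx_T_cases)
  case (1 l)
  show ?thesis
  proof (cases "l = k + 1")
    case True
    then show ?thesis using 1 that[of "Tc 0"] by (simp add: idx_T')
  next
    case False
    then show ?thesis using 1 that[of "Sc (k + 1)"] by (simp add: idx_T')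
  qed
next
  case 2
  then show ?thesis using that[of "Yc r"] by (simp add: idx_T')
qed

text \<open>No coordinate vanishes on the torus group, so the cutoff \<open>k\<close> is admissible
  for solving \<open>push x = g'\<close>. A principal divisor of \<open>T\<close> lifts through
  \<open>lift k\<close> to one of \<open>T'\<close>, whose character is trivial on
  \<open>g'\<close>; this makes the original character trivial on \<open>x\<close>.\<close>

lemma torus_lift:
  assumes g': "g' \<in> torus_group T'"
  shows "\<exists>g\<in>torus_group T. push g = g'"
proof -
  have g0: "\<And>c. c \<in> V \<Longrightarrow> g' c \<noteq> 0" and aff: "g' \<in> affine_space T'"
    using g' by (auto simp: torus_group_def)
  obtain x where x: "x \<in> affine_space T" "push x = g'"
  proof (rule push_surj[of k g'])
    show "g' (Sc (j + 1)) * g' (Tc j) = g' (Sc j) * g' (Tc (j - 1))" if "j \<in> {1..k}" for j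
      using torus_binomials[OF g' that] .
    show "g' (Sc j) \<noteq> 0" if "j \<in> {1..k}" for j by (rule g0) (use that in \<open>simp add: idx_T'\<close>)
  qed (use aff in auto)
  have x0: "x r \<noteq> 0" if r: "r \<in> {1..n}" for r
  proof -
    obtain c where c: "c \<in> V" "r \<in> incidence c" using incidence_cover[OF r] .
    have "finite (incidence c)" using incidence_subset[OF c(1)] by (auto intro: finite_subset)
    then show ?thesis using g0[OF c(1)] c by (auto simp: push_def simp flip: x(2))
  qed
  have "(\<Prod>r\<in>idx T. x r powi b r) = 1" if b: "b \<in> principal_divisors T" for b
  proof -
    have "pull V incidence (lift k b) \<in> principal_divisors T \<longleftrightarrow> b \<in> principal_divisors T"
      by (rule principal_divisors_cong) (simp add: pull_lift idx_T)
    then have "lift k b \<in> principal_divisors T'" using b by (simp add: principal_pull_iff)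
    then have "(\<Prod>c\<in>V. push x c powi lift k b c) = 1" using g' by (simp add: torus_group_def x(2))
    moreover have "(\<Prod>c\<in>V. push x c powi lift k b c) =
        (\<Prod>r\<in>idx T. x r powi pull V incidence (lift k b) r)"
      by (rule push_laurent_monomial) (use x0 in \<open>simp add: idx_T\<close>)
    moreover have "\<dots> = (\<Prod>r\<in>idx T. x r powi b r)"
      by (intro prod.cong refl) (simp add: pull_lift idx_T)
    ultimately show ?thesis by simp
  qed
  then have "x \<in> torus_group T" using x(1) x0 by (simp add: torus_group_def idx_T)
  then show ?thesis using x(2) by blast
qed

lemma exponent_lift_at:
  assumes p: "p \<le> k" and x0: "\<And>l. l \<le> k + 1 \<Longrightarrow> l \<noteq> p \<Longrightarrow> l \<noteq> p + 1 \<Longrightarrow> x (i l) \<noteq> 0"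
    and A: "finite A"
  shows "\<exists>\<eta> L. (\<Prod>r\<in>idx T. x r ^ \<eta> r) \<noteq> (0 :: complex) \<and>
    (\<forall>\<alpha>\<in>A. \<forall>r\<in>idx T. pull V incidence (L \<alpha>) r = \<alpha> r + (\<eta> r :: nat))"
proof -
  define N where "N = (\<Sum>\<alpha>\<in>A. \<Sum>r=1..n. \<alpha> r)"
  have N: "\<alpha> r \<le> N" if "\<alpha> \<in> A" "r \<in> {1..n}" for \<alpha> r
  proof -
    have "\<alpha> r \<le> (\<Sum>r=1..n. \<alpha> r)" using that(2) by (intro member_le_sum) auto
    also have "\<dots> \<le> N" unfolding N_def using that(1) A by (intro member_le_sum) auto
    finally show ?thesis .
  qed
  \<comment> \<open>\<open>N\<close> times the distance of \<open>l\<close> from the pair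
    \<open>p\<close>, \<open>p + 1\<close>; truncated subtraction leaves at most one summand. The
    slope \<open>N\<close> outweighs every exponent in \<open>A\<close>, which makes the corrected
    exponents monotone on either side, and the zeros at \<open>p\<close> and \<open>p + 1\<close>
    keep possibly vanishing coordinates out of the correction.\<close>
  define \<delta> where "\<delta> l = N * (p - l) + N * (l - (p + 1))" for l
  define \<eta> where "\<eta> r = (if r \<in> i ` {0..k + 1} then \<delta> (the_inv_into {0..k + 1} i r) else 0)" for r
  have \<eta>: "\<eta> (i l) = \<delta> l" if "l \<le> k + 1" for l
    using that the_inv_into_f_f[OF edge_inj, of l] by (auto simp: \<eta>_def)
  define E where "E \<alpha> r = int (\<alpha> r + \<eta> r)" for \<alpha> r
  define L where "L \<alpha> c = nat (lift p (E \<alpha>) c)" for \<alpha> c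
  have nonneg: "lift p (E \<alpha>) c \<ge> 0" if \<alpha>: "\<alpha> \<in> A" and c: "c \<in> V" for \<alpha> c
  proof -
    have bound: "\<alpha> (i l) \<le> N" if "l \<le> k + 1" for l using N[OF \<alpha> edge_range[OF that]] .
    have down: "E \<alpha> (i j) \<le> E \<alpha> (i (j - 1))" if j: "1 \<le> j" "j \<le> p" for j
    proof -
      have "\<delta> (j - 1) = N + \<delta> j"
        using j p by (simp add: \<delta>_def Suc_diff_le)
      then show ?thesis using bound[of j] \<eta>[of j] \<eta>[of "j - 1"] j p by (simp add: E_def)
    qed
    have up: "E \<alpha> (i j) \<le> E \<alpha> (i (j + 1))" if j: "p < j" "j \<le> k" for j
    proof -
      have "j - p = Suc (j - (p + 1))" using j by simp
      then have "\<delta> (j + 1) = N + \<delta> j"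
        using j p by (simp add: \<delta>_def)
      then show ?thesis using bound[of j] \<eta>[of j] \<eta>[of "j + 1"] j p by (simp add: E_def)
    qed
    have E0: "E \<alpha> r \<ge> 0" for r by (simp add: E_def)
    show ?thesis
    proof (cases c)
      case (Sc j)
      then have "j \<in> {1..k + 1}" using c by (auto simp: idx_T')
      then show ?thesis using Sc down E0 by simp
    next
      case (Tc j)
      then have "j \<le> k" using c by (auto simp: idx_T')
      then show ?thesis using Tc up[of j] E0 by simp
    qed (simp add: E0)
  qed
  have "pull V incidence (L \<alpha>) r = \<alpha> r + \<eta> r" if \<alpha>: "\<alpha> \<in> A" and r: "r \<in> {1..n}" for \<alpha> r
  proof -
    have "int (pull V incidence (L \<alpha>) r) = pull V incidence (lift p (E \<alpha>)) r"
      unfolding pull_def of_nat_sum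
      by (intro sum.cong refl) (use nonneg[OF \<alpha>] in \<open>auto simp: L_def\<close>)
    also have "\<dots> = int (\<alpha> r + \<eta> r)" using pull_lift[OF p r] by (simp add: E_def)
    finally show ?thesis by simp
  qed
  moreover have "x r ^ \<eta> r \<noteq> 0" if "r \<in> {1..n}" for r
    using that
  proof (cases rule: idx_T_cases)
    case (1 l)
    show ?thesis
    proof (cases "l = p \<or> l = p + 1")
      case True
      then show ?thesis using 1 \<eta>[of l] by (auto simp: \<delta>_def)
    next
      case False
      then show ?thesis using 1 x0[of l] by simp
    qed
  next
    case 2
    then show ?thesis by (auto simp: \<eta>_def)
  qed
  ultimately show ?thesis by (intro exI[of _ \<eta>] exI[of _ L]) (simp add: idx_T)
qed

end

section \<open>Cones of the fan of an edge\<close>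

context edge_configuration
begin

lemma cone_convex: "\<sigma> \<in> \<Sigma> \<Longrightarrow> convex_cone \<sigma>"
  using fan by (auto simp: fan_def polyhedral_cone_def convex_cone_convex_cone_hull)

lemma generator_ray:
  assumes "l \<in> {1..n}"
  obtains \<rho> where "\<rho> \<in> \<Sigma>" "\<rho> \<inter> std_lattice = {of_nat a *\<^sub>R e l | a. True}" "e l \<noteq> 0"
  using minimal_generator[OF assms] unfolding minimal_generators_def by blast

lemma generator_lattice:
  assumes "l \<in> {1..n}"
  shows "e l \<in> std_lattice"
proof -
  obtain \<rho> where "\<rho> \<inter> std_lattice = {of_nat a *\<^sub>R e l | a. True}"
    using generator_ray[OF assms] by metis
  moreover have "e l \<in> {of_nat a *\<^sub>R e l | a. True}" by (intro CollectI exI[of _ 1]) simp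
  ultimately show ?thesis by blast
qed

text \<open>The ray through \<open>e (i q)\<close> is a cone of the fan, so it meets \<open>\<sigma>\<close> in a face of
  \<open>\<sigma>\<close>; a face that contains \<open>e (i q)\<close> also contains the ends of the segment.\<close>

lemma gens_on_edge_no_gap:
  assumes \<sigma>: "\<sigma> \<in> \<Sigma>" and pqr: "p < q" "q < r" and mem: "p \<in> gens_on_edge e i k \<sigma>" "r \<in> gens_on_edge e i k \<sigma>"
  shows False
proof -
  have r: "r \<le> k + 1" and e\<sigma>: "e (i p) \<in> \<sigma>" "e (i r) \<in> \<sigma>"
    using mem by (auto simp: gens_on_edge_def)
  have seg: "e (i q) \<in> open_segment (e (i p)) (e (i r))"
    using edge_order[OF pqr r] .
  have "convex \<sigma>" using cone_convex[OF \<sigma>] by (simp add: convex_cone_def)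
  then have q\<sigma>: "e (i q) \<in> \<sigma>"
    using seg e\<sigma> closed_segment_subset segment_open_subset_closed by blast
  have range: "i p \<in> {1..n}" "i q \<in> {1..n}" "i r \<in> {1..n}"
    using edge_range[of p] edge_range[of q] edge_range[of r] pqr r by auto
  obtain \<rho> where \<rho>: "\<rho> \<in> \<Sigma>" "\<rho> \<inter> std_lattice = {of_nat a *\<^sub>R e (i q) | a. True}" "e (i q) \<noteq> 0"
    using generator_ray[OF range(2)] .
  have "e (i q) \<in> {of_nat a *\<^sub>R e (i q) | a. True}" by (intro CollectI exI[of _ 1]) simp
  then have "e (i q) \<in> \<sigma> \<inter> \<rho>" using \<rho>(2) q\<sigma> by blast
  moreover have "(\<sigma> \<inter> \<rho>) face_of \<sigma>" using fan \<sigma> \<rho>(1) by (simp add: fan_def)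
  ultimately have "e (i p) \<in> \<rho>" "e (i r) \<in> \<rho>"
    using seg e\<sigma> unfolding face_of_def by blast+
  then have "e (i p) \<in> \<rho> \<inter> std_lattice" "e (i r) \<in> \<rho> \<inter> std_lattice"
    using generator_lattice range by auto
  then obtain a b :: nat where ab: "e (i p) = of_nat a *\<^sub>R e (i q)" "e (i r) = of_nat b *\<^sub>R e (i q)"
    unfolding \<rho>(2) by auto
  have "e (i p) \<noteq> 0" "e (i r) \<noteq> 0"
    using minimal_generator[OF range(1)] minimal_generator[OF range(3)]
    by (auto simp: minimal_generators_def)
  then have ab1: "a \<ge> 1" "b \<ge> 1" using ab by (auto simp: Suc_le_eq)
  obtain u where u: "0 < u" "u < 1" "e (i p) \<noteq> e (i r)"
    "e (i q) = (1 - u) *\<^sub>R e (i p) + u *\<^sub>R e (i r)"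
    using seg by (auto simp: in_segment)
  \<comment> \<open>Two integers that are at least 1 and have average 1 with positive weights are
    both 1, which would make the ends of the segment coincide.\<close>
  have "e (i q) = ((1 - u) * real a + u * real b) *\<^sub>R e (i q)"
    by (subst u(4), subst ab(1), subst ab(2)) (simp add: scaleR_add_left)
  then have "((1 - u) * real a + u * real b - 1) *\<^sub>R e (i q) = 0"
    by (simp add: scaleR_diff_left)
  then have "(1 - u) * real a + u * real b - 1 = 0"
    using \<rho>(3) by (simp only: scaleR_eq_0_iff) simp
  then have "(1 - u) * (real a - 1) + u * (real b - 1) = 0"
    by (simp add: algebra_simps)
  moreover have "(1 - u) * (real a - 1) \<ge> 0" "u * (real b - 1) \<ge> 0" using u ab1 by simp_all
  ultimately have "(1 - u) * (real a - 1) = 0" "u * (real b - 1) = 0" by linarith+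
  then have "real a = 1" "real b = 1" using u by simp_all
  then show False using u(3) ab by simp
qed

lemma gens_on_edge_cases:
  assumes \<sigma>: "\<sigma> \<in> \<Sigma>"
  obtains "gens_on_edge e i k \<sigma> = {}"
  | lo hi where "gens_on_edge e i k \<sigma> = {lo..hi}" "lo \<le> hi" "hi \<le> lo + 1" "hi \<le> k + 1"
proof (cases "gens_on_edge e i k \<sigma> = {}")
  case False
  let ?G = "gens_on_edge e i k \<sigma>"
  have fin: "finite ?G" by (simp add: gens_on_edge_def)
  have lo: "Min ?G \<in> ?G" and hi: "Max ?G \<in> ?G" using fin False by simp_all
  have le: "Min ?G \<le> Max ?G" using fin lo by simp
  have "\<not> Min ?G + 1 < Max ?G"
    using gens_on_edge_no_gap[OF \<sigma> _ _ lo hi, of "Min ?G + 1"] by auto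
  then have near: "Max ?G \<le> Min ?G + 1" by simp
  have "?G = {Min ?G..Max ?G}"
  proof (intro equalityI subsetI)
    fix x assume "x \<in> {Min ?G..Max ?G}"
    then have "x = Min ?G \<or> x = Max ?G" using near by auto
    then show "x \<in> ?G" using lo hi by auto
  qed (use fin in auto)
  moreover have "Max ?G \<le> k + 1" using hi by (simp add: gens_on_edge_def)
  ultimately show thesis using that(2) le near by blast
qed (rule that(1))

text \<open>One formula for both shapes of cone: \<open>hi = lo\<close> is one generator on the
  edge, \<open>hi = lo + 1\<close> two consecutive ones. The half-open range contributes t_0, ...,
  t_{hi-1}.\<close>

definition cone_coords :: "(real ^ 'd) set \<Rightarrow> nat \<Rightarrow> nat \<Rightarrow> coord set" where
  "cone_coords \<sigma> lo hi = Yc ` gens_off_edge n e i k \<sigma> \<union> Tc ` {0..<hi} \<union> Sc ` {lo + 1..k + 1}"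

definition edge_cone :: "(real ^ 'd) set \<Rightarrow> nat \<Rightarrow> nat \<Rightarrow> ((real ^ 'd) \<times> (nat \<Rightarrow>\<^sub>0 real)) set" where
  "edge_cone \<sigma> lo hi = convex_cone hull (edge_gens e i k ` cone_coords \<sigma> lo hi)"

lemma edge_cones_iff:
  "\<kappa> \<in> edge_cones n e \<Sigma> i k \<longleftrightarrow>
    (\<exists>\<sigma>\<in>\<Sigma>. gens_on_edge e i k \<sigma> = {} \<and> \<kappa> = \<sigma> \<times> {0}) \<or>
    (\<exists>\<sigma>\<in>\<Sigma>. \<exists>lo hi. lo \<le> hi \<and> hi \<le> lo + 1 \<and> gens_on_edge e i k \<sigma> = {lo..hi} \<and> \<kappa> = edge_cone \<sigma> lo hi)"
  (is "_ \<longleftrightarrow> ?E \<or> ?C")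
proof
  assume "\<kappa> \<in> edge_cones n e \<Sigma> i k"
  then consider (empty) \<sigma> where "\<sigma> \<in> \<Sigma>" "gens_on_edge e i k \<sigma> = {}" "\<kappa> = \<sigma> \<times> {0}"
    | (one) \<sigma> j where "\<sigma> \<in> \<Sigma>" "gens_on_edge e i k \<sigma> = {j}" "\<kappa> = edge_cone \<sigma> j j"
    | (two) \<sigma> j where "\<sigma> \<in> \<Sigma>" "gens_on_edge e i k \<sigma> = {j, j + 1}" "\<kappa> = edge_cone \<sigma> j (j + 1)"
  proof -
    have "{0..<j + 1} = {0..j}" for j :: nat by auto
    then show thesis
      using \<open>\<kappa> \<in> edge_cones n e \<Sigma> i k\<close> that
      unfolding edge_cones_def edge_cone_def cone_coords_def by auto
  qed
  then show "?E \<or> ?C"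
  proof cases
    case (one \<sigma> j)
    then show ?thesis by (intro disjI2 bexI[of _ \<sigma>] exI[of _ j]) auto
  next
    case (two \<sigma> j)
    moreover have "{j, j + 1} = {j..j + 1}" by auto
    ultimately show ?thesis by (intro disjI2 bexI[of _ \<sigma>] exI[of _ j] exI[of _ "j + 1"]) auto
  qed blast
next
  assume "?E \<or> ?C"
  then show "\<kappa> \<in> edge_cones n e \<Sigma> i k"
  proof
    assume ?E
    then show ?thesis unfolding edge_cones_def by blast
  next
    assume ?C
    then obtain \<sigma> lo hi where *: "\<sigma> \<in> \<Sigma>" "lo \<le> hi" "hi \<le> lo + 1" "gens_on_edge e i k \<sigma> = {lo..hi}"
      "\<kappa> = edge_cone \<sigma> lo hi" by blast
    then consider "hi = lo" | "hi = lo + 1" by linarith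
    then show ?thesis
    proof cases
      case 1
      then have "gens_on_edge e i k \<sigma> = {lo}" using * by simp
      then show ?thesis
        unfolding edge_cones_def *(5) 1 edge_cone_def cone_coords_def
        by (intro UnI1[OF UnI2] CollectI exI[of _ \<sigma>] exI[of _ lo] conjI refl *(1))
    next
      case 2
      then have "{lo..hi} = {lo, lo + 1}" by auto
      with *(4) have "gens_on_edge e i k \<sigma> = {lo, lo + 1}" by (rule trans)
      moreover have "{0..<lo + 1} = {0..lo}" by auto
      then have "\<kappa> = convex_cone hull (edge_gens e i k `
          (Yc ` gens_off_edge n e i k \<sigma> \<union> Tc ` {0..lo} \<union> Sc ` {lo + 1..k + 1}))"
        unfolding *(5) 2 edge_cone_def cone_coords_def by (rule arg_cong)
      ultimately show ?thesis
        unfolding edge_cones_def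
        by (intro UnI2 CollectI exI[of _ \<sigma>] exI[of _ lo] conjI *(1))
    qed
  qed
qed

lemma convex_cone_times_zero: "convex_cone \<sigma> \<Longrightarrow> convex_cone (\<sigma> \<times> {0 :: nat \<Rightarrow>\<^sub>0 real})"
  by (simp add: convex_cone_Times)

text \<open>The condition only weakens when the cone grows, and every cone of the fan lies in a
  listed cone, which is a nonempty face of itself.\<close>

lemma semistable_T'_iff:
  "z \<in> semistable T' \<longleftrightarrow> z \<in> affine_space T' \<and>
    (\<exists>\<kappa>\<in>edge_cones n e \<Sigma> i k. \<forall>c\<in>V. z c = 0 \<longrightarrow> edge_gens e i k c \<in> \<kappa>)"
proof -
  have "\<kappa> \<in> edge_fan n e \<Sigma> i k" if "\<kappa> \<in> edge_cones n e \<Sigma> i k" for \<kappa>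
  proof -
    have "convex_cone \<kappa>"
      using that cone_convex convex_cone_times_zero
      by (auto simp: edge_cones_iff edge_cone_def convex_cone_convex_cone_hull)
    then have "\<kappa> \<noteq> {}" "\<kappa> face_of \<kappa>" by (auto simp: convex_cone_def face_of_refl)
    then show ?thesis using that by (auto simp: edge_fan_def)
  qed
  moreover have "\<exists>\<kappa>\<in>edge_cones n e \<Sigma> i k. \<tau> \<subseteq> \<kappa>" if "\<tau> \<in> edge_fan n e \<Sigma> i k" for \<tau>
    using that by (auto simp: edge_fan_def dest: face_of_imp_subset)
  ultimately show ?thesis
    unfolding semistable_iff edge_toric_simps by (meson subsetD)
qed

text \<open>In the convex cone \<open>?K\<close>, the number \<open>\<rho> l\<close> is the total weight of the generators of
  \<open>s\<^sub>l\<close> and \<open>t\<^bsub>l-1\<^esub>\<close>, and \<open>\<beta>\<close> is the weight of the generator of \<open>t\<^bsub>lo\<^esub>\<close>. On the slice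
  \<open>N \<times> {0}\<close> the weight \<open>\<rho> l\<close> does not depend on \<open>l\<close>.\<close>

lemma edge_cone_slice:
  assumes \<sigma>: "\<sigma> \<in> \<Sigma>" and G: "gens_on_edge e i k \<sigma> = {lo..hi}" and le: "lo \<le> hi" "hi \<le> lo + 1"
    and mem: "(v, 0) \<in> edge_cone \<sigma> lo hi"
  shows "v \<in> \<sigma>"
proof -
  note cc = cone_convex[OF \<sigma>]
  have lo_mem: "lo \<in> gens_on_edge e i k \<sigma>" and hi_mem: "hi \<in> gens_on_edge e i k \<sigma>"
    using G le by auto
  then have hi: "lo \<le> k + 1" "hi \<le> k + 1" and e\<sigma>: "e (i lo) \<in> \<sigma>" "e (i hi) \<in> \<sigma>"
    by (auto simp: gens_on_edge_def)
  \<comment> \<open>\<open>y\<close> absorbs the off-edge generators and ranges over all of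
    \<open>\<sigma>\<close>, so that closure under sums and scaling is immediate. The bound
    \<open>\<beta> \<le> \<rho> (lo + 1)\<close> holds because t_lo shares the weight
    \<open>\<rho> (lo + 1)\<close> with s_{lo+1}.\<close>
  define P where "P \<rho> \<beta> y v c \<longleftrightarrow> (\<forall>l. 0 \<le> \<rho> l) \<and> 0 \<le> \<beta> \<and> \<beta> \<le> \<rho> (lo + 1) \<and> (hi = lo \<longrightarrow> \<beta> = 0) \<and>
      y \<in> \<sigma> \<and> v = y + ((\<Sum>l=1..lo. \<rho> l) + \<beta>) *\<^sub>R w + \<rho> (k + 1) *\<^sub>R e (i 0) \<and>
      (\<forall>m\<in>{1..k}. Poly_Mapping.lookup c m = \<rho> m - \<rho> (k + 1))"
    for \<rho> :: "nat \<Rightarrow> real" and \<beta> y v and c :: "nat \<Rightarrow>\<^sub>0 real"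
  let ?K = "{(v, c). \<exists>\<rho> \<beta> y. P \<rho> \<beta> y v c}"
  have "convex_cone ?K"
    unfolding convex_cone_iff
  proof (intro conjI ballI allI impI)
    have "P (\<lambda>_. 0) 0 0 0 0" using convex_cone_contains_0[OF cc] by (simp add: P_def)
    then show "0 \<in> ?K" unfolding zero_prod_def by blast
  next
    fix a b assume "a \<in> ?K" "b \<in> ?K"
    then obtain v c \<rho> \<beta> y v' c' \<rho>' \<beta>' y' where ab: "a = (v, c)" "b = (v', c')"
      and P: "P \<rho> \<beta> y v c" "P \<rho>' \<beta>' y' v' c'" by auto
    have "P (\<lambda>l. \<rho> l + \<rho>' l) (\<beta> + \<beta>') (y + y') (v + v') (c + c')"
      using P convex_cone_add[OF cc, of y y']
      by (auto simp: P_def lookup_add sum.distrib algebra_simps add_mono)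
    then show "a + b \<in> ?K" using ab by auto
  next
    fix a :: "(real ^ 'd) \<times> (nat \<Rightarrow>\<^sub>0 real)" and r :: real
    assume "a \<in> ?K" and r: "0 \<le> r"
    then obtain v c \<rho> \<beta> y where a: "a = (v, c)" and P: "P \<rho> \<beta> y v c" by auto
    have "P (\<lambda>l. r * \<rho> l) (r * \<beta>) (r *\<^sub>R y) (r *\<^sub>R v) (r *\<^sub>R c)"
      using P convex_cone_scaleR[OF cc r, of y] r
      by (auto simp: P_def lookup_scaleR mult_left_mono scaleR_add_right right_diff_distrib
          distrib_left simp flip: sum_distrib_left)
    then show "r *\<^sub>R a \<in> ?K" using a by auto
  qed
  moreover have "edge_gens e i k ` cone_coords \<sigma> lo hi \<subseteq> ?K"
  proof
    fix g assume "g \<in> edge_gens e i k ` cone_coords \<sigma> lo hi"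
    then obtain c where c: "c \<in> cone_coords \<sigma> lo hi" and g: "g = edge_gens e i k c" by auto
    have lookup_b: "Poly_Mapping.lookup (bvec j) l = (if l = j then 1 else 0)" for j l
      by (simp add: lookup_single when_def)
    have lookup_s: "Poly_Mapping.lookup (\<Sum>l\<in>{1..k}. bvec l) j = 1" if "j \<in> {1..k}" for j
      using that by (simp add: lookup_sum lookup_b)
    define \<iota> where "\<iota> j l = (if l = j then 1 else 0 :: real)" for j l :: nat
    have sum_\<iota>: "(\<Sum>l=1..lo. \<iota> j l) = (if j \<in> {1..lo} then 1 else 0)" for j
      by (simp add: \<iota>_def)
    have "\<exists>\<rho> \<beta> y. P \<rho> \<beta> y (fst g) (snd g)"
    proof (cases c)
      case (Yc l)
      then have "e l \<in> \<sigma>" using c by (auto simp: cone_coords_def gens_off_edge_def)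
      then have "P (\<lambda>_. 0) 0 (e l) (fst g) (snd g)" by (simp add: P_def g Yc)
      then show ?thesis by blast
    next
      case (Sc j)
      then have j: "lo < j" "j \<le> k + 1" using c by (auto simp: cone_coords_def)
      have "P (\<iota> j) 0 0 (fst g) (snd g)"
        using j convex_cone_contains_0[OF cc] sum_\<iota>[of j] lookup_s
        by (auto simp: P_def g Sc \<iota>_def lookup_b)
      then show ?thesis by blast
    next
      case (Tc j)
      then have j: "j < hi" using c by (auto simp: cone_coords_def)
      then have jk: "j \<le> k" "j \<le> lo" using hi le by auto
      show ?thesis
      proof (cases "j = lo")
        case True
        have "P (\<iota> (j + 1)) 1 0 (fst g) (snd g)"
          using j jk True convex_cone_contains_0[OF cc] sum_\<iota>[of "j + 1"] lookup_s
          by (auto simp: P_def g Tc \<iota>_def lookup_b w_def)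
        then show ?thesis by blast
      next
        case False
        have "P (\<iota> (j + 1)) 0 0 (fst g) (snd g)"
          using j jk False convex_cone_contains_0[OF cc] sum_\<iota>[of "j + 1"] lookup_s
          by (auto simp: P_def g Tc \<iota>_def lookup_b w_def)
        then show ?thesis by blast
      qed
    qed
    then show "g \<in> ?K" by (cases g) auto
  qed
  ultimately have "edge_cone \<sigma> lo hi \<subseteq> ?K"
    unfolding edge_cone_def by (rule hull_minimal[rotated])
  with mem obtain \<rho> \<beta> y where P: "P \<rho> \<beta> y v 0" by blast
  define r where "r = \<rho> (k + 1)"
  have \<rho>: "\<rho> l = r" if "l \<in> {1..k + 1}" for l
    using P that by (cases "l = k + 1") (auto simp: P_def r_def)
  have r0: "0 \<le> r" and \<beta>0: "0 \<le> \<beta>" and y: "y \<in> \<sigma>"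
    and v: "v = y + ((\<Sum>l=1..lo. \<rho> l) + \<beta>) *\<^sub>R w + r *\<^sub>R e (i 0)"
    using P by (auto simp: P_def r_def)
  have "(\<Sum>l=1..lo. \<rho> l) = (\<Sum>l=1..lo. r)" by (intro sum.cong refl \<rho>) (use hi in auto)
  then have v': "v = y + r *\<^sub>R e (i lo) + \<beta> *\<^sub>R w"
    unfolding v edge_point[OF hi(1)] by (simp add: algebra_simps)
  show ?thesis
  proof (cases "hi = lo")
    case True
    then have "\<beta> = 0" using P by (simp add: P_def)
    then show ?thesis
      using v' y e\<sigma>(1) r0 convex_cone_add[OF cc] convex_cone_scaleR[OF cc] by simp
  next
    \<comment> \<open>The bound on \<open>\<beta>\<close> makes \<open>r - \<beta>\<close>
      nonnegative, so \<open>v\<close> is \<open>y\<close> plus a nonnegative combination of the two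
      edge points in \<open>\<sigma>\<close>.\<close>
    case False
    then have hi_eq: "hi = lo + 1" using le by simp
    have "\<beta> \<le> \<rho> (lo + 1)" using P by (simp add: P_def)
    also have "\<rho> (lo + 1) = r" by (rule \<rho>) (use hi hi_eq in auto)
    finally have "0 \<le> r - \<beta>" by simp
    moreover have "e (i hi) = e (i lo) + w"
      using edge_point[OF hi(1)] edge_point[OF hi(2)] unfolding hi_eq by (simp add: algebra_simps)
    then have "v = y + ((r - \<beta>) *\<^sub>R e (i lo) + \<beta> *\<^sub>R e (i hi))"
      by (simp add: v' algebra_simps)
    ultimately show ?thesis
      using y e\<sigma> \<beta>0 convex_cone_add[OF cc] convex_cone_scaleR[OF cc] by simp
  qed
qed

lemma edge_point_in_slice:
  assumes K: "convex_cone K" and A: "A \<subseteq> {1..k + 1}"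
    and Tc: "\<And>l. l \<in> A \<Longrightarrow> edge_gens e i k (Tc (l - 1)) \<in> K"
    and Sc: "\<And>l. l \<in> {1..k + 1} - A \<Longrightarrow> edge_gens e i k (Sc l) \<in> K"
  shows "(e (i (card A)), 0) \<in> K"
  unfolding sum_mixed_gens[OF A, symmetric]
  by (rule convex_cone_sum[OF K]) (use Tc Sc in \<open>auto simp del: edge_gens.simps\<close>)

text \<open>A missing generator of \<open>s\<^sub>m\<close> or \<open>t\<^sub>m\<close> in the cone would complete a sum that
  represents the lattice point of the edge just before \<open>lo\<close> or just after \<open>hi\<close>.\<close>

lemma edge_cone_coords:
  assumes \<sigma>: "\<sigma> \<in> \<Sigma>" and G: "gens_on_edge e i k \<sigma> = {lo..hi}" and le: "lo \<le> hi" "hi \<le> lo + 1"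
    and c: "c \<in> V" and mem: "edge_gens e i k c \<in> edge_cone \<sigma> lo hi"
  shows "c \<in> cone_coords \<sigma> lo hi"
proof -
  have "hi \<in> gens_on_edge e i k \<sigma>" using G le by auto
  then have hi: "hi \<le> k + 1" by (simp add: gens_on_edge_def)
  note cc = convex_cone_convex_cone_hull[of "edge_gens e i k ` cone_coords \<sigma> lo hi", folded edge_cone_def]
  have gen: "edge_gens e i k d \<in> edge_cone \<sigma> lo hi" if "d \<in> cone_coords \<sigma> lo hi" for d
    unfolding edge_cone_def using that by (intro hull_inc imageI)
  have slice: "j \<in> {lo..hi}" if "(e (i j), 0) \<in> edge_cone \<sigma> lo hi" "j \<le> k + 1" for j
    using edge_cone_slice[OF \<sigma> G le that(1)] that(2) unfolding G[symmetric] by (simp add: gens_on_edge_def)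
  show ?thesis
  proof (cases c)
    case (Yc l)
    then have "(e l, 0) \<in> edge_cone \<sigma> lo hi" using mem by simp
    then have "e l \<in> \<sigma>" using edge_cone_slice[OF \<sigma> G le] by blast
    then show ?thesis using c Yc by (auto simp: cone_coords_def gens_off_edge_def idx_T')
  next
    case (Sc m)
    then have m: "m \<in> {1..k + 1}" using c by (auto simp: idx_T')
    show ?thesis
    proof (rule ccontr)
      assume "c \<notin> cone_coords \<sigma> lo hi"
      then have "m \<le> lo" using m Sc by (auto simp: cone_coords_def)
      \<comment> \<open>Position \<open>m\<close> uses s_m in place of t_{m-1}, one t fewer than for
        \<open>{1..lo}\<close>; hence the index \<open>lo - 1\<close>.\<close>
      let ?A = "{1..lo} - {m}"
      have "(e (i (card ?A)), 0) \<in> edge_cone \<sigma> lo hi"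
      proof (rule edge_point_in_slice[OF cc])
        show "?A \<subseteq> {1..k + 1}" using hi le by auto
        show "edge_gens e i k (Tc (l - 1)) \<in> edge_cone \<sigma> lo hi" if "l \<in> ?A" for l
          by (rule gen) (use that le in \<open>auto simp: cone_coords_def\<close>)
        show "edge_gens e i k (Sc l) \<in> edge_cone \<sigma> lo hi" if "l \<in> {1..k + 1} - ?A" for l
        proof (cases "l = m")
          case True
          then show ?thesis using mem Sc by simp
        next
          case False
          then show ?thesis by (intro gen) (use that in \<open>auto simp: cone_coords_def\<close>)
        qed
      qed
      moreover have "card ?A = lo - 1" using m \<open>m \<le> lo\<close> by simp
      ultimately have "lo - 1 \<in> {lo..hi}" using slice[of "lo - 1"] hi le by simp
      then show False using m \<open>m \<le> lo\<close> unfolding atLeastAtMost_iff by linarith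
    qed
  next
    case (Tc m)
    then have m: "m \<le> k" using c by (auto simp: idx_T')
    show ?thesis
    proof (rule ccontr)
      assume "c \<notin> cone_coords \<sigma> lo hi"
      then have "hi \<le> m" using m Tc by (auto simp: cone_coords_def)
      let ?A = "insert (m + 1) {1..hi}"
      have "(e (i (card ?A)), 0) \<in> edge_cone \<sigma> lo hi"
      proof (rule edge_point_in_slice[OF cc])
        show "?A \<subseteq> {1..k + 1}" using m hi by auto
        show "edge_gens e i k (Tc (l - 1)) \<in> edge_cone \<sigma> lo hi" if "l \<in> ?A" for l
        proof (cases "l = m + 1")
          case True
          then show ?thesis using mem Tc by simp
        next
          case False
          then show ?thesis by (intro gen) (use that in \<open>auto simp: cone_coords_def\<close>)
        qed
        show "edge_gens e i k (Sc l) \<in> edge_cone \<sigma> lo hi" if "l \<in> {1..k + 1} - ?A" for l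
          by (rule gen) (use that le in \<open>auto simp: cone_coords_def\<close>)
      qed
      moreover have "card ?A = hi + 1" using \<open>hi \<le> m\<close> by simp
      ultimately have "hi + 1 \<in> {lo..hi}" using slice[of "hi + 1"] \<open>hi \<le> m\<close> m by simp
      then show False by simp
    qed
  qed
qed

text \<open>For \<open>k > 0\<close> the Z^k component excludes every edge coordinate. For
  \<open>k = 0\<close> the two edge generators are the points \<open>e (i 0)\<close> and
  \<open>e (i 1)\<close> themselves, which are not in \<open>\<sigma>\<close>.\<close>

lemma times_zero_coords:
  assumes \<sigma>: "\<sigma> \<in> \<Sigma>" and G: "gens_on_edge e i k \<sigma> = {}"
    and c: "c \<in> V" and mem: "edge_gens e i k c \<in> \<sigma> \<times> {0}"
  shows "c \<in> Yc ` gens_off_edge n e i k \<sigma>"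
proof -
  have no_edge: "e (i j) \<notin> \<sigma>" if "j \<le> k + 1" for j
    using G that by (auto simp: gens_on_edge_def)
  have lookup_b: "Poly_Mapping.lookup (bvec j) l = (if l = j then 1 else 0)" for j l
    by (simp add: lookup_single when_def)
  have b: "bvec j \<noteq> 0" for j using lookup_b[of j j] by (metis lookup_zero zero_neq_one)
  have s: "k = 0" if "(\<Sum>l\<in>{1..k}. bvec l) = 0"
  proof (rule ccontr)
    assume "k \<noteq> 0"
    then have "Poly_Mapping.lookup (\<Sum>l\<in>{1..k}. bvec l) 1 = 1" by (simp add: lookup_sum lookup_b)
    then show False using that by simp
  qed
  show ?thesis
  proof (cases c)
    case (Sc j)
    then have "j \<in> {1..k + 1}" using c by (auto simp: idx_T')
    then show ?thesis using mem Sc no_edge[of 0] b by (auto split: if_splits)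
  next
    case (Tc j)
    then have "j \<le> k" using c by (auto simp: idx_T')
    have "\<not> j < k" using mem Tc b[of "j + 1"] by auto
    then have "- (\<Sum>l\<in>{1..k}. bvec l) = 0" using mem Tc by simp
    then have "k = 0" by (intro s) (simp only: neg_equal_0_iff_equal)
    then have "e (i 1) \<in> \<sigma>" using mem Tc by simp
    then show ?thesis using no_edge[of 1] by simp
  next
    case (Yc l)
    then show ?thesis using mem c by (auto simp: gens_off_edge_def idx_T')
  qed
qed

section \<open>Vanishing coordinates of semistable points\<close>

text \<open>The case \<open>hi < lo\<close> encodes a cone without generators on the edge.\<close>

definition vanishing_pattern :: "(coord \<Rightarrow> complex) \<Rightarrow> (real ^ 'd) set \<Rightarrow> nat \<Rightarrow> nat \<Rightarrow> bool" where
  "vanishing_pattern z \<sigma> lo hi \<longleftrightarrow> \<sigma> \<in> \<Sigma> \<and> lo \<le> k + 1 \<and> hi \<le> lo + 1 \<and> hi \<le> k + 1 \<and>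
    (\<forall>j\<in>{lo..hi}. e (i j) \<in> \<sigma>) \<and>
    (\<forall>l\<in>off_edge. z (Yc l) = 0 \<longrightarrow> e l \<in> \<sigma>) \<and>
    (\<forall>j\<in>{1..k + 1}. z (Sc j) = 0 \<longrightarrow> lo < j) \<and>
    (\<forall>j\<le>k. z (Tc j) = 0 \<longrightarrow> j < hi) \<and>
    (hi < lo \<longrightarrow> (\<forall>j\<in>{1..k + 1}. z (Sc j) \<noteq> 0) \<and> (\<forall>j\<le>k. z (Tc j) \<noteq> 0))"

lemma vanishing_pattern_Sc:
  "vanishing_pattern z \<sigma> lo hi \<Longrightarrow> j \<in> {1..k + 1} \<Longrightarrow> z (Sc j) = 0 \<Longrightarrow> lo < j"
  unfolding vanishing_pattern_def by blast

lemma vanishing_pattern_Tc: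
  "vanishing_pattern z \<sigma> lo hi \<Longrightarrow> j \<le> k \<Longrightarrow> z (Tc j) = 0 \<Longrightarrow> j < hi"
  unfolding vanishing_pattern_def by blast

lemma vanishing_pattern_bounds:
  "vanishing_pattern z \<sigma> lo hi \<Longrightarrow> \<sigma> \<in> \<Sigma> \<and> lo \<le> k + 1 \<and> hi \<le> lo + 1 \<and> hi \<le> k + 1"
  unfolding vanishing_pattern_def by blast

lemma vanishing_pattern:
  assumes "z \<in> semistable T'"
  obtains \<sigma> lo hi where "vanishing_pattern z \<sigma> lo hi"
proof -
  obtain \<kappa> where \<kappa>: "\<kappa> \<in> edge_cones n e \<Sigma> i k" and z: "\<And>c. c \<in> V \<Longrightarrow> z c = 0 \<Longrightarrow> edge_gens e i k c \<in> \<kappa>"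
    using assms unfolding semistable_T'_iff by blast
  from \<kappa> consider
      (empty) \<sigma> where "\<sigma> \<in> \<Sigma>" "gens_on_edge e i k \<sigma> = {}" "\<kappa> = \<sigma> \<times> {0}"
    | (edge) \<sigma> lo hi where "\<sigma> \<in> \<Sigma>" "lo \<le> hi" "hi \<le> lo + 1" "gens_on_edge e i k \<sigma> = {lo..hi}"
        "\<kappa> = edge_cone \<sigma> lo hi"
    unfolding edge_cones_iff by blast
  then show thesis
  proof cases
    case (empty \<sigma>)
    have "c \<in> Yc ` gens_off_edge n e i k \<sigma>" if "c \<in> V" "z c = 0" for c
      using times_zero_coords[OF empty(1,2) that(1)] z[OF that] empty(3) by blast
    note * = this
    have "e l \<in> \<sigma>" if "l \<in> off_edge" "z (Yc l) = 0" for l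
      using *[of "Yc l"] that by (auto simp: idx_T' gens_off_edge_def)
    moreover have "z (Sc j) \<noteq> 0" if "j \<in> {1..k + 1}" for j
      using *[of "Sc j"] that by (auto simp: idx_T')
    moreover have "z (Tc j) \<noteq> 0" if "j \<le> k" for j
      using *[of "Tc j"] that by (auto simp: idx_T')
    \<comment> \<open>The pair 1, 0 makes \<open>{lo..hi}\<close> empty and meets the bounds for
      every \<open>k\<close>.\<close>
    ultimately have "vanishing_pattern z \<sigma> 1 0"
      unfolding vanishing_pattern_def using empty(1) by simp
    then show thesis by (rule that)
  next
    case (edge \<sigma> lo hi)
    have "c \<in> cone_coords \<sigma> lo hi" if "c \<in> V" "z c = 0" for c
      using edge_cone_coords[OF edge(1,4,2,3) that(1)] z[OF that] edge(5) by blast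
    note * = this
    have mem: "j \<le> k + 1 \<and> e (i j) \<in> \<sigma>" if "j \<in> {lo..hi}" for j
      using that unfolding edge(4)[symmetric] by (simp add: gens_on_edge_def)
    have "vanishing_pattern z \<sigma> lo hi"
      unfolding vanishing_pattern_def
    proof (intro conjI ballI allI impI)
      show "lo \<le> k + 1" "hi \<le> k + 1" using mem[of lo] mem[of hi] edge(2) by auto
      show "e (i j) \<in> \<sigma>" if "j \<in> {lo..hi}" for j using mem[OF that] by simp
      show "e l \<in> \<sigma>" if "l \<in> off_edge" "z (Yc l) = 0" for l
        using *[of "Yc l"] that by (auto simp: idx_T' cone_coords_def gens_off_edge_def)
      show "lo < j" if "j \<in> {1..k + 1}" "z (Sc j) = 0" for j
        using *[of "Sc j"] that by (auto simp: idx_T' cone_coords_def)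
      show "j < hi" if "j \<le> k" "z (Tc j) = 0" for j
        using *[of "Tc j"] that by (auto simp: idx_T' cone_coords_def)
    qed (use edge in auto)
    then show thesis by (rule that)
  qed
qed

text \<open>A zero of s_j or t_j at the image comes from a zero x_{i_l} with \<open>l < j\<close>,
  respectively \<open>j < l\<close>. That \<open>l\<close> lies between \<open>lo\<close> and
  \<open>hi\<close>, which places the coordinate in the cone built from the same
  \<open>\<sigma>\<close>.\<close>

lemma push_semistable:
  assumes "x \<in> semistable T"
  shows "push x \<in> semistable T'"
proof -
  obtain \<sigma> where \<sigma>: "\<sigma> \<in> \<Sigma>" and x: "\<And>r. r \<in> {1..n} \<Longrightarrow> x r = 0 \<Longrightarrow> e r \<in> \<sigma>"
    using assms unfolding semistable_iff base_toric_simps idx_T by blast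
  have edge: "\<exists>l\<in>A. l \<in> gens_on_edge e i k \<sigma>" if prod: "(\<Prod>l\<in>A. x (i l)) = 0" and A: "A \<subseteq> {0..k + 1}" for A
  proof -
    obtain l where l: "l \<in> A" "x (i l) = 0" using prod finite_subset[OF A] by auto
    moreover have "l \<le> k + 1" using l(1) A by auto
    ultimately show ?thesis using x[OF edge_range] by (auto simp: gens_on_edge_def)
  qed
  have Y: "l \<in> gens_off_edge n e i k \<sigma>" if "l \<in> off_edge" "push x (Yc l) = 0" for l
    using that x[of l] push_simps(3)[of l x] by (auto simp: gens_off_edge_def)
  have S: "\<exists>l<j. l \<in> gens_on_edge e i k \<sigma>" if j: "j \<in> {1..k + 1}" and 0: "push x (Sc j) = 0" for j
  proof -
    have "(\<Prod>l\<in>{0..<j}. x (i l)) = 0" using 0 push_simps(1)[OF j, of x] by simp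
    moreover have "{0..<j} \<subseteq> {0..k + 1}" using j by auto
    ultimately obtain l where "l \<in> {0..<j}" "l \<in> gens_on_edge e i k \<sigma>" using edge by meson
    then show ?thesis by auto
  qed
  have Tt: "\<exists>l>j. l \<in> gens_on_edge e i k \<sigma>" if j: "j \<le> k" and 0: "push x (Tc j) = 0" for j
  proof -
    have "(\<Prod>l\<in>{j + 1..k + 1}. x (i l)) = 0" using 0 push_simps(2)[OF j, of x] by simp
    moreover have "{j + 1..k + 1} \<subseteq> {0..k + 1}" by auto
    ultimately obtain l where "l \<in> {j + 1..k + 1}" "l \<in> gens_on_edge e i k \<sigma>" using edge by meson
    then show ?thesis by (auto simp: Suc_le_eq)
  qed
  from \<sigma> have "\<exists>\<kappa>\<in>edge_cones n e \<Sigma> i k. \<forall>c\<in>V. push x c = 0 \<longrightarrow> edge_gens e i k c \<in> \<kappa>"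
  proof (cases rule: gens_on_edge_cases)
    case 1
    have "edge_gens e i k c \<in> \<sigma> \<times> {0}" if c: "c \<in> V" "push x c = 0" for c
    proof (cases c)
      case (Yc l)
      then show ?thesis using Y[of l] c by (auto simp: idx_T' gens_off_edge_def)
    next
      case (Sc j)
      then show ?thesis using S[of j] c 1 by (auto simp: idx_T')
    next
      case (Tc j)
      then show ?thesis using Tt[of j] c 1 by (auto simp: idx_T')
    qed
    moreover have "\<sigma> \<times> {0} \<in> edge_cones n e \<Sigma> i k" using \<sigma> 1 by (auto simp: edge_cones_iff)
    ultimately show ?thesis by blast
  next
    case (2 lo hi)
    have "c \<in> cone_coords \<sigma> lo hi" if c: "c \<in> V" "push x c = 0" for c
    proof (cases c)
      case (Yc l)
      then show ?thesis using Y[of l] c by (auto simp: idx_T' cone_coords_def)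
    next
      case (Sc j)
      then show ?thesis using S[of j] c 2 by (auto simp: idx_T' cone_coords_def)
    next
      case (Tc j)
      then show ?thesis using Tt[of j] c 2 by (auto simp: idx_T' cone_coords_def)
    qed
    then have "\<forall>c\<in>V. push x c = 0 \<longrightarrow> edge_gens e i k c \<in> edge_cone \<sigma> lo hi"
      unfolding edge_cone_def by (auto intro!: hull_inc)
    moreover have "edge_cone \<sigma> lo hi \<in> edge_cones n e \<Sigma> i k"
      unfolding edge_cones_iff
      by (intro disjI2 bexI[OF _ \<sigma>] exI[of _ lo] exI[of _ hi]) (use 2 in simp)
    ultimately show ?thesis by blast
  qed
  then show ?thesis using push_affine by (simp add: semistable_T'_iff)
qed

text \<open>The cutoff \<open>p\<close> carries the information about the fan that is needed to
  solve for preimages under \<open>push\<close>, to lift exponents and to prove the binomial rows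
  independent.\<close>

lemma semistable_nonzero:
  assumes z: "z \<in> semistable T'"
  obtains p where "p \<le> k" "\<And>j. j \<in> {1..p} \<Longrightarrow> z (Sc j) \<noteq> 0" "\<And>j. j \<in> {p + 1..k} \<Longrightarrow> z (Tc j) \<noteq> 0"
proof -
  obtain \<sigma> lo hi where vp: "vanishing_pattern z \<sigma> lo hi" using vanishing_pattern[OF z] .
  \<comment> \<open>A zero of s_j needs \<open>lo < j\<close>; a zero of t_j needs
    \<open>j < hi\<close>, hence \<open>j \<le> lo\<close>. The minimum matters only for
    \<open>lo = k + 1\<close>, where the range for t is empty.\<close>
  show thesis
  proof (rule that[of "min lo k"])
    show "z (Sc j) \<noteq> 0" if "j \<in> {1..min lo k}" for j
      using vanishing_pattern_Sc[OF vp, of j] that by auto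
    show "z (Tc j) \<noteq> 0" if "j \<in> {min lo k + 1..k}" for j
      using vanishing_pattern_Tc[OF vp, of j] vanishing_pattern_bounds[OF vp] that by auto
  qed simp
qed

text \<open>A zero x_{i_l} kills s_{l+1} and t_{l-1}, as far as these exist. The pattern of
  \<open>z\<close> then gives \<open>lo \<le> l \<le> hi\<close>, so the cone that serves
  \<open>z\<close> serves the preimage as well.\<close>

lemma push_semistable_surj:
  assumes z: "z \<in> semistable T'"
    and eq: "\<And>j. j \<in> {1..k} \<Longrightarrow> z (Sc (j + 1)) * z (Tc j) = z (Sc j) * z (Tc (j - 1))"
  obtains x where "x \<in> semistable T" "push x = z"
proof -
  obtain p where p: "p \<le> k" "\<And>j. j \<in> {1..p} \<Longrightarrow> z (Sc j) \<noteq> 0" "\<And>j. j \<in> {p + 1..k} \<Longrightarrow> z (Tc j) \<noteq> 0"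
    using semistable_nonzero[OF z] by blast
  have aff: "z \<in> affine_space T'" using z by (simp add: semistable_iff)
  obtain x where x: "x \<in> affine_space T" "push x = z"
    using push_surj[OF p(1) aff eq p(2,3)] by blast
  obtain \<sigma> lo hi where vp: "vanishing_pattern z \<sigma> lo hi" using vanishing_pattern[OF z] .
  have S: "z (Sc j) = 0" if "x (i l) = 0" "l < j" "j \<le> k + 1" for l j
    using push_simps(1)[of j x] x(2) that by auto
  have Tt: "z (Tc j) = 0" if "x (i l) = 0" "j < l" "l \<le> k + 1" for l j
  proof -
    have "(\<Prod>l\<in>{j + 1..k + 1}. x (i l)) = 0" by (rule prod_zero) (use that in auto)
    then show ?thesis using push_simps(2)[of j x] x(2) that by simp
  qed
  have "e r \<in> \<sigma>" if "r \<in> {1..n}" "x r = 0" for r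
    using that(1)
  proof (cases rule: idx_T_cases)
    case (1 l)
    have xl: "x (i l) = 0" using 1 that by simp
    have "l \<in> {lo..hi}"
    proof -
      have "lo \<le> l"
      proof (cases "l = k + 1")
        case False
        then have "z (Sc (l + 1)) = 0" using S[OF xl] 1 by simp
        then show ?thesis using vanishing_pattern_Sc[OF vp, of "l + 1"] 1 False by simp
      qed (use vp in \<open>simp add: vanishing_pattern_def\<close>)
      moreover have "l \<le> hi"
      proof (cases "l = 0")
        case False
        then have "z (Tc (l - 1)) = 0" using Tt[OF xl] 1 by simp
        then show ?thesis using vanishing_pattern_Tc[OF vp, of "l - 1"] 1 False by (cases l) auto
      qed simp
      ultimately show ?thesis by simp
    qed
    then show ?thesis using vp 1 by (simp add: vanishing_pattern_def)
  next
    case 2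
    then show ?thesis using vp that push_simps(3)[OF 2, of x] x(2) by (auto simp: vanishing_pattern_def)
  qed
  then have "x \<in> semistable T"
    using x(1) vp unfolding semistable_iff base_toric_simps idx_T vanishing_pattern_def by blast
  then show thesis using that x(2) by blast
qed

text \<open>The variable at position \<open>l\<close> divides s_p if \<open>l < p\<close> and
  t_{p+1} if \<open>l > p + 1\<close>, and these are nonzero; only positions \<open>p\<close> and
  \<open>p + 1\<close> can carry zeros.\<close>

lemma exponent_lift:
  assumes "x \<in> semistable T" "finite A"
  shows "\<exists>\<eta> L. (\<Prod>r\<in>idx T. x r ^ \<eta> r) \<noteq> 0 \<and>
    (\<forall>\<alpha>\<in>A. \<forall>r\<in>idx T. pull V incidence (L \<alpha>) r = \<alpha> r + (\<eta> r :: nat))"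
proof -
  obtain p where p: "p \<le> k" "\<And>j. j \<in> {1..p} \<Longrightarrow> push x (Sc j) \<noteq> 0"
    "\<And>j. j \<in> {p + 1..k} \<Longrightarrow> push x (Tc j) \<noteq> 0"
    using semistable_nonzero[OF push_semistable[OF assms(1)]] by blast
  show ?thesis
  proof (rule exponent_lift_at[OF p(1) _ assms(2)])
    fix l assume l: "l \<le> k + 1" "l \<noteq> p" "l \<noteq> p + 1"
    show "x (i l) \<noteq> 0"
    proof (cases "l < p")
      case True
      then show ?thesis using p(2)[of p] push_simps(1)[of p x] p(1) by auto
    next
      case False
      then have "p + 1 < l" using l by simp
      then have "push x (Tc (p + 1)) \<noteq> 0" "p + 1 \<le> k" using p(3)[of "p + 1"] l by auto
      moreover have "(\<Prod>l\<in>{p + 1 + 1..k + 1}. x (i l)) = 0" if "x (i l) = 0"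
        by (rule prod_zero) (use that \<open>p + 1 < l\<close> l(1) in auto)
      ultimately show ?thesis using push_simps(2)[of "p + 1" x] by auto
    qed
  qed
qed

lemma inj_push: "inj_on push (semistable T)"
proof (rule inj_onI)
  fix x y assume x: "x \<in> semistable T" and y: "y \<in> semistable T" and eq: "push x = push y"
  obtain p where p: "p \<le> k" "\<And>j. j \<in> {1..p} \<Longrightarrow> push x (Sc j) \<noteq> 0"
    "\<And>j. j \<in> {p + 1..k} \<Longrightarrow> push x (Tc j) \<noteq> 0"
    using semistable_nonzero[OF push_semistable[OF x]] by blast
  show "x = y" by (rule push_eqD[OF p(1) _ _ eq p(2,3)]) (use x y in \<open>simp_all add: semistable_iff\<close>)
qed

sublocale toric_embedding T T' incidence
  by unfold_locales (rule push_semistable inj_push torus_lift exponent_lift; assumption?)+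

end

section \<open>Quasismoothness\<close>

lemma finite_bounded_std_lattice:
  fixes P :: "(real ^ 'd) set"
  assumes "bounded P"
  shows "finite (P \<inter> std_lattice)"
proof -
  obtain B where B: "\<And>v. v \<in> P \<Longrightarrow> norm v \<le> B"
    using assms unfolding bounded_iff by auto
  define Z where "Z = {r :: real. r \<in> \<int> \<and> \<bar>r\<bar> \<le> B}"
  have "finite Z" unfolding Z_def by (rule finite_abs_int_segment)
  have "P \<inter> std_lattice \<subseteq> vec_lambda ` (UNIV \<rightarrow>\<^sub>E Z)"
  proof
    fix v assume v: "v \<in> P \<inter> std_lattice"
    have "vec_nth v j \<in> Z" for j
      using B[of v] component_le_norm_cart[of v j] v by (simp add: Z_def std_lattice_def)
    then have "vec_nth v \<in> UNIV \<rightarrow>\<^sub>E Z" by (simp add: PiE_iff)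
    then show "v \<in> vec_lambda ` (UNIV \<rightarrow>\<^sub>E Z)" by (rule rev_image_eqI) (simp add: vec_nth_inverse)
  qed
  then show ?thesis
    by (rule finite_subset) (intro finite_imageI finite_PiE; simp add: \<open>finite Z\<close>)
qed

lemma inner_std_lattice:
  assumes "m \<in> std_lattice" "v \<in> std_lattice"
  shows "inner m v \<in> \<int>"
  using assms by (auto simp: inner_vec_def std_lattice_def intro!: Ints_sum Ints_mult)

lemma expo_of_nat_combination:
  assumes "x \<in> \<int>" "0 \<le> x" "y \<in> \<int>" "0 \<le> y"
  shows "expo (x + real l * y) = expo x + expo y * l"
proof -
  have "\<exists>N::nat. x = real N" if "x \<in> \<int>" "0 \<le> x" for x :: real
  proof -
    obtain z where "x = real_of_int z" using \<open>x \<in> \<int>\<close> by (rule Ints_cases)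
    then show ?thesis using that(2) by (intro exI[of _ "nat z"]) simp
  qed
  then obtain a b where ab: "x = real a" "y = real b" using assms by blast
  have "x + real l * y = real (a + b * l)" by (simp add: ab)
  then show ?thesis by (simp only: ab floor_of_nat nat_int)
qed

context edge_configuration
begin

section \<open>Exponents of the lifted polynomial\<close>

lemma prod_V:
  "(\<Prod>c\<in>V. f c) = (\<Prod>j=1..k + 1. f (Sc j)) * (\<Prod>j=0..k. f (Tc j)) * (\<Prod>l\<in>off_edge. f (Yc l))"
proof -
  have "(\<Prod>c\<in>V. f c) = prod f (Sc ` {1..k + 1}) * prod f (Tc ` {0..k}) * prod f (Yc ` off_edge)"
    unfolding idx_T'
    by (subst prod.union_disjoint, simp_all, blast, subst prod.union_disjoint) auto
  then show ?thesis
    by (simp add: prod.reindex inj_on_def del: prod.cl_ivl_Suc)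
qed

fun lifted_exponent :: "real ^ 'd \<Rightarrow> coord \<Rightarrow> nat" where
  "lifted_exponent m (Yc l) = expo (1 + inner m (e l))"
| "lifted_exponent m c =
    (if inner m (e (i 1) - e (i 0)) \<ge> 0
     then expo (1 + inner m (e (i 0))) * binomial_exponent 0 c +
       (case c of Tc j \<Rightarrow> expo (inner m (e (i 1) - e (i 0))) | _ \<Rightarrow> 0)
     else expo (1 + inner m (e (i (k + 1)))) * binomial_exponent 0 c +
       (case c of Sc j \<Rightarrow> expo (inner m (e (i 0) - e (i 1))) | _ \<Rightarrow> 0))"

lemma lifted_monomial:
  "X_monomial e i k m z * (\<Prod>l\<in>off_edge. z (Yc l) ^ expo (1 + inner m (e l))) =
    (\<Prod>c\<in>V. z c ^ lifted_exponent m c)"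
proof -
  have S: "(\<Prod>j=1..k + 1. z (Sc j) ^ (N * binomial_exponent 0 (Sc j))) = z (Sc 1) ^ N" for N
  proof -
    have "(\<Prod>j=1..k + 1. z (Sc j) ^ (N * binomial_exponent 0 (Sc j))) =
        (\<Prod>j=1..k + 1. if j = 1 then z (Sc j) ^ N else 1)"
      by (intro prod.cong refl) (simp add: binomial_exponent_def)
    also have "\<dots> = z (Sc 1) ^ N" by (subst prod.delta) auto
    finally show ?thesis .
  qed
  have Tt: "(\<Prod>j=0..k. z (Tc j) ^ (N * binomial_exponent 0 (Tc j))) = z (Tc 0) ^ N" for N
  proof -
    have "(\<Prod>j=0..k. z (Tc j) ^ (N * binomial_exponent 0 (Tc j))) =
        (\<Prod>j=0..k. if j = 0 then z (Tc j) ^ N else 1)"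
      by (intro prod.cong refl) (simp add: binomial_exponent_def)
    also have "\<dots> = z (Tc 0) ^ N" by (subst prod.delta) auto
    finally show ?thesis .
  qed
  show ?thesis
    unfolding prod_V X_monomial_def
    by (cases "inner m (e (i 1) - e (i 0)) \<ge> 0";
      simp only: lifted_exponent.simps if_True if_False coord.case power_add prod.distrib S Tt
        power_mult_distrib prod_power_distrib add_0_right;
      simp only: mult_ac)
qed

lemma lifted_poly_eq:
  "lifted_poly n e i k a z = (\<Sum>m\<in>Delta n e \<inter> std_lattice. a m * (\<Prod>c\<in>V. z c ^ lifted_exponent m c))"
  unfolding lifted_poly_def lifted_monomial[symmetric] by (simp only: mult.assoc)

text \<open>Along the edge the exponent 1 + <m, e_{i_l}> is its value at the lower end plus a
  nonnegative slope times the distance from that end. The power of s_1 t_0 supplies the constant;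
  the t's count the distance \<open>l\<close> from the start, the s's the distance
  \<open>k + 1 - l\<close> from the end.\<close>

lemma pull_lifted_exponent:
  assumes m: "m \<in> Delta n e \<inter> std_lattice" and r: "r \<in> {1..n}"
  shows "pull V incidence (lifted_exponent m) r = expo (1 + inner m (e r))"
  using r
proof (cases rule: idx_T_cases)
  case (1 l)
  have int: "inner m (e (i l)) \<in> \<int>" "- 1 \<le> inner m (e (i l))" if "l \<le> k + 1" for l
    using m edge_range[OF that] generator_lattice inner_std_lattice by (auto simp: Delta_def)
  have w: "e (i 1) - e (i 0) = w" using edge_point[of 1] by simp
  have w': "e (i 0) - e (i 1) = - w" using w by (metis minus_diff_eq)
  have "inner m w = inner m (e (i 1)) - inner m (e (i 0))" by (simp add: inner_diff_right flip: w)
  then have wint: "inner m w \<in> \<int>" using int(1)[of 1] int(1)[of 0] by simp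
  have delta: "(\<Sum>j=1..k + 1. N * (if j = 1 then 1 else 0)) = (N :: nat)" for N
    by (simp add: if_distrib sum.delta cong: if_cong del: sum.cl_ivl_Suc)
  have bin: "binomial_exponent 0 (if j \<le> l then Tc (j - 1) else Sc j) = (if j = 1 then 1 else 0)"
    if "j \<in> {1..k + 1}" for j
    using that by (auto simp: binomial_exponent_def)
  show ?thesis
  proof (cases "inner m w \<ge> 0")
    case True
    have L: "lifted_exponent m (Sc j) = expo (1 + inner m (e (i 0))) * binomial_exponent 0 (Sc j)"
      "lifted_exponent m (Tc j) = expo (1 + inner m (e (i 0))) * binomial_exponent 0 (Tc j) + expo (inner m w)" for j
      using True by (simp_all only: lifted_exponent.simps coord.case w if_True add_0_right)
    have "pull V incidence (lifted_exponent m) (i l) =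
        (\<Sum>j=1..k + 1. expo (1 + inner m (e (i 0))) * (if j = 1 then 1 else 0) +
          (if j \<le> l then expo (inner m w) else 0))"
      unfolding pull_edge[OF 1(1)]
    proof (intro sum.cong refl)
      fix j assume "j \<in> {1..k + 1}"
      from bin[OF this] show "lifted_exponent m (if j \<le> l then Tc (j - 1) else Sc j) =
          expo (1 + inner m (e (i 0))) * (if j = 1 then 1 else 0) + (if j \<le> l then expo (inner m w) else 0)"
        by (cases "j \<le> l") (simp_all only: L if_True if_False add_0_right)
    qed
    also have "\<dots> = expo (1 + inner m (e (i 0))) + (\<Sum>j\<in>{1..l}. expo (inner m w))"
    proof -
      have "(\<Sum>j=1..k + 1. if j \<le> l then expo (inner m w) else 0) = (\<Sum>j\<in>{1..l}. expo (inner m w))"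
        by (intro sum.mono_neutral_cong_right) (use 1 in auto)
      then show ?thesis by (simp only: sum.distrib delta)
    qed
    also have "\<dots> = expo (1 + inner m (e (i 0)) + real l * inner m w)"
      using int[of 0] wint True by (subst expo_of_nat_combination) auto
    also have "1 + inner m (e (i 0)) + real l * inner m w = 1 + inner m (e (i l))"
      unfolding edge_point[OF 1(1)] by (simp add: inner_add_right)
    finally show ?thesis using 1 by simp
  next
    case False
    have L: "lifted_exponent m (Sc j) = expo (1 + inner m (e (i (k + 1)))) * binomial_exponent 0 (Sc j) + expo (- inner m w)"
      "lifted_exponent m (Tc j) = expo (1 + inner m (e (i (k + 1)))) * binomial_exponent 0 (Tc j)" for j
      using False by (simp_all only: lifted_exponent.simps coord.case w w' inner_minus_right if_False add_0_right)
    have "pull V incidence (lifted_exponent m) (i l) =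
        (\<Sum>j=1..k + 1. expo (1 + inner m (e (i (k + 1)))) * (if j = 1 then 1 else 0) +
          (if j \<le> l then 0 else expo (- inner m w)))"
      unfolding pull_edge[OF 1(1)]
    proof (intro sum.cong refl)
      fix j assume "j \<in> {1..k + 1}"
      from bin[OF this] show "lifted_exponent m (if j \<le> l then Tc (j - 1) else Sc j) =
          expo (1 + inner m (e (i (k + 1)))) * (if j = 1 then 1 else 0) + (if j \<le> l then 0 else expo (- inner m w))"
        by (cases "j \<le> l") (simp_all only: L if_True if_False add_0_right)
    qed
    also have "\<dots> = expo (1 + inner m (e (i (k + 1)))) + (\<Sum>j\<in>{l + 1..k + 1}. expo (- inner m w))"
    proof -
      have "(\<Sum>j=1..k + 1. if j \<le> l then 0 else expo (- inner m w)) = (\<Sum>j\<in>{l + 1..k + 1}. expo (- inner m w))"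
        by (intro sum.mono_neutral_cong_right) auto
      then show ?thesis by (simp only: sum.distrib delta)
    qed
    also have "\<dots> = expo (1 + inner m (e (i (k + 1))) + real (k + 1 - l) * - inner m w)"
      using int[of "k + 1"] wint False by (subst expo_of_nat_combination) auto
    also have "1 + inner m (e (i (k + 1))) + real (k + 1 - l) * - inner m w = 1 + inner m (e (i l))"
      unfolding edge_point[OF 1(1)] edge_point[OF order_refl]
      using 1 by (simp add: inner_add_right of_nat_diff algebra_simps)
    finally show ?thesis using 1 by simp
  qed
next
  case 2
  then show ?thesis by (simp only: pull_off_edge lifted_exponent.simps)
qed

section \<open>Equations of the complete intersection\<close>

definition binomial_equation :: "nat \<Rightarrow> (coord \<Rightarrow> complex) \<Rightarrow> complex" where
  "binomial_equation j z = z (Sc (j + 1)) * z (Tc j) - z (Sc j) * z (Tc (j - 1))"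

lemma binomial_equation_eq:
  assumes "j \<in> {1..k}"
  shows "binomial_equation j z =
    (\<Sum>q\<in>{j - 1, j}. (if q = j then 1 else - 1) * (\<Prod>c\<in>V. z c ^ binomial_exponent q c))"
proof -
  have "j \<le> k" "j - 1 \<le> k" "j - 1 + 1 = j" "j - 1 \<noteq> j" using assms by auto
  then show ?thesis by (simp add: binomial_equation_def binomial_monomial del: One_nat_def)
qed

lemma edge_equations_eq:
  "edge_equations n e i k a = map binomial_equation [1..<k + 1] @ [lifted_poly n e i k a]"
  by (simp add: edge_equations_def binomial_equation_def[abs_def])

lemma homogeneous_binomial_equation:
  assumes "j \<in> {1..k}"
  shows "\<exists>b. homogeneous T' b (binomial_equation j)"
proof -
  have eq: "pull V incidence (binomial_exponent q) r = pull V incidence (binomial_exponent j) r"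
    if "q \<in> {j - 1, j}" "r \<in> {1..n}" for q r
  proof -
    have "q \<le> k" "j \<le> k" using that(1) assms by auto
    then show ?thesis using that(2) by (simp only: pull_binomial_exponent)
  qed
  have "homogeneous T' (\<lambda>c. int (binomial_exponent j c)) (binomial_equation j)"
    by (rule homogeneousI[OF _ principal_if_pull_eq[OF eq] binomial_equation_eq[OF assms]]) simp
  then show ?thesis by (rule exI[of _ "\<lambda>c. int (binomial_exponent j c)"])
qed

lemma homogeneous_lifted_poly:
  assumes fin: "finite (Delta n e \<inter> std_lattice)"
  shows "\<exists>b. homogeneous T' b (lifted_poly n e i k a)"
proof -
  \<comment> \<open>The term of \<open>m = 0\<close> serves as reference: it pulls back to exponent
    1 in every variable, the anticanonical degree. The other terms differ from it by the principal
    divisors of the characters \<open>m\<close>.\<close>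
  have 0: "0 \<in> Delta n e \<inter> std_lattice" by (simp add: Delta_def std_lattice_def)
  have "(\<lambda>c. int (lifted_exponent m c) - int (lifted_exponent 0 c)) \<in> principal_divisors T'"
    if m: "m \<in> Delta n e \<inter> std_lattice" for m
  proof -
    have "pull V incidence (\<lambda>c. int (lifted_exponent m c) - int (lifted_exponent 0 c)) \<in> principal_divisors T"
      unfolding principal_divisors_def base_toric_simps idx_T
    proof (intro CollectI exI[of _ "inner m"] conjI ballI)
      show "linear (inner m)" by (simp add: bounded_linear.linear bounded_linear_inner_right)
      show "inner m v \<in> \<int>" if "v \<in> std_lattice" for v using m that inner_std_lattice by blast
      fix r assume r: "r \<in> {1..n}"
      then have "inner m (e r) \<in> \<int>" "- 1 \<le> inner m (e r)"
        using m generator_lattice inner_std_lattice by (auto simp: Delta_def)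
      then obtain N where "inner m (e r) = real_of_int N" "- 1 \<le> N" by (auto elim!: Ints_cases)
      then show "real_of_int (pull V incidence (\<lambda>c. int (lifted_exponent m c) - int (lifted_exponent 0 c)) r) =
          inner m (e r)"
        by (simp add: pull_diff pull_of_nat pull_lifted_exponent[OF m r] pull_lifted_exponent[OF 0 r])
    qed
    then show ?thesis by (simp only: principal_pull_iff)
  qed
  then have "homogeneous T' (\<lambda>c. int (lifted_exponent 0 c)) (lifted_poly n e i k a)"
    by (intro homogeneousI[OF fin _ lifted_poly_eq])
  then show ?thesis by blast
qed

lemma anticanonical_poly_eq:
  "anticanonical_poly n e a x =
    (\<Sum>m\<in>Delta n e \<inter> std_lattice. a m * (\<Prod>r\<in>idx T. x r ^ expo (1 + inner m (e r))))"
  by (simp add: anticanonical_poly_def idx_T)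

lemma lifted_poly_push: "lifted_poly n e i k a (push x) = anticanonical_poly n e a x"
  unfolding lifted_poly_eq anticanonical_poly_eq push_monomial
  by (intro sum.cong arg_cong2[where f="(*)"] prod.cong refl) (simp add: pull_lifted_exponent idx_T)

lemma binomial_equation_push:
  assumes "j \<in> {1..k}"
  shows "binomial_equation j (push x) = 0"
proof -
  have "j \<le> k" "j - 1 \<le> k" using assms by auto
  then have "(\<Prod>c\<in>V. push x c ^ binomial_exponent j c) = (\<Prod>c\<in>V. push x c ^ binomial_exponent (j - 1) c)"
    unfolding push_monomial by (intro prod.cong refl) (simp only: pull_binomial_exponent idx_T)
  moreover have "j - 1 \<noteq> j" using assms by auto
  ultimately show ?thesis unfolding binomial_equation_eq[OF assms] by simp
qed

text \<open>Among semistable points the binomials cut out the image of \<open>push\<close>, where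
  the last polynomial restricts to f. In this form the two systems of equations enter the comparison
  of subvarieties.\<close>

lemma edge_equations_zeros:
  "{z \<in> semistable T'. \<forall>F\<in>set (edge_equations n e i k a). F z = 0} =
    push ` {x \<in> semistable T. \<forall>F\<in>set [anticanonical_poly n e a]. F x = 0}"
proof (intro equalityI subsetI)
  fix z assume z: "z \<in> {z \<in> semistable T'. \<forall>F\<in>set (edge_equations n e i k a). F z = 0}"
  then have bin: "binomial_equation j z = 0" if "j \<in> {1..k}" for j
  proof -
    have "binomial_equation j \<in> set (edge_equations n e i k a)"
      using that by (auto simp: edge_equations_eq simp del: upt_Suc)
    then show ?thesis using z by blast
  qed
  obtain x where x: "x \<in> semistable T" "push x = z"
  proof (rule push_semistable_surj)
    show "z \<in> semistable T'" using z by simp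
    show "z (Sc (j + 1)) * z (Tc j) = z (Sc j) * z (Tc (j - 1))" if "j \<in> {1..k}" for j
      using bin[OF that] by (simp add: binomial_equation_def)
  qed
  have "lifted_poly n e i k a z = 0" using z by (simp add: edge_equations_eq)
  then have "anticanonical_poly n e a x = 0" using lifted_poly_push[of a x] x(2) by simp
  then show "z \<in> push ` {x \<in> semistable T. \<forall>F\<in>set [anticanonical_poly n e a]. F x = 0}"
    using x by auto
next
  fix z assume "z \<in> push ` {x \<in> semistable T. \<forall>F\<in>set [anticanonical_poly n e a]. F x = 0}"
  then show "z \<in> {z \<in> semistable T'. \<forall>F\<in>set (edge_equations n e i k a). F z = 0}"
    using push_semistable binomial_equation_push lifted_poly_push
    by (auto simp: edge_equations_eq)
qed

section \<open>Linear relations among the rows of the Jacobian matrix\<close>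

lemma partial_binomial_Sc:
  assumes "j \<in> {1..k}"
  shows "partial (binomial_equation j) (Sc m) z =
    (if j = m - 1 then z (Tc j) else 0) - (if j = m then z (Tc (j - 1)) else 0)"
proof -
  have "(\<lambda>u. binomial_equation j (z(Sc m := u))) =
      (\<lambda>u. (if j + 1 = m then u else z (Sc (j + 1))) * z (Tc j) -
        (if j = m then u else z (Sc j)) * z (Tc (j - 1)))"
    by (rule ext) (simp add: binomial_equation_def)
  moreover have "deriv (\<lambda>u. (if j + 1 = m then u else z (Sc (j + 1))) * z (Tc j) -
        (if j = m then u else z (Sc j)) * z (Tc (j - 1))) (z (Sc m)) =
      (if j + 1 = m then 1 else 0) * z (Tc j) - (if j = m then 1 else 0) * z (Tc (j - 1))"
    by (rule DERIV_imp_deriv) (auto intro!: derivative_eq_intros)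
  moreover have "j + 1 = m \<longleftrightarrow> j = m - 1" using assms by auto
  ultimately show ?thesis unfolding partial_def by simp
qed

lemma partial_binomial_Tc:
  assumes "j \<in> {1..k}"
  shows "partial (binomial_equation j) (Tc m) z =
    (if j = m then z (Sc (j + 1)) else 0) - (if j = m + 1 then z (Sc j) else 0)"
proof -
  have "(\<lambda>u. binomial_equation j (z(Tc m := u))) =
      (\<lambda>u. z (Sc (j + 1)) * (if j = m then u else z (Tc j)) -
        z (Sc j) * (if j - 1 = m then u else z (Tc (j - 1))))"
    by (rule ext) (simp add: binomial_equation_def)
  moreover have "deriv (\<lambda>u. z (Sc (j + 1)) * (if j = m then u else z (Tc j)) -
        z (Sc j) * (if j - 1 = m then u else z (Tc (j - 1)))) (z (Tc m)) =
      z (Sc (j + 1)) * (if j = m then 1 else 0) - z (Sc j) * (if j - 1 = m then 1 else 0)"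
    by (rule DERIV_imp_deriv) (auto intro!: derivative_eq_intros)
  moreover have "j - 1 = m \<longleftrightarrow> j = m + 1" using assms by auto
  ultimately show ?thesis unfolding partial_def by simp
qed

text \<open>The column of t_m says that neighbouring coefficients agree when s_{m+1} is nonzero, the
  column of s_m does so when t_{m-1} is nonzero. Zero spreads upward from position 0 to
  \<open>p\<close> by the t-columns and downward from \<open>k + 1\<close> to \<open>p + 1\<close>
  by the s-columns.\<close>

lemma binomial_rows_independent:
  assumes z: "z \<in> semistable T'"
    and rel: "\<And>c. c \<in> V \<Longrightarrow> (\<Sum>j=1..k. \<mu> j * partial (binomial_equation j) c z) = 0"
    and j: "j \<in> {1..k}"
  shows "\<mu> j = 0"
proof -
  \<comment> \<open>Extension by zero to 0 and \<open>k + 1\<close> provides the two starting values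
    and makes the end columns obey the general formula.\<close>
  define \<nu> where "\<nu> j = (if j \<in> {1..k} then \<mu> j else 0)" for j
  obtain p where p: "p \<le> k" "\<And>j. j \<in> {1..p} \<Longrightarrow> z (Sc j) \<noteq> 0" "\<And>j. j \<in> {p + 1..k} \<Longrightarrow> z (Tc j) \<noteq> 0"
    using semistable_nonzero[OF z] by blast
  have pick: "(\<Sum>j=1..k. \<mu> j * (if j = q then f j else 0)) = \<nu> q * f q" for q and f :: "nat \<Rightarrow> complex"
    by (simp add: \<nu>_def if_distrib sum.delta cong: if_cong)
  have Sc_rel: "(\<nu> (m - 1) - \<nu> m) * z (Tc (m - 1)) = 0" if "m \<in> {1..k + 1}" for m
  proof -
    have "(\<Sum>j=1..k. \<mu> j * partial (binomial_equation j) (Sc m) z) =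
        (\<Sum>j=1..k. \<mu> j * (if j = m - 1 then z (Tc j) else 0)) -
        (\<Sum>j=1..k. \<mu> j * (if j = m then z (Tc (j - 1)) else 0))"
      unfolding sum_subtractf[symmetric] right_diff_distrib[symmetric]
      by (intro sum.cong refl) (simp only: partial_binomial_Sc)
    also have "\<dots> = (\<nu> (m - 1) - \<nu> m) * z (Tc (m - 1))"
      unfolding pick by (simp add: algebra_simps)
    finally show ?thesis using rel[of "Sc m"] that by (simp add: idx_T')
  qed
  have Tc_rel: "(\<nu> m - \<nu> (m + 1)) * z (Sc (m + 1)) = 0" if "m \<le> k" for m
  proof -
    have "(\<Sum>j=1..k. \<mu> j * partial (binomial_equation j) (Tc m) z) =
        (\<Sum>j=1..k. \<mu> j * (if j = m then z (Sc (j + 1)) else 0)) -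
        (\<Sum>j=1..k. \<mu> j * (if j = m + 1 then z (Sc j) else 0))"
      unfolding sum_subtractf[symmetric] right_diff_distrib[symmetric]
      by (intro sum.cong refl) (simp only: partial_binomial_Tc)
    also have "\<dots> = (\<nu> m - \<nu> (m + 1)) * z (Sc (m + 1))"
      unfolding pick by (simp add: algebra_simps)
    finally show ?thesis using rel[of "Tc m"] that by (simp add: idx_T')
  qed
  have low: "\<nu> m = 0" if "m \<le> p" for m
    using that
  proof (induction m)
    case (Suc m)
    then show ?case using Tc_rel[of m] p(1) p(2)[of "Suc m"] by simp
  qed (simp add: \<nu>_def)
  have high: "\<nu> m = 0" if "p + 1 \<le> m" "m \<le> k + 1" for m
    using that(2,1)
  proof (induction m rule: inc_induct)
    case (step m)
    then show ?case using Sc_rel[of "m + 1"] p(3)[of m] by simp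
  qed (simp add: \<nu>_def)
  have "\<nu> j = 0" using low[of j] high[of j] j by (cases "j \<le> p") auto
  then show ?thesis using j by (simp add: \<nu>_def)
qed

text \<open>The vector field \<open>\<Sum> z\<^sub>c \<partial>/\<partial>z\<^sub>c\<close> over the coordinates \<open>c\<close> whose monomial contains \<open>x\<^sub>r\<close>
  is \<open>push\<close>-related to \<open>x\<^sub>r \<partial>/\<partial>x\<^sub>r\<close>: it kills the binomial equations, and it maps the lifted
  polynomial to \<open>x\<^sub>r \<partial>f/\<partial>x\<^sub>r\<close>.\<close>

lemma euler_lifted_poly:
  assumes r: "r \<in> {1..n}"
  shows "(\<Sum>c | c \<in> V \<and> r \<in> incidence c. push x c * partial (lifted_poly n e i k a) c (push x)) =
    x r * partial (anticanonical_poly n e a) r x"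
proof -
  have "(\<Sum>c | c \<in> V \<and> r \<in> incidence c. push x c * partial (lifted_poly n e i k a) c (push x)) =
      (\<Sum>m\<in>Delta n e \<inter> std_lattice. a m * of_nat (pull V incidence (lifted_exponent m) r) *
        (\<Prod>c\<in>V. push x c ^ lifted_exponent m c))"
    by (rule euler_polynomial) (simp_all add: lifted_poly_eq)
  also have "\<dots> = (\<Sum>m\<in>Delta n e \<inter> std_lattice. a m * of_nat (expo (1 + inner m (e r))) *
        (\<Prod>r\<in>idx T. x r ^ expo (1 + inner m (e r))))"
    unfolding push_monomial
    by (intro sum.cong arg_cong2[where f="(*)"] prod.cong refl)
      (simp_all only: pull_lifted_exponent r idx_T)
  also have "\<dots> = x r * partial (anticanonical_poly n e a) r x"
    by (rule mult_partial_polynomial[symmetric]) (use r in \<open>simp_all add: anticanonical_poly_eq idx_T\<close>)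
  finally show ?thesis .
qed

text \<open>Both monomials have the same weight, so the operator multiplies the binomial by that
  weight, and the binomial is zero on the image of \<open>push\<close>.\<close>

lemma euler_binomial_equation:
  assumes r: "r \<in> {1..n}" and j: "j \<in> {1..k}"
  shows "(\<Sum>c | c \<in> V \<and> r \<in> incidence c. push x c * partial (binomial_equation j) c (push x)) = 0"
proof -
  let ?\<epsilon> = "if r \<in> i ` {0..k + 1} then 1 else 0 :: nat"
  have "pull V incidence (binomial_exponent q) r = ?\<epsilon>" if "q \<in> {j - 1, j}" for q
    by (rule pull_binomial_exponent) (use j r that in auto)
  note pull_\<epsilon> = this
  have "(\<Sum>c | c \<in> V \<and> r \<in> incidence c. push x c * partial (binomial_equation j) c (push x)) =
      (\<Sum>q\<in>{j - 1, j}. (if q = j then 1 else - 1) * of_nat (pull V incidence (binomial_exponent q) r) *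
        (\<Prod>c\<in>V. push x c ^ binomial_exponent q c))"
    by (rule euler_polynomial[OF _ binomial_equation_eq[OF j]]) simp
  also have "(\<Sum>q\<in>{j - 1, j}. (if q = j then 1 else - 1) * of_nat (pull V incidence (binomial_exponent q) r) *
        (\<Prod>c\<in>V. push x c ^ binomial_exponent q c)) =
      (\<Sum>q\<in>{j - 1, j}. of_nat ?\<epsilon> * ((if q = j then 1 else - 1) * (\<Prod>c\<in>V. push x c ^ binomial_exponent q c)))"
    by (intro sum.cong refl) (simp only: pull_\<epsilon> mult_ac)
  also have "\<dots> = of_nat ?\<epsilon> * binomial_equation j (push x)"
    unfolding binomial_equation_eq[OF j] by (simp only: sum_distrib_left)
  finally show ?thesis by (simp add: binomial_equation_push[OF j])
qed

lemma quasismooth_edge_equations: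
  assumes fin: "finite (Delta n e \<inter> std_lattice)"
    and nondeg: "nondegenerate T (anticanonical_poly n e a)"
  shows "quasismooth T' (edge_equations n e i k a)"
  unfolding quasismooth_def
proof (intro conjI ballI impI)
  fix F assume "F \<in> set (edge_equations n e i k a)"
  then show "\<exists>b. homogeneous T' b F"
    using homogeneous_binomial_equation homogeneous_lifted_poly[OF fin]
    by (auto simp: edge_equations_eq)
next
  let ?Fs = "edge_equations n e i k a"
  fix z assume z: "z \<in> semistable T'" and F0: "\<forall>F\<in>set ?Fs. F z = 0"
  then have "z \<in> push ` {x \<in> semistable T. \<forall>F\<in>set [anticanonical_poly n e a]. F x = 0}"
    using edge_equations_zeros by blast
  then obtain x where x: "x \<in> semistable T" "z = push x" by blast
  \<comment> \<open>The index \<open>r\<close> depends on the point; its Euler operator isolates the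
    coefficient of the last row.\<close>
  obtain r where r: "r \<in> {1..n}" and nz: "x r * partial (anticanonical_poly n e a) r x \<noteq> 0"
    using nondeg x(1) unfolding nondegenerate_def idx_T by blast
  have len: "length ?Fs = k + 1" by (simp add: edge_equations_eq)
  show "vec_space.rank (length ?Fs) (jacobian T' ?Fs z) = length ?Fs"
  proof (rule complex_rank_eq_dim)
    show "jacobian T' ?Fs z \<in> carrier_mat (length ?Fs) (length (vars T'))"
      by (simp add: jacobian_def)
    fix v assume v: "\<And>c. c < length (vars T') \<Longrightarrow>
      (\<Sum>q<length ?Fs. v q * jacobian T' ?Fs z $$ (q, c)) = 0"
    \<comment> \<open>Rows are numbered from 0: the binomial of index \<open>j\<close> is in row
      \<open>j - 1\<close>, the last polynomial in row \<open>k\<close>.\<close>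
    have split: "(\<Sum>q<length ?Fs. v q * h (?Fs ! q)) =
        (\<Sum>j=1..k. v (j - 1) * h (binomial_equation j)) + v k * h (lifted_poly n e i k a)"
      for h :: "_ \<Rightarrow> complex"
    proof -
      have "?Fs ! q = binomial_equation (q + 1)" if "q < k" for q
        using that by (simp add: edge_equations_eq nth_append del: upt_Suc)
      moreover have "?Fs ! k = lifted_poly n e i k a" by (simp add: edge_equations_eq nth_append del: upt_Suc)
      ultimately have "(\<Sum>q<length ?Fs. v q * h (?Fs ! q)) =
          (\<Sum>q<k. v q * h (binomial_equation (q + 1))) + v k * h (lifted_poly n e i k a)"
        by (simp add: len)
      also have "(\<Sum>q<k. v q * h (binomial_equation (q + 1))) = (\<Sum>j=1..k. v (j - 1) * h (binomial_equation j))"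
        by (rule sum.reindex_bij_witness[of _ "\<lambda>j. j - 1" "\<lambda>q. q + 1"]) auto
      finally show ?thesis .
    qed
    have rel: "(\<Sum>j=1..k. v (j - 1) * partial (binomial_equation j) c z) +
        v k * partial (lifted_poly n e i k a) c z = 0" if c: "c \<in> V" for c
    proof -
      obtain d where d: "d < length (vars T')" "vars T' ! d = c"
        using c by (auto simp: in_set_conv_nth)
      then have "(\<Sum>q<length ?Fs. v q * partial (?Fs ! q) c z) = 0"
        using v[OF d(1)] by (simp add: jacobian_def)
      then show ?thesis using split[of "\<lambda>F. partial F c z"] by simp
    qed
    let ?C = "{c \<in> V. r \<in> incidence c}"
    have "0 = (\<Sum>c\<in>?C. z c * ((\<Sum>j=1..k. v (j - 1) * partial (binomial_equation j) c z) +
        v k * partial (lifted_poly n e i k a) c z))"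
      using rel by simp
    also have "\<dots> = (\<Sum>j=1..k. v (j - 1) * (\<Sum>c\<in>?C. z c * partial (binomial_equation j) c z)) +
        v k * (\<Sum>c\<in>?C. z c * partial (lifted_poly n e i k a) c z)"
      unfolding distrib_left sum.distrib sum_distrib_left
      by (subst sum.swap) (simp add: mult_ac)
    also have "\<dots> = v k * (x r * partial (anticanonical_poly n e a) r x)"
      using euler_lifted_poly[OF r] euler_binomial_equation[OF r] by (simp add: x(2))
    finally have vk: "v k = 0" using nz by simp
    have v0: "v (j - 1) = 0" if "j \<in> {1..k}" for j
      by (rule binomial_rows_independent[OF z _ that, where \<mu> = "\<lambda>j. v (j - 1)"])
        (use rel vk in simp)
    show "\<forall>q<length ?Fs. v q = 0"
    proof (intro allI impI)
      fix q assume "q < length ?Fs"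
      then show "v q = 0" using vk v0[of "q + 1"] by (cases "q = k") (simp_all add: len)
    qed
  qed
qed

end

theorem proposition4p4:
  fixes n k :: nat
    and e :: "nat \<Rightarrow> real ^ 'd"
    and \<Sigma> :: "(real ^ 'd) set set"
    and \<Gamma> :: "(real ^ 'd) set"
    and i :: "nat \<Rightarrow> nat"
    and a :: "real ^ 'd \<Rightarrow> complex"
  assumes "fan std_lattice \<Sigma>" and "complete_fan \<Sigma>" and "simplicial_fan \<Sigma>"
    and "bij_betw e {1..n} (minimal_generators std_lattice \<Sigma>)"
    and "semiample_anticanonical (base_toric n e \<Sigma>)"
    and "reflexive (Delta n e)"
    and "\<forall>l\<in>{1..n}. e l \<in> frontier (polar (Delta n e))"
    and "\<Gamma> edge_of polar (Delta n e)"
    and "i ` {0..k + 1} \<subseteq> {1..n}"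
    and "bij_betw (e \<circ> i) {0..k + 1} (\<Gamma> \<inter> std_lattice)"
    and "\<forall>p q r. p < q \<and> q < r \<and> r \<le> k + 1 \<longrightarrow> e (i q) \<in> open_segment (e (i p)) (e (i r))"
    and "nondegenerate (base_toric n e \<Sigma>) (anticanonical_poly n e a)"
  shows "quasismooth (edge_toric n e \<Sigma> i k) (edge_equations n e i k a) \<and>
    isomorphic_via
      (base_toric n e \<Sigma>) (subvariety (base_toric n e \<Sigma>) [anticanonical_poly n e a])
      (edge_toric n e \<Sigma> i k) (subvariety (edge_toric n e \<Sigma> i k) (edge_equations n e i k a))
      (edge_embedding n i k)"
proof -
  have cvx: "convex \<Gamma>"
    using assms(8) face_of_imp_convex unfolding edge_of_def by blast
  interpret edge_configuration n k e \<Sigma> i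
  proof
    show "fan std_lattice \<Sigma>" by fact
    show "e l \<in> minimal_generators std_lattice \<Sigma>" if "l \<in> {1..n}" for l
      using assms(4) that by (rule bij_betw_apply)
    show "i l \<in> {1..n}" if "l \<le> k + 1" for l
    proof -
      have "i l \<in> i ` {0..k + 1}" using that by simp
      then show ?thesis using assms(9) by blast
    qed
    show "inj_on i {0..k + 1}"
      using bij_betw_imp_inj_on[OF assms(10)] by (rule inj_on_imageI2)
    show ord: "e (i q) \<in> open_segment (e (i p)) (e (i r))" if "p < q" "q < r" "r \<le> k + 1" for p q r
      using assms(11) that by blast
    show "e (i l) = e (i 0) + real l *\<^sub>R ((1 / real (k + 1)) *\<^sub>R (e (i (k + 1)) - e (i 0)))"
      if "l \<le> k + 1" for l
      using lattice_points_equidistant[OF cvx assms(10) _ that] ord by simp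
  qed
  \<comment> \<open>A reflexive polytope is bounded, so f and its lift are finite sums of
    monomials.\<close>
  have "bounded (Delta n e)"
    using assms(6) polytope_imp_bounded unfolding reflexive_def lattice_polytope_at_0_def by blast
  then have fin: "finite (Delta n e \<inter> std_lattice)" by (rule finite_bounded_std_lattice)
  show ?thesis
    using quasismooth_edge_equations[OF fin assms(12)]
      isomorphic_via_push[OF edge_equations_zeros]
    by (simp only: push_edge_embedding)
qed

end
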